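(* Let $\Omega\subseteq\mathbb{R}^n$ be a smooth bounded $1$-admissible domain. Let $\varphi \in C^2(\Omega) \cap C(\overline{\Omega})$ be spacelike and affine. Suppose $\psi(x,z,p) \in C^{\infty}(\overline{\Omega} \times \mathbb{R} \times \mathbb{R}^n)$ is positive. If $u \in C^4(\Omega) \cap C^2(\overline{\Omega})$ is a $2$-admissible solution to \[\sigma_2[u]=\psi(x,u, Du)\ \text{ in } \Omega,\qquad u=\varphi\ \text{ on } \partial\Omega,\] then the maximum principal curvature $\kappa_{\max}(x):=\max_{1 \leq i \leq n} \kappa_i(x)$ of its graph $\Sigma$ satisfies \[\sup_{\Omega'}\kappa_{\max} \leq C(\Omega')\] for any $\Omega' \subset \subset \Omega$, where $C(\Omega')>0$ depends (besides $\Omega'$) on $n, \theta, \|\psi\|_{C^2(\mathcal{D})}, \inf_{\mathcal{D}} \psi,$ and $\|\varphi\|_{C^1(\overline{\Omega})}$; here $\theta\in(0,1)$ is a constant such that $\sup_{\overline\Omega}|Du|\le 1-\theta$, and \[\mathcal{D}:=\overline{\Omega} \times [\inf_{\Omega} u, \sup_{\Omega} u] \times \mathbb{R}^n.\]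
   Context: The Minkowski space $\mathbb{R}^{n,1}$ is $\mathbb{R}^{n+1}$ with the metric $dx_1^2+\cdots+dx_n^2-dx_{n+1}^2$. $D$ and $D^2$ denote the ordinary gradient and Hessian in $\mathbb{R}^n$. A function $u$ on $\overline{\Omega}$ is spacelike if $\sup_{\overline{\Omega}}|Du|<1$ (equivalently, its graph $\Sigma=\{(x,u(x)) : x\in\overline\Omega\}$ is a spacelike hypersurface of $\mathbb{R}^{n,1}$). For spacelike $u$, the principal curvatures $\kappa(x)=(\kappa_1(x),\ldots,\kappa_n(x))$ of its graph at $(x,u(x))$ are the eigenvalues of the matrix \[\frac{1}{w}\left(I+\frac{Du\otimes Du}{w^2}\right)D^2u,\qquad w=\sqrt{1-|Du|^2}.\] $\sigma_k(\kappa)=\sum_{1\le i_1<\cdots<i_k\le n}\kappa_{i_1}\cdots\kappa_{i_k}$ is the $k$-th elementary symmetric polynomial, and $\sigma_k[u](x):=\sigma_k(\kappa(x))$. A function $u$ (with the regularity stated in the claim) is $k$-admissible if its graph over $\overline\Omega$ is a $k$-convex spacelike hypersurface, i.e. $\sup_{\overline\Omega}|Du|<1$ and $\sigma_j[u]>0$ for all $x\in\overline\Omega$ and all $1\le j\le k$. A smooth bounded domain $\Omega\subseteq\mathbb{R}^n$ is $(k-1)$-admissible if at every point of $\partial\Omega$ at least $k-1$ principal curvatures of $\partial\Omega$ (relative to the interior normal) are positive. *)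

theory Defs
  imports "HOL-Analysis.Analysis" "HOL-Computational_Algebra.Polynomial"
begin

text \<open>Partial derivatives and the classes $C^k$. A multi-index is a list of directions from
  \<^const>\<open>Basis\<close>; the order of the list is immaterial for $C^k$ functions.\<close>

fun partials :: "'a list \<Rightarrow> ('a \<Rightarrow> real) \<Rightarrow> 'a::euclidean_space \<Rightarrow> real" where
  "partials [] f = f"
| "partials (b # bs) f = (\<lambda>x. frechet_derivative (partials bs f) (at x) b)"

definition multi_indices :: "nat \<Rightarrow> 'a::euclidean_space list set" where
  "multi_indices j = {bs. set bs \<subseteq> Basis \<and> length bs = j}"

definition Ck_on :: "nat \<Rightarrow> 'a::euclidean_space set \<Rightarrow> ('a \<Rightarrow> real) \<Rightarrow> bool" where
  "Ck_on k U f \<longleftrightarrow>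
     (\<forall>j<k. \<forall>bs\<in>multi_indices j. \<forall>x\<in>U. partials bs f differentiable (at x)) \<and>
     (\<forall>j\<le>k. \<forall>bs\<in>multi_indices j. continuous_on U (partials bs f))"

text \<open>For $x \in \partial U$, \<open>bdry_ext U g x\<close> is the value at \<open>x\<close> of the continuous extension of
  \<open>g\<close> from the open set \<open>U\<close> to \<open>closure U\<close>. Functions in $C^k(\overline U)$ are those
  in $C^k(U)$ all of whose derivatives of order at most $k$ extend continuously to $\overline U$;
  their derivatives on $\partial U$ are always understood in this sense.\<close>

definition bdry_ext :: "'a::topological_space set \<Rightarrow> ('a \<Rightarrow> real) \<Rightarrow> 'a \<Rightarrow> real" where
  "bdry_ext U g x = (if x \<in> U then g x else Lim (at x within U) g)"

definition Ck_closure :: "nat \<Rightarrow> 'a::euclidean_space set \<Rightarrow> ('a \<Rightarrow> real) \<Rightarrow> bool" where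
  "Ck_closure k U f \<longleftrightarrow> Ck_on k U f \<and> continuous_on (closure U) f \<and>
     (\<forall>j\<le>k. \<forall>bs\<in>multi_indices j. continuous_on (closure U) (bdry_ext U (partials bs f)))"

text \<open>The norm $\sum_{j\le k}\max_{|\beta|=j}\sup_D |D^\beta f|$ over a set $D \subseteq \overline U$;
  it is extended-real valued because $D$ may be unbounded.\<close>

definition Ck_norm ::
  "nat \<Rightarrow> 'a::euclidean_space set \<Rightarrow> 'a set \<Rightarrow> ('a \<Rightarrow> real) \<Rightarrow> ereal" where
  "Ck_norm k U D f =
     (\<Sum>j\<le>k. SUP bs\<in>multi_indices j. SUP x\<in>D. ereal \<bar>bdry_ext U (partials bs f) x\<bar>)"

definition grad :: "(real^'n) set \<Rightarrow> (real^'n \<Rightarrow> real) \<Rightarrow> real^'n \<Rightarrow> real^'n" where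
  "grad \<Omega> u x = (\<chi> i. bdry_ext \<Omega> (partials [axis i 1] u) x)"

definition hess :: "(real^'n) set \<Rightarrow> (real^'n \<Rightarrow> real) \<Rightarrow> real^'n \<Rightarrow> real^'n^'n" where
  "hess \<Omega> u x = (\<chi> i j. bdry_ext \<Omega> (partials [axis i 1, axis j 1] u) x)"

text \<open>Eigenvalues with multiplicity are the roots of the characteristic polynomial. The vector
  is determined only up to a permutation of its entries (and is meaningful only if the
  characteristic polynomial splits over the reals); everything below is symmetric in the entries.\<close>

definition charpoly :: "real^'n^'n \<Rightarrow> real poly" where
  "charpoly A = det (\<chi> i j. (if i = j then [:0, 1:] else 0) - [:A $ i $ j:])"

definition eigenvalue_vec :: "real^'n^'n \<Rightarrow> real^'n" where
  "eigenvalue_vec A = (SOME \<kappa>. charpoly A = (\<Prod>i\<in>UNIV. [:- (\<kappa> $ i), 1:]))"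

definition elem_sym :: "nat \<Rightarrow> real^'n \<Rightarrow> real" where
  "elem_sym k \<kappa> = (\<Sum>I\<in>{I. card I = k}. \<Prod>i\<in>I. \<kappa> $ i)"

definition spacelike :: "(real^'n) set \<Rightarrow> (real^'n \<Rightarrow> real) \<Rightarrow> bool" where
  "spacelike \<Omega> u \<longleftrightarrow> (SUP x\<in>closure \<Omega>. ereal (norm (grad \<Omega> u x))) < 1"

definition outer :: "real^'n \<Rightarrow> real^'n \<Rightarrow> real^'n^'n" where
  "outer a b = (\<chi> i j. a $ i * b $ j)"

definition curv_matrix :: "(real^'n) set \<Rightarrow> (real^'n \<Rightarrow> real) \<Rightarrow> real^'n \<Rightarrow> real^'n^'n" where
  "curv_matrix \<Omega> u x =
     (let p = grad \<Omega> u x; w = sqrt (1 - (norm p)\<^sup>2)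
      in (1 / w) *\<^sub>R ((mat 1 + (1 / w\<^sup>2) *\<^sub>R outer p p) ** hess \<Omega> u x))"

definition principal_curvatures :: "(real^'n) set \<Rightarrow> (real^'n \<Rightarrow> real) \<Rightarrow> real^'n \<Rightarrow> real^'n" where
  "principal_curvatures \<Omega> u x = eigenvalue_vec (curv_matrix \<Omega> u x)"

definition sigma_k :: "nat \<Rightarrow> (real^'n) set \<Rightarrow> (real^'n \<Rightarrow> real) \<Rightarrow> real^'n \<Rightarrow> real" where
  "sigma_k k \<Omega> u x = elem_sym k (principal_curvatures \<Omega> u x)"

definition kappa_max :: "(real^'n) set \<Rightarrow> (real^'n \<Rightarrow> real) \<Rightarrow> real^'n \<Rightarrow> real" where
  "kappa_max \<Omega> u x = Max (range (\<lambda>i. principal_curvatures \<Omega> u x $ i))"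

definition k_admissible :: "nat \<Rightarrow> (real^'n) set \<Rightarrow> (real^'n \<Rightarrow> real) \<Rightarrow> bool" where
  "k_admissible k \<Omega> u \<longleftrightarrow>
     spacelike \<Omega> u \<and> (\<forall>x\<in>closure \<Omega>. \<forall>j\<in>{1..k}. sigma_k j \<Omega> u x > 0)"

text \<open>\<open>\<Omega>\<close> lies locally, and on one side only, in the region where a smooth function with
  nonvanishing gradient is positive. Hence \<open>sgn (grad V \<rho> y)\<close> is the interior unit normal field
  at the boundary points in \<open>V\<close>.\<close>

definition local_defining ::
  "(real^'n) set \<Rightarrow> real^'n \<Rightarrow> (real^'n) set \<Rightarrow> (real^'n \<Rightarrow> real) \<Rightarrow> bool" where
  "local_defining \<Omega> x V \<rho> \<longleftrightarrow> open V \<and> x \<in> V \<and> (\<forall>k. Ck_on k V \<rho>) \<and>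
     (\<forall>y\<in>V. grad V \<rho> y \<noteq> 0) \<and> \<Omega> \<inter> V = {y\<in>V. \<rho> y > 0}"

definition smooth_bounded_domain :: "(real^'n) set \<Rightarrow> bool" where
  "smooth_bounded_domain \<Omega> \<longleftrightarrow> open \<Omega> \<and> connected \<Omega> \<and> \<Omega> \<noteq> {} \<and> bounded \<Omega> \<and>
     (\<forall>x\<in>frontier \<Omega>. \<exists>V \<rho>. local_defining \<Omega> x V \<rho>)"

text \<open>\<open>X\<close> is a unit tangent vector at \<open>x\<close> which is an eigenvector, with eigenvalue \<open>\<mu>\<close>, of the
  Weingarten map $X \mapsto -D_X\nu$ of $\partial\Omega$, where $\nu$ is the interior unit normal
  (so that spheres bounding balls have positive principal curvatures).\<close>

definition bdry_principal_direction ::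
  "(real^'n) set \<Rightarrow> real^'n \<Rightarrow> real \<Rightarrow> real^'n \<Rightarrow> bool" where
  "bdry_principal_direction \<Omega> x \<mu> X \<longleftrightarrow>
     (\<exists>V \<rho>. local_defining \<Omega> x V \<rho> \<and> norm X = 1 \<and> X \<bullet> grad V \<rho> x = 0 \<and>
        - frechet_derivative (\<lambda>y. sgn (grad V \<rho> y)) (at x) X = \<mu> *\<^sub>R X)"

text \<open>At every boundary point at least \<open>m\<close> principal curvatures, counted with multiplicity, are
  positive: multiplicity is expressed through orthonormal principal directions.\<close>

definition admissible_domain :: "nat \<Rightarrow> (real^'n) set \<Rightarrow> bool" where
  "admissible_domain m \<Omega> \<longleftrightarrow>
     (\<forall>x\<in>frontier \<Omega>. \<exists>B. finite B \<and> card B = m \<and> pairwise orthogonal B \<and>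
        (\<forall>X\<in>B. \<exists>\<mu>>0. bdry_principal_direction \<Omega> x \<mu> X))"

definition compactly_contained :: "'a::topological_space set \<Rightarrow> 'a set \<Rightarrow> bool"
    (infix "\<subset>\<subset>" 50) where
  "A \<subset>\<subset> B \<longleftrightarrow> compact (closure A) \<and> closure A \<subseteq> B"

definition affine_on :: "(real^'n) set \<Rightarrow> (real^'n \<Rightarrow> real) \<Rightarrow> bool" where
  "affine_on S f \<longleftrightarrow> (\<exists>a b. \<forall>x\<in>S. f x = a \<bullet> x + b)"

text \<open>The open domain $\Omega \times \mathbb{R} \times \mathbb{R}^n$ of \<open>\<psi>\<close>, and the set
  $\mathcal{D} = \overline\Omega \times [\inf_\Omega u, \sup_\Omega u] \times \mathbb{R}^n$.\<close>

definition psi_dom :: "(real^'n) set \<Rightarrow> ((real^'n) \<times> real \<times> (real^'n)) set" where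
  "psi_dom \<Omega> = \<Omega> \<times> UNIV \<times> UNIV"

definition DD :: "(real^'n) set \<Rightarrow> (real^'n \<Rightarrow> real) \<Rightarrow> ((real^'n) \<times> real \<times> (real^'n)) set" where
  "DD \<Omega> u = closure \<Omega> \<times> {(INF x\<in>\<Omega>. u x)..(SUP x\<in>\<Omega>. u x)} \<times> UNIV"

end

theory Submission
  imports Defs
begin

text \<open>
  The mean curvature \<open>H\<close> bounds every principal curvature because \<open>\<sigma>\<^sub>2 > 0\<close>, and unlike
  \<open>\<kappa>\<^sub>m\<^sub>a\<^sub>x\<close> it is smooth. With \<open>\<eta> = \<phi> - u\<close>, the function
  \<open>H \<eta>\<^sup>\<beta> exp (N |x|\<^sup>2 / 2)\<close> vanishes on the boundary, so it has an interior maximum. There the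
  linearized operator \<open>F\<^sup>i\<^sup>j \<nabla>\<^sub>i \<nabla>\<^sub>j\<close> of \<open>\<sigma>\<^sub>2\<close> is applied to its logarithm. Simons' identity
  expresses \<open>F\<^sup>i\<^sup>j \<nabla>\<^sub>i \<nabla>\<^sub>j H\<close> through \<open>\<Delta>\<psi>\<close>, the third-order terms \<open>|\<nabla>A|\<^sup>2 - |\<nabla>H|\<^sup>2\<close> and, by the sign
  of the Gauss equation in Minkowski space, the good term \<open>H \<Sum> f\<^sub>i \<kappa>\<^sub>i\<^sup>2\<close> with \<open>f\<^sub>i = H - \<kappa>\<^sub>i\<close>.

  If no principal curvature is close to \<open>H\<close>, then \<open>\<Sum> f\<^sub>i \<kappa>\<^sub>i\<^sup>2\<close> is of order \<open>H\<^sup>3\<close> and absorbs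
  everything. Otherwise a single \<open>\<kappa>\<^sub>1\<close> dominates; then the third-order terms control
  \<open>(1 + \<tau>) F\<^sup>i\<^sup>i |\<nabla>\<^sub>i log H|\<^sup>2\<close> in all directions \<open>i \<noteq> 1\<close>, which pays for \<open>\<eta>\<close> once \<open>\<beta>\<tau> \<ge> 2\<close>, the
  direction \<open>1\<close> is paid for by \<open>f\<^sub>1 \<kappa>\<^sub>1\<^sup>2\<close>, and the terms of order \<open>H\<close> coming from the gradient
  dependence of \<open>\<psi>\<close> are absorbed by \<open>N \<Sum> f\<^sub>i = N (n - 1) H\<close>. Either way \<open>H \<eta>\<close> is bounded at the
  maximum. Finally, \<open>H \<ge> (2 inf \<psi>)\<^sup>1\<^sup>/\<^sup>2\<close> and a quadratic barrier bound \<open>\<eta>\<close> from below on \<open>\<Omega>'\<close>.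
\<close>

section \<open>Functions of class $C^k$ and their directional derivatives\<close>


text \<open>No connection or curvature tensor is set up. At a point everything is read off from
  second-order Taylor expansions along the straight lines \<open>x0 + t *\<^sub>R e k\<close>, for a
  frame orthonormal in the induced metric I - Du Du^T. The Christoffel symbols of this metric are
  multiples of D^2 u, so in the frame the covariant second derivative of g in direction k is g_kk +
  \<mu>_k \<Sum> b_m g_m, a correction that cancels at a critical point. Simons' identity thereby
  becomes polynomial algebra in the derivatives of u.

  Affinity of \<phi> is what makes \<eta> a usable weight: D^2 \<eta> = - D^2 u, and \<Sum> f_i
  \<kappa>_i = 2 \<sigma>_2 by homogeneity, so the operator applied to \<eta> stays bounded however
  large H is.

  The bound must be uniform in \<phi>, \<psi> and u, which dictates the order of choices: N comes
  from the structural constants alone, \<beta> is then taken large compared with N^2, and only the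
  final bound depends on \<beta>. The choice of N must not depend on \<beta>; this is why the losses
  caused by \<beta> are left multiplied by f_1 or divided by \<eta>.\<close>

lemma line_derivative:
  fixes f :: "'a::euclidean_space \<Rightarrow> real"
  assumes "f differentiable (at (x + t *\<^sub>R e))"
  shows "((\<lambda>s. f (x + s *\<^sub>R e)) has_real_derivative frechet_derivative f (at (x + t *\<^sub>R e)) e) (at t)"
proof -
  let ?D = "frechet_derivative f (at (x + t *\<^sub>R e))"
  have D: "(f has_derivative ?D) (at (x + t *\<^sub>R e))"
    using assms frechet_derivative_works by blast
  have "((\<lambda>s. x + s *\<^sub>R e) has_derivative (\<lambda>s. s *\<^sub>R e)) (at t)"
    by (auto intro!: derivative_eq_intros)
  from diff_chain_at[OF this, of f ?D] D
  have "((\<lambda>s. f (x + s *\<^sub>R e)) has_derivative (\<lambda>s. ?D (s *\<^sub>R e))) (at t)"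
    by (simp add: o_def)
  moreover have "?D (s *\<^sub>R e) = ?D e * s" for s
    using linear_scale[OF linear_frechet_derivative[OF assms], of s e] by simp
  ultimately show ?thesis by (simp add: has_field_derivative_def)
qed

text \<open>The mean value theorem is applied first in direction \<open>a\<close>, to the difference
  of two parallel lines, and then in direction \<open>b\<close>. The left-hand side is symmetric in
  \<open>a\<close> and \<open>b\<close>, which is the source of Clairaut's theorem.\<close>

lemma second_difference_mvt:
  fixes f :: "'a::euclidean_space \<Rightarrow> real"
  assumes h: "0 < h"
    and R: "\<And>s t. \<lbrakk>0 \<le> s; s \<le> h; 0 \<le> t; t \<le> h\<rbrakk> \<Longrightarrow> x + s *\<^sub>R a + t *\<^sub>R b \<in> U"
    and d: "\<And>y. y \<in> U \<Longrightarrow> f differentiable (at y)"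
    and da: "\<And>y. y \<in> U \<Longrightarrow> (\<lambda>z. frechet_derivative f (at z) a) differentiable (at y)"
  obtains s t where "0 \<le> s" "s \<le> h" "0 \<le> t" "t \<le> h"
    "f (x + h *\<^sub>R a + h *\<^sub>R b) - f (x + h *\<^sub>R a) - f (x + h *\<^sub>R b) + f x
     = h\<^sup>2 * frechet_derivative (\<lambda>z. frechet_derivative f (at z) a) (at (x + s *\<^sub>R a + t *\<^sub>R b)) b"
proof -
  let ?a = "\<lambda>z. frechet_derivative f (at z) a"
  let ?g = "\<lambda>s. f ((x + h *\<^sub>R b) + s *\<^sub>R a) - f (x + s *\<^sub>R a)"
  have g: "(?g has_real_derivative (?a ((x + h *\<^sub>R b) + s *\<^sub>R a) - ?a (x + s *\<^sub>R a))) (at s)"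
    if "0 \<le> s" "s \<le> h" for s
    using that R[of s h] R[of s 0] h
    by (intro DERIV_diff line_derivative d) (auto simp: algebra_simps)
  obtain s where s: "0 < s" "s < h" "?g h - ?g 0 = (h - 0) * (?a ((x + h *\<^sub>R b) + s *\<^sub>R a) - ?a (x + s *\<^sub>R a))"
    using MVT2[OF h, of ?g "\<lambda>s. ?a ((x + h *\<^sub>R b) + s *\<^sub>R a) - ?a (x + s *\<^sub>R a)"] g by auto
  have k: "((\<lambda>t. ?a ((x + s *\<^sub>R a) + t *\<^sub>R b)) has_real_derivative
      frechet_derivative ?a (at ((x + s *\<^sub>R a) + t *\<^sub>R b)) b) (at t)" if "0 \<le> t" "t \<le> h" for t
    using that R[of s t] s by (intro line_derivative da) auto
  obtain t where t: "0 < t" "t < h" "?a ((x + s *\<^sub>R a) + h *\<^sub>R b) - ?a ((x + s *\<^sub>R a) + 0 *\<^sub>R b)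
     = (h - 0) * frechet_derivative ?a (at ((x + s *\<^sub>R a) + t *\<^sub>R b)) b"
    using MVT2[OF h, of "\<lambda>t. ?a ((x + s *\<^sub>R a) + t *\<^sub>R b)"
      "\<lambda>t. frechet_derivative ?a (at ((x + s *\<^sub>R a) + t *\<^sub>R b)) b"] k by auto
  show ?thesis
  proof (rule that[of s t])
    have "x + h *\<^sub>R b + s *\<^sub>R a = x + s *\<^sub>R a + h *\<^sub>R b" by (simp add: algebra_simps)
    then show "f (x + h *\<^sub>R a + h *\<^sub>R b) - f (x + h *\<^sub>R a) - f (x + h *\<^sub>R b) + f x
     = h\<^sup>2 * frechet_derivative ?a (at (x + s *\<^sub>R a + t *\<^sub>R b)) b"
      using s(3) t(3) by (simp add: power2_eq_square algebra_simps)
  qed (use s t in auto)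
qed

text \<open>One second difference equals both mixed derivatives, each at some point of a small
  parallelogram; continuity at \<open>x\<close> then identifies them. Arbitrary directions are
  allowed because the later frames are not coordinate frames.\<close>

lemma clairaut:
  fixes f :: "'a::euclidean_space \<Rightarrow> real"
  assumes U: "open U" "x \<in> U"
    and d: "\<And>y. y \<in> U \<Longrightarrow> f differentiable (at y)"
    and da: "\<And>y. y \<in> U \<Longrightarrow> (\<lambda>z. frechet_derivative f (at z) a) differentiable (at y)"
    and db: "\<And>y. y \<in> U \<Longrightarrow> (\<lambda>z. frechet_derivative f (at z) b) differentiable (at y)"
    and ca: "continuous_on U (\<lambda>x. frechet_derivative (\<lambda>z. frechet_derivative f (at z) a) (at x) b)"
    and cb: "continuous_on U (\<lambda>x. frechet_derivative (\<lambda>z. frechet_derivative f (at z) b) (at x) a)"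
  shows "frechet_derivative (\<lambda>z. frechet_derivative f (at z) a) (at x) b
       = frechet_derivative (\<lambda>z. frechet_derivative f (at z) b) (at x) a"
    (is "?A x = ?B x")
proof -
  have A: "isCont ?A x" and B: "isCont ?B x"
    using ca cb U continuous_on_eq_continuous_at by blast+
  have "\<bar>?A x - ?B x\<bar> \<le> e" if e: "0 < e" for e :: real
  proof -
    have "0 < e / 2" using e by simp
    obtain r1 where r1: "r1 > 0" "\<And>y. dist y x < r1 \<Longrightarrow> dist (?A y) (?A x) < e/2"
      using A \<open>0 < e/2\<close> unfolding continuous_at_eps_delta by metis
    obtain r2 where r2: "r2 > 0" "\<And>y. dist y x < r2 \<Longrightarrow> dist (?B y) (?B x) < e/2"
      using B \<open>0 < e/2\<close> unfolding continuous_at_eps_delta by metis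
    obtain r3 where r3: "r3 > 0" "ball x r3 \<subseteq> U" using U openE by blast
    define r where "r = Min {r1, r2, r3}"
    have r: "r > 0" "r \<le> r1" "r \<le> r2" "r \<le> r3" using r1 r2 r3 by (auto simp: r_def)
    \<comment> \<open>The parallelogram with sides \<open>h a\<close>, \<open>h b\<close> then lies
      within r/2 of \<open>x\<close>; the summand 1 keeps \<open>S\<close> positive when both
      directions vanish.\<close>
    define S where "S = norm a + norm b + 1"
    define h where "h = r / S / 2"
    have na: "S > 0" unfolding S_def by (smt (verit) norm_ge_zero)
    have h: "h > 0" using r na by (simp add: h_def)
    have near: "dist (x + s *\<^sub>R a + t *\<^sub>R b) x < r" if "0 \<le> s" "s \<le> h" "0 \<le> t" "t \<le> h" for s t
    proof -
      have "dist (x + s *\<^sub>R a + t *\<^sub>R b) x = norm (s *\<^sub>R a + t *\<^sub>R b)"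
        by (simp add: dist_norm algebra_simps)
      also have "\<dots> \<le> s * norm a + t * norm b"
        using norm_triangle_ineq[of "s *\<^sub>R a" "t *\<^sub>R b"] that by simp
      also have "\<dots> \<le> h * norm a + h * norm b"
        using that by (intro add_mono mult_right_mono) auto
      also have "\<dots> \<le> h * S" using h by (simp add: S_def algebra_simps)
      also have "\<dots> = r / 2" using na by (simp add: h_def)
      also have "\<dots> < r" using r by simp
      finally show ?thesis .
    qed
    have R: "x + s *\<^sub>R a + t *\<^sub>R b \<in> U" if "0 \<le> s" "s \<le> h" "0 \<le> t" "t \<le> h" for s t
      using near[OF that] r r3 by (auto simp: dist_commute subset_iff)
    obtain s t where st: "0 \<le> s" "s \<le> h" "0 \<le> t" "t \<le> h"
      "f (x + h *\<^sub>R a + h *\<^sub>R b) - f (x + h *\<^sub>R a) - f (x + h *\<^sub>R b) + f x = h\<^sup>2 * ?A (x + s *\<^sub>R a + t *\<^sub>R b)"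
      by (rule second_difference_mvt[of h x a b U f]) (use h R d da in auto)
    have R': "x + s *\<^sub>R b + t *\<^sub>R a \<in> U" if "0 \<le> s" "s \<le> h" "0 \<le> t" "t \<le> h" for s t
      using R[of t s] that by (simp add: algebra_simps)
    obtain t' s' where st': "0 \<le> t'" "t' \<le> h" "0 \<le> s'" "s' \<le> h"
      "f (x + h *\<^sub>R b + h *\<^sub>R a) - f (x + h *\<^sub>R b) - f (x + h *\<^sub>R a) + f x = h\<^sup>2 * ?B (x + t' *\<^sub>R b + s' *\<^sub>R a)"
      by (rule second_difference_mvt[of h x b a U f]) (use h R' d db in auto)
    have "x + h *\<^sub>R b + h *\<^sub>R a = x + h *\<^sub>R a + h *\<^sub>R b" by (simp add: algebra_simps)
    then have "f (x + h *\<^sub>R b + h *\<^sub>R a) = f (x + h *\<^sub>R a + h *\<^sub>R b)" by (rule arg_cong)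
    with st(5) st'(5) have "h\<^sup>2 * ?A (x + s *\<^sub>R a + t *\<^sub>R b) = h\<^sup>2 * ?B (x + t' *\<^sub>R b + s' *\<^sub>R a)"
      by linarith
    also have "x + t' *\<^sub>R b + s' *\<^sub>R a = x + s' *\<^sub>R a + t' *\<^sub>R b" by (simp add: algebra_simps)
    finally have eq: "?A (x + s *\<^sub>R a + t *\<^sub>R b) = ?B (x + s' *\<^sub>R a + t' *\<^sub>R b)"
      using h by simp
    have "dist (?A (x + s *\<^sub>R a + t *\<^sub>R b)) (?A x) < e/2"
      using r1(2) near[OF st(1-4)] r by force
    moreover have "dist (?B (x + s' *\<^sub>R a + t' *\<^sub>R b)) (?B x) < e/2"
      using r2(2) near[OF st'(3,4) st'(1,2)] r by force
    ultimately show ?thesis using eq unfolding dist_real_def by linarith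
  qed
  then have "\<bar>?A x - ?B x\<bar> \<le> 0" by (rule field_le_epsilon) simp
  then show ?thesis by simp
qed

section \<open>Iterated derivatives in arbitrary directions\<close>

lemma partials_append: "partials (as @ bs) f = partials as (partials bs f)"
  by (induction as) auto

lemma partials_cong_on:
  assumes "open U" "\<And>x. x \<in> U \<Longrightarrow> f x = g x" "x \<in> U"
  shows "partials bs f x = partials bs g x"
  using assms(3)
proof (induction bs arbitrary: x)
  case Nil
  then show ?case using assms by simp
next
  case (Cons b bs)
  have "(partials bs f has_derivative D) (at x) \<longleftrightarrow> (partials bs g has_derivative D) (at x)" for D
    using Cons assms(1)
    by (auto intro: has_derivative_transform_within_open[of _ _ x UNIV U])
  then show ?case by (simp add: frechet_derivative_def)
qed

lemma differentiable_cong_open: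
  fixes f g :: "'a::euclidean_space \<Rightarrow> real"
  assumes "open U" "x \<in> U" "\<And>x. x \<in> U \<Longrightarrow> f x = g x" "f differentiable (at x)"
  shows "g differentiable (at x)"
  using assms unfolding differentiable_def
  by (meson has_derivative_transform_within_open)

lemma Ck_on_cong:
  fixes f g :: "'a::euclidean_space \<Rightarrow> real"
  assumes "open U" "\<And>x. x \<in> U \<Longrightarrow> f x = g x" "Ck_on k U f"
  shows "Ck_on k U g"
proof -
  have *: "partials bs f x = partials bs g x" if "x \<in> U" for bs x
    using partials_cong_on[OF assms(1,2) that] .
  show ?thesis unfolding Ck_on_def
  proof (intro conjI allI impI ballI)
    fix j :: nat and bs :: "'a list" and x assume "j < k" "bs \<in> multi_indices j" "x \<in> U"
    then show "partials bs g differentiable (at x)"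
      using assms(3) differentiable_cong_open[OF assms(1) \<open>x \<in> U\<close>, of "partials bs f" "partials bs g"] *
      unfolding Ck_on_def by blast
  next
    fix j :: nat and bs :: "'a list" assume "j \<le> k" "bs \<in> multi_indices j"
    then have "continuous_on U (partials bs f)" using assms(3) unfolding Ck_on_def by blast
    then show "continuous_on U (partials bs g)" by (rule continuous_on_eq) (rule *)
  qed
qed

lemma partials_sum_scale:
  fixes f :: "'i \<Rightarrow> 'a::euclidean_space \<Rightarrow> real"
  assumes "open U" "finite I" "\<And>i. i \<in> I \<Longrightarrow> Ck_on k U (f i)"
    and "bs \<in> multi_indices j" "j \<le> k" "x \<in> U"
  shows "partials bs (\<lambda>y. \<Sum>i\<in>I. c i * f i y) x = (\<Sum>i\<in>I. c i * partials bs (f i) x)"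
  using assms(4-6)
proof (induction bs arbitrary: j x)
  case Nil
  then show ?case by simp
next
  case (Cons b bs)
  obtain j' where j': "j = Suc j'" "bs \<in> multi_indices j'" "j' < k"
    using Cons.prems by (auto simp: multi_indices_def)
  have d: "partials bs (f i) differentiable (at x)" if "i \<in> I" for i
    using assms(3)[OF that] Cons.prems j' unfolding Ck_on_def by blast
  have h: "((\<lambda>y. \<Sum>i\<in>I. c i * partials bs (f i) y) has_derivative
      (\<lambda>v. \<Sum>i\<in>I. c i * frechet_derivative (partials bs (f i)) (at x) v)) (at x)"
    using d frechet_derivative_works by (intro has_derivative_sum has_derivative_mult_right) blast
  have "((\<lambda>y. partials bs (\<lambda>y. \<Sum>i\<in>I. c i * f i y) y) has_derivative
      (\<lambda>v. \<Sum>i\<in>I. c i * frechet_derivative (partials bs (f i)) (at x) v)) (at x)"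
    by (rule has_derivative_transform_within_open[OF h assms(1) Cons.prems(3)])
       (use Cons.IH[OF j'(2)] j' in auto)
  from frechet_derivative_at[OF this] show ?case by (auto simp: fun_eq_iff)
qed

lemma Ck_on_sum_scale:
  fixes f :: "'i \<Rightarrow> 'a::euclidean_space \<Rightarrow> real"
  assumes "open U" "finite I" "\<And>i. i \<in> I \<Longrightarrow> Ck_on k U (f i)"
  shows "Ck_on k U (\<lambda>y. \<Sum>i\<in>I. c i * f i y)"
  unfolding Ck_on_def
proof (intro conjI allI impI ballI)
  fix j :: nat and bs :: "'a list" and x assume *: "j < k" "bs \<in> multi_indices j" "x \<in> U"
  have eq: "(\<Sum>i\<in>I. c i * partials bs (f i) y) = partials bs (\<lambda>y. \<Sum>i\<in>I. c i * f i y) y"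
    if "y \<in> U" for y
    using partials_sum_scale[OF assms *(2) _ that] * by simp
  have "(\<lambda>y. \<Sum>i\<in>I. c i * partials bs (f i) y) differentiable (at x)"
    using assms(2,3) * unfolding Ck_on_def
    by (intro differentiable_sum differentiable_mult differentiable_const) auto
  from differentiable_cong_open[OF assms(1) *(3) eq this]
  show "partials bs (\<lambda>y. \<Sum>i\<in>I. c i * f i y) differentiable (at x)" .
next
  fix j :: nat and bs :: "'a list" assume *: "j \<le> k" "bs \<in> multi_indices j"
  have "continuous_on U (\<lambda>y. \<Sum>i\<in>I. c i * partials bs (f i) y)"
    using assms(2,3) * unfolding Ck_on_def by (intro continuous_intros) auto
  then show "continuous_on U (partials bs (\<lambda>y. \<Sum>i\<in>I. c i * f i y))"
    by (rule continuous_on_eq) (rule partials_sum_scale[OF assms *(2,1), symmetric])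
qed

lemma Ck_on_mono: "Ck_on k U f \<Longrightarrow> j \<le> k \<Longrightarrow> Ck_on j U f"
  unfolding Ck_on_def by (meson le_trans less_le_trans)

lemma Ck_on_continuous: "Ck_on k U f \<Longrightarrow> continuous_on U f"
  unfolding Ck_on_def by (drule conjunct2, drule spec[of _ 0]) (auto simp: multi_indices_def)

lemma Ck_on_differentiable: "Ck_on (Suc k) U f \<Longrightarrow> x \<in> U \<Longrightarrow> f differentiable (at x)"
  unfolding Ck_on_def by (drule conjunct1, drule spec[of _ 0]) (auto simp: multi_indices_def)

lemma frechet_derivative_basis_expansion:
  fixes f :: "'a::euclidean_space \<Rightarrow> real"
  assumes "f differentiable (at x)"
  shows "frechet_derivative f (at x) v = (\<Sum>b\<in>Basis. (v \<bullet> b) * frechet_derivative f (at x) b)"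
proof -
  have "frechet_derivative f (at x) v = frechet_derivative f (at x) (\<Sum>b\<in>Basis. (v \<bullet> b) *\<^sub>R b)"
    by (simp add: euclidean_representation)
  also have "\<dots> = (\<Sum>b\<in>Basis. (v \<bullet> b) * frechet_derivative f (at x) b)"
    using linear_frechet_derivative[OF assms] by (simp add: linear_sum linear_scale)
  finally show ?thesis .
qed

text \<open>\<open>Ck_on\<close> mentions coordinate directions only. A derivative in direction
  \<open>v\<close> is a fixed linear combination of coordinate derivatives, so nothing is lost in
  passing to frame vectors.\<close>

lemma Ck_on_partials1:
  fixes f :: "'a::euclidean_space \<Rightarrow> real"
  assumes "open U" "Ck_on (Suc k) U f"
  shows "Ck_on k U (partials [v] f)"
proof -
  have b: "Ck_on k U (partials [b] f)" if "b \<in> Basis" for b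
    unfolding Ck_on_def partials_append[symmetric]
  proof (intro conjI allI impI ballI)
    fix j :: nat and bs :: "'a list" and x assume *: "j < k" "bs \<in> multi_indices j" "x \<in> U"
    then have "bs @ [b] \<in> multi_indices (Suc j)" "Suc j < Suc k"
      using that by (auto simp: multi_indices_def)
    then show "partials (bs @ [b]) f differentiable (at x)"
      using * assms(2) unfolding Ck_on_def by blast
  next
    fix j :: nat and bs :: "'a list" assume "j \<le> k" "bs \<in> multi_indices j"
    then have "bs @ [b] \<in> multi_indices (Suc j)" "Suc j \<le> Suc k"
      using that by (auto simp: multi_indices_def)
    then show "continuous_on U (partials (bs @ [b]) f)"
      using that assms(2) unfolding Ck_on_def by blast
  qed
  have "Ck_on k U (\<lambda>x. \<Sum>b\<in>Basis. (v \<bullet> b) * partials [b] f x)"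
    using Ck_on_sum_scale[where f = "\<lambda>b. partials [b] f" and c = "\<lambda>b. v \<bullet> b", OF assms(1) finite_Basis b]
    by blast
  moreover have "(\<Sum>b\<in>Basis. (v \<bullet> b) * partials [b] f x) = partials [v] f x" if "x \<in> U" for x
    using frechet_derivative_basis_expansion[OF Ck_on_differentiable[OF assms(2) that], of v] by simp
  ultimately show ?thesis by (rule Ck_on_cong[OF assms(1), rotated])
qed

lemma Ck_on_partials:
  fixes f :: "'a::euclidean_space \<Rightarrow> real"
  assumes "open U" "Ck_on (k + length vs) U f"
  shows "Ck_on k U (partials vs f)"
  using assms(2)
proof (induction vs arbitrary: k)
  case (Cons v vs)
  then have "Ck_on (Suc k) U (partials vs f)" by simp
  from Ck_on_partials1[OF assms(1) this, of v] show ?case by simp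
qed simp

lemma partials_swap2:
  fixes f :: "'a::euclidean_space \<Rightarrow> real"
  assumes "open U" "Ck_on 2 U f" "x \<in> U"
  shows "partials [a, b] f x = partials [b, a] f x"
proof -
  have 1: "Ck_on (Suc 0) U (partials [v] f)" for v
    using Ck_on_partials1[OF assms(1), of 1 f v] assms(2) by (simp add: numeral_2_eq_2)
  have 2: "Ck_on 0 U (partials [w, v] f)" for v w
    using Ck_on_partials[OF assms(1), of 0 "[w, v]" f] assms(2) by (simp add: numeral_2_eq_2)
  have "partials [b, a] f x = partials [a, b] f x"
    unfolding partials.simps
  proof (rule clairaut[OF assms(1,3)])
    show "f differentiable (at y)" if "y \<in> U" for y
      using Ck_on_differentiable[of 1] assms(2) that by (simp add: numeral_2_eq_2)
  qed (use Ck_on_differentiable[OF 1] Ck_on_continuous[OF 2] in auto)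
  then show ?thesis by simp
qed

text \<open>Adjacent transpositions at any depth generate all permutations: this gives the total
  symmetry of third derivatives and the equality of u_iikk and u_kkii.\<close>

lemma partials_swap:
  fixes f :: "'a::euclidean_space \<Rightarrow> real"
  assumes "open U" "Ck_on (2 + length bs) U f" "x \<in> U"
  shows "partials (as @ a # b # bs) f x = partials (as @ b # a # bs) f x"
proof -
  have C: "Ck_on 2 U (partials bs f)" using Ck_on_partials[OF assms(1,2)] .
  have "partials [a, b] (partials bs f) y = partials [b, a] (partials bs f) y" if "y \<in> U" for y
    by (rule partials_swap2[OF assms(1) C that])
  from partials_cong_on[OF assms(1) this assms(3), where bs = as]
  show ?thesis by (simp add: partials_append)
qed

section \<open>Second-order jets of functions of one real variable\<close>


text \<open>The first derivative must exist near 0, but be differentiable only at 0; this is the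
  weakest notion closed under the operations below and sufficient for the second derivative test.
  Keeping the coefficients explicit turns second derivatives of curvature into a calculation with
  triples.\<close>

definition jet2 :: "(real \<Rightarrow> real) \<Rightarrow> real \<Rightarrow> real \<Rightarrow> real \<Rightarrow> bool" where
  "jet2 f a b c \<longleftrightarrow> f 0 = a \<and>
     (\<exists>f'. (\<forall>\<^sub>F t in nhds 0. (f has_real_derivative f' t) (at t)) \<and> f' 0 = b \<and>
           (f' has_real_derivative c) (at 0))"

lemma jet2_eqI: "jet2 f a b c \<Longrightarrow> a = a' \<Longrightarrow> b = b' \<Longrightarrow> c = c' \<Longrightarrow> jet2 f a' b' c'"
  by simp

lemma jet2_const: "jet2 (\<lambda>t. a) a 0 0"
  unfolding jet2_def by (auto intro!: exI[of _ "\<lambda>_. 0"])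

lemma jet2_linear: "jet2 (\<lambda>t. a + t * b) a b 0"
  unfolding jet2_def
  by (auto intro!: exI[of _ "\<lambda>_. b"] derivative_eq_intros always_eventually)

lemma jet2_add:
  assumes "jet2 f a b c" "jet2 g a' b' c'"
  shows "jet2 (\<lambda>t. f t + g t) (a + a') (b + b') (c + c')"
proof -
  obtain f' g' where
    f: "\<forall>\<^sub>F t in nhds 0. (f has_real_derivative f' t) (at t)" "f' 0 = b" "(f' has_real_derivative c) (at 0)" and
    g: "\<forall>\<^sub>F t in nhds 0. (g has_real_derivative g' t) (at t)" "g' 0 = b'" "(g' has_real_derivative c') (at 0)"
    using assms unfolding jet2_def by auto
  have "\<forall>\<^sub>F t in nhds 0. ((\<lambda>t. f t + g t) has_real_derivative f' t + g' t) (at t)"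
    using f(1) g(1) by eventually_elim (rule DERIV_add)
  moreover have "((\<lambda>t. f' t + g' t) has_real_derivative c + c') (at 0)"
    using f(3) g(3) by (rule DERIV_add)
  ultimately show ?thesis
    using assms f(2) g(2) unfolding jet2_def by (auto intro!: exI[of _ "\<lambda>t. f' t + g' t"])
qed

lemma jet2_mult:
  assumes "jet2 f a b c" "jet2 g a' b' c'"
  shows "jet2 (\<lambda>t. f t * g t) (a * a') (b * a' + a * b') (c * a' + 2 * b * b' + a * c')"
proof -
  obtain f' g' where
    f: "\<forall>\<^sub>F t in nhds 0. (f has_real_derivative f' t) (at t)" "f' 0 = b" "(f' has_real_derivative c) (at 0)" and
    g: "\<forall>\<^sub>F t in nhds 0. (g has_real_derivative g' t) (at t)" "g' 0 = b'" "(g' has_real_derivative c') (at 0)"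
    using assms unfolding jet2_def by auto
  have f0: "(f has_real_derivative b) (at 0)" and g0: "(g has_real_derivative b') (at 0)"
    using eventually_nhds_x_imp_x[OF f(1)] eventually_nhds_x_imp_x[OF g(1)] f(2) g(2) by auto
  have "\<forall>\<^sub>F t in nhds 0. ((\<lambda>t. f t * g t) has_real_derivative f' t * g t + f t * g' t) (at t)"
    using f(1) g(1) by eventually_elim (auto intro!: derivative_eq_intros)
  moreover have "((\<lambda>t. f' t * g t + f t * g' t) has_real_derivative c * a' + 2 * b * b' + a * c') (at 0)"
    by (rule derivative_eq_intros f(3) g(3) f0 g0 refl)+
       (use f(2) g(2) assms in \<open>auto simp: jet2_def algebra_simps\<close>)
  ultimately show ?thesis
    using assms f(2) g(2) unfolding jet2_def
    by (auto intro!: exI[of _ "\<lambda>t. f' t * g t + f t * g' t"])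
qed

lemma jet2_cmult: "jet2 f a b c \<Longrightarrow> jet2 (\<lambda>t. k * f t) (k * a) (k * b) (k * c)"
  using jet2_mult[OF jet2_const[of k], of f a b c] by simp

lemma jet2_diff:
  assumes "jet2 f a b c" "jet2 g a' b' c'"
  shows "jet2 (\<lambda>t. f t - g t) (a - a') (b - b') (c - c')"
  using jet2_add[OF assms(1) jet2_cmult[OF assms(2), of "-1"]] by simp

lemma jet2_sum:
  assumes "finite I" "\<And>i. i \<in> I \<Longrightarrow> jet2 (f i) (a i) (b i) (c i)"
  shows "jet2 (\<lambda>t. \<Sum>i\<in>I. f i t) (\<Sum>i\<in>I. a i) (\<Sum>i\<in>I. b i) (\<Sum>i\<in>I. c i)"
  using assms by (induction I rule: finite_induct) (auto intro: jet2_const jet2_add)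

lemma jet2_DERIV: "jet2 f a b c \<Longrightarrow> (f has_real_derivative b) (at 0)"
  unfolding jet2_def using eventually_nhds_x_imp_x by blast

lemma jet2_isCont: "jet2 f a b c \<Longrightarrow> isCont f 0"
  using jet2_DERIV DERIV_isCont by blast

lemma jet2_compose:
  assumes f: "jet2 f a b c"
    and g: "\<forall>\<^sub>F y in nhds a. (g has_real_derivative g' y) (at y)" "(g' has_real_derivative g2) (at a)"
  shows "jet2 (\<lambda>t. g (f t)) (g a) (g' a * b) (g2 * b\<^sup>2 + g' a * c)"
proof -
  obtain f' where
    f': "\<forall>\<^sub>F t in nhds 0. (f has_real_derivative f' t) (at t)" "f' 0 = b" "(f' has_real_derivative c) (at 0)" "f 0 = a"
    using f unfolding jet2_def by auto
  have "(f \<longlongrightarrow> a) (nhds 0)"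
    using jet2_isCont[OF f] f'(4) by (simp add: continuous_at tendsto_nhds_iff isCont_def)
  then have "\<forall>\<^sub>F t in nhds 0. (g has_real_derivative g' (f t)) (at (f t))"
    using g(1) by (rule eventually_compose_filterlim[rotated])
  then have "\<forall>\<^sub>F t in nhds 0. ((\<lambda>t. g (f t)) has_real_derivative g' (f t) * f' t) (at t)"
    using f'(1) by eventually_elim (rule DERIV_chain2)
  moreover have "((\<lambda>t. g' (f t) * f' t) has_real_derivative g2 * b\<^sup>2 + g' a * c) (at 0)"
  proof -
    have "((\<lambda>t. g' (f t)) has_real_derivative g2 * b) (at 0)"
      using DERIV_chain2[OF _ jet2_DERIV[OF f], of g' g2] g(2) f'(4) by simp
    from DERIV_mult[OF this f'(3)] show ?thesis
      using f'(2,4) by (simp add: power2_eq_square algebra_simps)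
  qed
  ultimately show ?thesis
    using f' unfolding jet2_def by (auto intro!: exI[of _ "\<lambda>t. g' (f t) * f' t"])
qed

lemma jet2_inverse:
  assumes "jet2 f a b c" "a \<noteq> 0"
  shows "jet2 (\<lambda>t. 1 / f t) (1 / a) (- b / a\<^sup>2) (2 * b\<^sup>2 / a ^ 3 - c / a\<^sup>2)"
proof -
  have "\<forall>\<^sub>F y in nhds a. y \<noteq> 0" using assms(2) by (simp add: t1_space_nhds)
  then have "\<forall>\<^sub>F y in nhds a. ((\<lambda>y. 1 / y) has_real_derivative - 1 / y\<^sup>2) (at y)"
    by eventually_elim (auto intro!: derivative_eq_intros simp: power2_eq_square)
  moreover have "((\<lambda>y. - 1 / y\<^sup>2) has_real_derivative 2 / a ^ 3) (at a)"
    using assms(2) by (auto intro!: derivative_eq_intros simp: field_simps eval_nat_numeral)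
  ultimately have "jet2 (\<lambda>t. 1 / f t) (1 / a) ((- 1 / a\<^sup>2) * b) ((2 / a ^ 3) * b\<^sup>2 + (- 1 / a\<^sup>2) * c)"
    by (rule jet2_compose[OF assms(1)])
  then show ?thesis by (rule jet2_eqI) auto
qed

lemma jet2_ln:
  assumes "jet2 f a b c" "0 < a"
  shows "jet2 (\<lambda>t. ln (f t)) (ln a) (b / a) (c / a - b\<^sup>2 / a\<^sup>2)"
proof -
  have "\<forall>\<^sub>F y in nhds a. 0 < y" using assms(2)
    using eventually_nhds_in_open[of "{0<..}" a] by simp
  then have "\<forall>\<^sub>F y in nhds a. (ln has_real_derivative 1 / y) (at y)"
    by eventually_elim (auto intro!: derivative_eq_intros)
  moreover have "((\<lambda>y. 1 / y) has_real_derivative - 1 / a\<^sup>2) (at a)"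
    using assms(2) by (auto intro!: derivative_eq_intros simp: power2_eq_square)
  ultimately have "jet2 (\<lambda>t. ln (f t)) (ln a) ((1 / a) * b) ((- 1 / a\<^sup>2) * b\<^sup>2 + (1 / a) * c)"
    by (rule jet2_compose[OF assms(1)])
  then show ?thesis by (rule jet2_eqI) auto
qed

text \<open>Writing the value as w^2 keeps all coefficients rational in \<open>w\<close>, so that
  later identities are within reach of polynomial algebra.\<close>

lemma jet2_inverse_sqrt:
  assumes "jet2 f (w\<^sup>2) b c" "0 < w"
  shows "jet2 (\<lambda>t. 1 / sqrt (f t)) (1 / w) (- b / (2 * w ^ 3)) (3 * b\<^sup>2 / (4 * w ^ 5) - c / (2 * w ^ 3))"
proof -
  have w2: "0 < w\<^sup>2" using assms(2) by simp
  have "\<forall>\<^sub>F y in nhds (w\<^sup>2). 0 < y" using w2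
    using eventually_nhds_in_open[of "{0<..}" "w\<^sup>2"] by simp
  then have "\<forall>\<^sub>F y in nhds (w\<^sup>2). (sqrt has_real_derivative 1 / (2 * sqrt y)) (at y)"
    by eventually_elim (auto intro!: derivative_eq_intros simp: field_simps)
  moreover have "((\<lambda>y. 1 / (2 * sqrt y)) has_real_derivative - 1 / (4 * w ^ 3)) (at (w\<^sup>2))"
    using assms(2) w2 by (auto intro!: derivative_eq_intros simp: field_simps eval_nat_numeral)
  ultimately have "jet2 (\<lambda>t. sqrt (f t)) (sqrt (w\<^sup>2)) ((1 / (2 * sqrt (w\<^sup>2))) * b)
      ((- 1 / (4 * w ^ 3)) * b\<^sup>2 + (1 / (2 * sqrt (w\<^sup>2))) * c)"
    by (rule jet2_compose[OF assms(1)])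
  then have "jet2 (\<lambda>t. sqrt (f t)) w (b / (2 * w)) (- b\<^sup>2 / (4 * w ^ 3) + c / (2 * w))"
    by (rule jet2_eqI) (use assms(2) in auto)
  from jet2_inverse[OF this] show ?thesis
    by (rule jet2_eqI) (use assms(2) in \<open>auto simp: field_simps eval_nat_numeral\<close>)
qed

lemma jet2_cong:
  assumes "jet2 f a b c" "\<forall>\<^sub>F t in nhds 0. f t = g t"
  shows "jet2 g a b c"
proof -
  obtain f' where
    f': "\<forall>\<^sub>F t in nhds 0. (f has_real_derivative f' t) (at t)" "f' 0 = b" "(f' has_real_derivative c) (at 0)"
    using assms unfolding jet2_def by auto
  have "\<forall>\<^sub>F t in nhds 0. \<forall>\<^sub>F s in nhds t. f s = g s"
    using assms(2) by (simp add: eventually_eventually)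
  then have "\<forall>\<^sub>F t in nhds 0. (g has_real_derivative f' t) (at t)"
    using f'(1) by eventually_elim (use DERIV_cong_ev in blast)
  then show ?thesis
    using assms f'(2,3) eventually_nhds_x_imp_x[OF assms(2)] unfolding jet2_def by auto
qed

text \<open>This is how the equation \<sigma>_2 = \<psi> is differentiated: both sides have a jet
  computed in its own way, and the coefficients must agree.\<close>

lemma jet2_unique:
  assumes "jet2 f a b c" "jet2 f a' b' c'"
  shows "a = a'" "b = b'" "c = c'"
proof -
  obtain f1 where
    f1: "\<forall>\<^sub>F t in nhds 0. (f has_real_derivative f1 t) (at t)" "f1 0 = b" "(f1 has_real_derivative c) (at 0)"
    using assms(1) unfolding jet2_def by auto
  obtain f2 where
    f2: "\<forall>\<^sub>F t in nhds 0. (f has_real_derivative f2 t) (at t)" "f2 0 = b'" "(f2 has_real_derivative c') (at 0)"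
    using assms(2) unfolding jet2_def by auto
  have e: "\<forall>\<^sub>F t in nhds 0. f1 t = f2 t"
    using f1(1) f2(1) by eventually_elim (rule DERIV_unique)
  show "a = a'" using assms by (simp add: jet2_def)
  show "b = b'" using eventually_nhds_x_imp_x[OF e] f1(2) f2(2) by simp
  have "(f2 has_real_derivative c) (at 0)" using DERIV_cong_ev[OF refl e refl] f1(3) by blast
  then show "c = c'" using f2(3) DERIV_unique by blast
qed

lemma jet2_local_max:
  assumes j: "jet2 f a b c" and m: "\<forall>\<^sub>F t in nhds 0. f t \<le> a"
  shows "b = 0" "c \<le> 0"
proof -
  obtain f' where
    f': "\<forall>\<^sub>F t in nhds 0. (f has_real_derivative f' t) (at t)" "f' 0 = b" "(f' has_real_derivative c) (at 0)" "f 0 = a"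
    using j unfolding jet2_def by auto
  obtain d where d: "d > 0" "\<And>t. dist t 0 < d \<Longrightarrow> f t \<le> a \<and> (f has_real_derivative f' t) (at t)"
    using eventually_conj[OF m f'(1)] unfolding eventually_nhds_metric by blast
  show b: "b = 0"
    using DERIV_local_max[OF jet2_DERIV[OF j] d(1)] d(2) f'(4) by (auto simp: dist_real_def)
  \<comment> \<open>If c were positive, f' would be positive just to the right of its zero at 0, and
    f would exceed its maximum there.\<close>
  show "c \<le> 0"
  proof (rule ccontr)
    assume "\<not> c \<le> 0"
    then obtain e where e: "e > 0" "\<And>h. 0 < h \<Longrightarrow> h < e \<Longrightarrow> f' 0 < f' (0 + h)"
      using DERIV_pos_inc_right[OF f'(3)] by auto
    define t where "t = min d e / 2"
    have t: "0 < t" "t < d" "t < e" using d e by (auto simp: t_def)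
    obtain z where z: "0 < z" "z < t" "f t - f 0 = (t - 0) * f' z"
      using MVT2[OF t(1), of f f'] d(2) t by (auto simp: dist_real_def)
    have "f' z > 0" using e(2)[of z] z t b f'(2) by simp
    then have "t * f' z > 0" using t by simp
    then have "f t > a" using z(3) f'(4) by simp
    then show False using d(2)[of t] t by (simp add: dist_real_def)
  qed
qed

lemma eventually_line_in_open:
  fixes x :: "'a::real_normed_vector"
  assumes "open U" "x \<in> U"
  shows "\<forall>\<^sub>F t in nhds (0::real). x + t *\<^sub>R e \<in> U"
proof -
  have "isCont (\<lambda>t::real. x + t *\<^sub>R e) 0" by (intro continuous_intros)
  then have "((\<lambda>t::real. x + t *\<^sub>R e) \<longlongrightarrow> x) (nhds 0)"
    by (simp add: isCont_def tendsto_nhds_iff)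
  then show ?thesis using assms by (rule topological_tendstoD)
qed

lemma jet2_line:
  fixes f :: "'a::euclidean_space \<Rightarrow> real"
  assumes "open U" "x \<in> U" "Ck_on 2 U f"
  shows "jet2 (\<lambda>t. f (x + t *\<^sub>R e)) (f x) (partials [e] f x) (partials [e, e] f x)"
proof -
  have C1: "Ck_on (Suc 0) U (partials [e] f)"
    using Ck_on_partials[OF assms(1), of 1 "[e]" f] assms(3) by (simp add: numeral_2_eq_2)
  have "\<forall>\<^sub>F t in nhds 0. ((\<lambda>s. f (x + s *\<^sub>R e)) has_real_derivative partials [e] f (x + t *\<^sub>R e)) (at t)"
  proof (rule eventually_mono[OF eventually_line_in_open[OF assms(1,2), of e]])
    fix t assume "x + t *\<^sub>R e \<in> U"
    then have "f differentiable (at (x + t *\<^sub>R e))"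
      using Ck_on_differentiable[of 1 U f] assms(3) by (simp add: numeral_2_eq_2)
    from line_derivative[OF this]
    show "((\<lambda>s. f (x + s *\<^sub>R e)) has_real_derivative partials [e] f (x + t *\<^sub>R e)) (at t)" by simp
  qed
  moreover have "((\<lambda>t. partials [e] f (x + t *\<^sub>R e)) has_real_derivative partials [e, e] f x) (at 0)"
    using line_derivative[of "partials [e] f" x 0 e] Ck_on_differentiable[OF C1 assms(2)] by simp
  ultimately show ?thesis
    unfolding jet2_def by (auto intro!: exI[of _ "\<lambda>t. partials [e] f (x + t *\<^sub>R e)"])
qed


section \<open>Simultaneous diagonalization of the fundamental forms\<close>

lemma linear_coeff_zero_if_quadratic_nonpos:
  fixes p q :: real
  assumes "\<And>t. t * p + t\<^sup>2 * q \<le> 0"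
  shows "p = 0"
proof (rule ccontr)
  assume p: "p \<noteq> 0"
  \<comment> \<open>With t = p/s the expression is p^2 (s + q) / s^2, which is positive because s
    exceeds the absolute value of q.\<close>
  define s where "s = \<bar>q\<bar> + 1"
  define t where "t = p / s"
  have s: "0 < s" "0 < s + q" by (auto simp: s_def)
  have "t * p + t\<^sup>2 * q = (p\<^sup>2 / s\<^sup>2) * (s + q)"
    using s by (simp add: t_def power2_eq_square field_simps)
  moreover have "0 < (p\<^sup>2 / s\<^sup>2) * (s + q)"
    using p s by (intro mult_pos_pos) auto
  ultimately show False using assms[of t] by linarith
qed

text \<open>A maximizer \<open>x\<close> of the quadratic form on the unit sphere of
  \<open>V\<close> is an eigenvector. Moving from \<open>x\<close> along the residual y = f x -
  \<mu> x, which stays in \<open>V\<close>, changes the form minus \<mu> times the squared norm at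
  first order by 2 |y|^2; maximality forces y = 0.\<close>

lemma self_adjoint_has_eigenvector:
  fixes f :: "'a::euclidean_space \<Rightarrow> 'a"
  assumes f: "linear f" "\<And>x y. f x \<bullet> y = x \<bullet> f y"
    and V: "subspace V" "f ` V \<subseteq> V" "v \<in> V" "v \<noteq> 0"
  obtains x c where "x \<in> V" "norm x = 1" "f x = c *\<^sub>R x"
proof -
  let ?S = "V \<inter> sphere 0 1"
  have "compact ?S" using V by (simp add: closed_Int_compact closed_subspace)
  moreover have "(1 / norm v) *\<^sub>R v \<in> ?S" using V by (simp add: subspace_scale)
  then have "?S \<noteq> {}" by blast
  moreover have "continuous_on ?S (\<lambda>x. x \<bullet> f x)"
    using f(1) linear_continuous_on linear_conv_bounded_linear by (intro continuous_intros) auto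
  ultimately obtain x where x: "x \<in> ?S" "\<And>y. y \<in> ?S \<Longrightarrow> y \<bullet> f y \<le> x \<bullet> f x"
    using continuous_attains_sup[of ?S "\<lambda>x. x \<bullet> f x"] by blast
  define \<mu> where "\<mu> = x \<bullet> f x"
  have xV: "x \<in> V" and nx: "norm x = 1" using x by auto
  have xx: "x \<bullet> x = 1" using nx by (simp add: norm_eq_1)
  have le: "z \<bullet> f z \<le> \<mu> * (z \<bullet> z)" if "z \<in> V" for z
  proof (cases "z = 0")
    case True
    then show ?thesis using f(1) by (simp add: linear_0)
  next
    case False
    have "(1 / norm z) *\<^sub>R z \<in> ?S" using False that V by (simp add: subspace_scale)
    from x(2)[OF this] have "(1 / norm z)\<^sup>2 * (z \<bullet> f z) \<le> \<mu>"
      using f(1) by (simp add: linear_scale \<mu>_def power2_eq_square)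
    then show ?thesis using False
      by (simp add: divide_simps power2_norm_eq_inner mult.commute)
  qed
  define y where "y = f x - \<mu> *\<^sub>R x"
  have yV: "y \<in> V" using V xV by (auto simp: y_def subspace_diff subspace_scale)
  have "t * (2 * (y \<bullet> y)) + t\<^sup>2 * (y \<bullet> f y - \<mu> * (y \<bullet> y)) \<le> 0" for t
  proof -
    have "x + t *\<^sub>R y \<in> V" using V xV yV by (simp add: subspace_add subspace_scale)
    from le[OF this]
    have "x \<bullet> f x + t * (x \<bullet> f y) + t * (y \<bullet> f x) + t\<^sup>2 * (y \<bullet> f y)
        \<le> \<mu> * (x \<bullet> x) + 2 * t * \<mu> * (x \<bullet> y) + t\<^sup>2 * \<mu> * (y \<bullet> y)"
      using f(1) by (simp add: linear_add linear_scale inner_add_left inner_add_right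
          power2_eq_square algebra_simps inner_commute)
    moreover have "x \<bullet> f y = y \<bullet> f x" using f(2)[of x y] by (simp add: inner_commute)
    moreover have "y \<bullet> f x = y \<bullet> y + \<mu> * (x \<bullet> y)"
    proof -
      have "f x = y + \<mu> *\<^sub>R x" by (simp add: y_def)
      then show ?thesis by (simp add: inner_add_right inner_commute)
    qed
    moreover have "x \<bullet> f x = \<mu>" by (simp add: \<mu>_def)
    ultimately show ?thesis using xx by (simp add: algebra_simps)
  qed
  then have "2 * (y \<bullet> y) = 0" by (rule linear_coeff_zero_if_quadratic_nonpos)
  then have "f x = \<mu> *\<^sub>R x" by (simp add: y_def)
  then show ?thesis using that xV nx by blast
qed

text \<open>Stated for every invariant subspace, because the induction splits off one eigenvector
  and continues in its orthogonal complement, which is again invariant.\<close>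

lemma self_adjoint_eigenbasis:
  fixes f :: "'a::euclidean_space \<Rightarrow> 'a"
  assumes f: "linear f" "\<And>x y. f x \<bullet> y = x \<bullet> f y"
  shows "subspace V \<Longrightarrow> f ` V \<subseteq> V \<Longrightarrow>
    \<exists>B. finite B \<and> B \<subseteq> V \<and> card B = dim V \<and> pairwise orthogonal B \<and>
      (\<forall>b\<in>B. norm b = 1 \<and> (\<exists>c. f b = c *\<^sub>R b))"
proof (induction "dim V" arbitrary: V)
  case 0
  then show ?case by (intro exI[of _ "{}"]) auto
next
  case (Suc n)
  have "\<exists>v\<in>V. v \<noteq> 0"
  proof (rule ccontr)
    assume "\<not> ?thesis"
    then have "V \<subseteq> {0}" by auto
    then have "dim V = 0" by (simp add: dim_eq_0)
    then show False using Suc.hyps(2) by linarith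
  qed
  then obtain v where "v \<in> V" "v \<noteq> 0" by blast
  then obtain x c where x: "x \<in> V" "norm x = 1" "f x = c *\<^sub>R x"
    using self_adjoint_has_eigenvector[OF f] Suc.prems by metis
  define W where "W = {y \<in> V. \<forall>z\<in>span {x}. orthogonal z y}"
  have W: "W = {y \<in> V. x \<bullet> y = 0}"
    by (auto simp: W_def orthogonal_def span_singleton)
  have "span {x} \<subseteq> V" using x Suc.prems by (simp add: span_minimal)
  from dim_subspace_orthogonal_to_vectors[OF subspace_span Suc.prems(1) this]
  have "dim W + dim (span {x}) = dim V" unfolding W_def .
  moreover have "dim (span {x}) = 1"
    using x(2) by (auto simp: dim_insert)
  ultimately have dW: "n = dim W" using Suc by simp
  have "subspace W" unfolding W using Suc.prems(1)
    by (auto simp: subspace_def inner_add_right)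
  moreover have "f ` W \<subseteq> W"
  proof
    fix z assume "z \<in> f ` W"
    then obtain y where y: "y \<in> V" "x \<bullet> y = 0" "z = f y" unfolding W by auto
    have "x \<bullet> f y = f x \<bullet> y" using f(2) by simp
    then show "z \<in> W" using y Suc.prems x unfolding W by auto
  qed
  ultimately obtain B where B: "finite B" "B \<subseteq> W" "card B = dim W" "pairwise orthogonal B"
      "\<forall>b\<in>B. norm b = 1 \<and> (\<exists>c. f b = c *\<^sub>R b)"
    using Suc.hyps(1)[OF dW] by blast
  have "x \<notin> B" using B(2) x(2) unfolding W by (auto simp: norm_eq_1)
  show ?case
  proof (intro exI[of _ "insert x B"] conjI)
    show "card (insert x B) = dim V" using \<open>x \<notin> B\<close> B dW Suc by simp
    show "pairwise orthogonal (insert x B)"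
      using B(2,4) unfolding W by (auto simp: pairwise_insert orthogonal_def inner_commute)
  qed (use B x W in auto)
qed

lemma self_adjoint_orthonormal_frame:
  fixes f :: "real^'n \<Rightarrow> real^'n"
  assumes "linear f" "\<And>x y. f x \<bullet> y = x \<bullet> f y"
  obtains e :: "'n \<Rightarrow> real^'n" and c where
    "\<And>i j. e i \<bullet> e j = (if i = j then 1 else 0)" "\<And>i. f (e i) = c i *\<^sub>R e i"
proof -
  obtain B where B: "finite B" "card B = CARD('n)" "pairwise orthogonal B"
      "\<forall>b\<in>B. norm b = 1 \<and> (\<exists>c. f b = c *\<^sub>R b)"
    using self_adjoint_eigenbasis[OF assms, of UNIV] by auto
  obtain e where e: "bij_betw e (UNIV :: 'n set) B"
    using finite_same_card_bij[of "UNIV :: 'n set" B] B by auto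
  have eB: "e i \<in> B" for i using e by (auto simp: bij_betw_def)
  have "\<forall>i. \<exists>c. f (e i) = c *\<^sub>R e i" using B(4) eB by blast
  then obtain c where "\<And>i. f (e i) = c i *\<^sub>R e i" by metis
  moreover have "e i \<bullet> e j = (if i = j then 1 else 0)" for i j
  proof (cases "i = j")
    case True
    then show ?thesis using B(4) eB by (simp add: norm_eq_1)
  next
    case False
    then have "e i \<noteq> e j" using e by (auto simp: bij_betw_def inj_on_def)
    then show ?thesis using B(3) eB False by (auto simp: pairwise_def orthogonal_def)
  qed
  ultimately show ?thesis using that by blast
qed

text \<open>The frame diagonalizes both fundamental forms: apply the spectral theorem after conjugating
  with \<open>A\<close>, the square root of \<open>(I - p p\<^sup>T)\<^sup>-\<^sup>1\<close>.\<close>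

lemma principal_frame:
  fixes p :: "real^'n" and r :: "real^'n^'n"
  assumes p: "norm p < 1" and r: "\<And>i j. r $ i $ j = r $ j $ i"
  defines "w \<equiv> sqrt (1 - (norm p)\<^sup>2)"
  obtains e :: "'n \<Rightarrow> real^'n" and \<kappa> where
    "\<And>i j. e i \<bullet> e j - (e i \<bullet> p) * (e j \<bullet> p) = (if i = j then 1 else 0)"
    "\<And>i j. e i \<bullet> (r *v e j) = (if i = j then w * \<kappa> i else 0)"
proof -
  have p1: "(norm p)\<^sup>2 < 1" using p by (simp add: abs_square_less_1)
  have w: "0 < w" "w\<^sup>2 = 1 - p \<bullet> p"
    using p1 by (simp_all add: w_def power2_norm_eq_inner)
  \<comment> \<open>A must fix the orthogonal complement of p and multiply p by 1/w, so \<gamma>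
    |p|^2 = 1/w - 1 with |p|^2 = 1 - w^2. This form of the solution also makes sense at p =
    0.\<close>
  define \<gamma> where "\<gamma> = 1 / (w * (1 + w))"
  have g: "1 + \<gamma> * (p \<bullet> p) = 1 / w"
  proof -
    have "p \<bullet> p = (1 - w) * (1 + w)" using w(2) by (simp add: power2_eq_square algebra_simps)
    then have "\<gamma> * (p \<bullet> p) = (1 - w) / w" using w(1) by (simp add: \<gamma>_def)
    then show ?thesis using w(1) by (simp add: diff_divide_distrib)
  qed
  have rs: "x \<bullet> (r *v y) = (r *v x) \<bullet> y" for x y
  proof -
    have "transpose r = r" using r by (simp add: vec_eq_iff transpose_def)
    then show ?thesis by (metis dot_lmul_matrix vector_transpose_matrix)
  qed
  define A where "A = (\<lambda>y. y + (\<gamma> * (p \<bullet> y)) *\<^sub>R p)"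
  have linA: "linear A"
    by (rule linearI) (auto simp: A_def algebra_simps inner_add_right)
  have As: "A x \<bullet> y = x \<bullet> A y" for x y
    by (simp add: A_def inner_add_left inner_add_right inner_commute)
  have Ap: "A x \<bullet> p = (x \<bullet> p) / w" for x
  proof -
    have "A x \<bullet> p = (x \<bullet> p) * (1 + \<gamma> * (p \<bullet> p))"
      by (simp add: A_def inner_add_left inner_commute algebra_simps)
    then show ?thesis using g by simp
  qed
  have AA: "A x \<bullet> A y - (A x \<bullet> p) * (A y \<bullet> p) = x \<bullet> y" for x y
  proof -
    have "A x \<bullet> A y = A x \<bullet> y + \<gamma> * (p \<bullet> y) * (A x \<bullet> p)"
      by (simp add: A_def[of] inner_add_right)
    also have "\<dots> = x \<bullet> y + (x \<bullet> p) * (y \<bullet> p) * (\<gamma> + \<gamma> / w)"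
      unfolding Ap by (simp add: A_def inner_add_left inner_commute algebra_simps)
    also have "\<gamma> + \<gamma> / w = 1 / w\<^sup>2"
      using w(1) by (simp add: \<gamma>_def power2_eq_square divide_simps)
    finally show ?thesis unfolding Ap by (simp add: power2_eq_square)
  qed
  let ?f = "\<lambda>x. A (r *v A x)"
  have "linear ?f"
    using linA by (simp add: linear_iff matrix_vector_right_distrib matrix_vector_mult_scaleR)
  moreover have "?f x \<bullet> y = x \<bullet> ?f y" for x y
    by (metis As rs)
  ultimately obtain e c where e: "\<And>i j :: 'n. e i \<bullet> e j = (if i = j then 1 else 0)"
      "\<And>i. ?f (e i) = c i *\<^sub>R e i"
    using self_adjoint_orthonormal_frame[of ?f] by blast
  show ?thesis
  proof (rule that[of "\<lambda>i. A (e i)" "\<lambda>i. c i / w"])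
    show "A (e i) \<bullet> A (e j) - (A (e i) \<bullet> p) * (A (e j) \<bullet> p) = (if i = j then 1 else 0)" for i j
      using AA e(1) by simp
    show "A (e i) \<bullet> (r *v A (e j)) = (if i = j then w * (c i / w) else 0)" for i j
      using As[of "e i" "r *v A (e j)"] e w(1) by auto
  qed
qed

section \<open>Eigenvalues with multiplicity\<close>

definition const_poly_matrix :: "real^'n^'n \<Rightarrow> real poly^'n^'n" where
  "const_poly_matrix A = (\<chi> i j. [:A $ i $ j:])"

lemma const_poly_matrix_mult: "const_poly_matrix (A ** B) = const_poly_matrix A ** const_poly_matrix B"
proof -
  have add: "[:a + b:] = [:a:] + [:b:]" for a b :: real by simp
  have *: "[:\<Sum>k\<in>I. f k:] = (\<Sum>k\<in>I. [:f k:])" for I and f :: "'n \<Rightarrow> real"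
    by (induction I rule: infinite_finite_induct) (simp_all add: add del: add_pCons)
  show ?thesis
    by (simp add: const_poly_matrix_def matrix_matrix_mult_def vec_eq_iff * mult.commute)
qed

lemma const_poly_matrix_one: "const_poly_matrix (mat 1) = mat 1"
  by (auto simp: const_poly_matrix_def mat_def vec_eq_iff)

text \<open>Matrices are moved into the polynomial ring, where the scalar matrix of the
  indeterminate commutes with everything and the determinant is multiplicative.\<close>

lemma charpoly_similar:
  fixes D E M :: "real^'n^'n"
  assumes "D ** E = mat 1"
  shows "charpoly (D ** M ** E) = charpoly M"
proof -
  let ?c = const_poly_matrix
  define X :: "real poly^'n^'n" where "X = (\<chi> i j. if i = j then [:0, 1:] else 0)"
  have cp: "charpoly N = det (X - ?c N)" for N
    unfolding charpoly_def X_def const_poly_matrix_def by (rule arg_cong[of _ _ det]) (simp add: vec_eq_iff)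
  have Xc: "X ** B = B ** X" for B
    by (simp add: X_def matrix_matrix_mult_def vec_eq_iff if_distrib[of "\<lambda>x. x * _"]
        if_distrib[of "\<lambda>x. _ * x"] sum.delta sum.delta' mult.commute cong: if_cong)
  have DE: "?c D ** ?c E = mat 1" using assms by (metis const_poly_matrix_mult const_poly_matrix_one)
  have "?c D ** (X - ?c M) ** ?c E = ?c D ** X ** ?c E - ?c D ** ?c M ** ?c E"
    by (simp add: matrix_matrix_mult_def vec_eq_iff sum_subtractf algebra_simps)
  also have "?c D ** X ** ?c E = X"
    by (metis DE Xc matrix_mul_assoc matrix_mul_rid)
  also have "?c D ** ?c M ** ?c E = ?c (D ** M ** E)" by (simp add: const_poly_matrix_mult)
  finally have "charpoly (D ** M ** E) = det (?c D ** (X - ?c M) ** ?c E)" by (simp add: cp)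
  also have "\<dots> = det (?c D ** ?c E) * det (X - ?c M)" by (simp add: det_mul)
  finally show ?thesis by (simp add: DE cp)
qed

lemma charpoly_diagonal:
  "charpoly (\<chi> i j. if i = j then \<kappa> i else 0) = (\<Prod>i\<in>UNIV. [:- \<kappa> i, 1:])"
  unfolding charpoly_def by (subst det_diagonal) auto

lemma prod_linear_eq_imp_image_mset_eq:
  fixes a b :: "'n::finite \<Rightarrow> real"
  assumes "(\<Prod>i\<in>UNIV. [:- a i, 1:]) = (\<Prod>i\<in>UNIV. [:- b i, 1:])"
  shows "image_mset a (mset_set UNIV) = image_mset b (mset_set UNIV)"
proof -
  have pr: "proots [:- c, 1:] = {#c#}" for c :: real
  proof (rule multiset_eqI)
    fix x
    show "count (proots [:- c, 1:]) x = count {#c#} x"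
      using order_power_n_n[of c 1] by (cases "x = c") (auto simp: order_eq_0_iff)
  qed
  have *: "proots (\<Prod>i\<in>UNIV. [:- c i, 1:]) = image_mset c (mset_set UNIV)" for c :: "'n \<Rightarrow> real"
    by (subst proots_prod) (auto simp: pr sum_unfold_sum_mset)
  show ?thesis using *[of a] *[of b] assms by simp
qed

lemma sum_UNIV_cong_image_mset:
  fixes a b :: "'n::finite \<Rightarrow> 'a" and g :: "'a \<Rightarrow> 'b::comm_monoid_add"
  assumes "image_mset a (mset_set UNIV) = image_mset b (mset_set UNIV)"
  shows "(\<Sum>i\<in>UNIV. g (a i)) = (\<Sum>i\<in>UNIV. g (b i))"
proof -
  have *: "(\<Sum>i\<in>(UNIV :: 'n set). g (c i)) = sum_mset (image_mset g (image_mset c (mset_set UNIV)))" for c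
    by (simp add: sum_unfold_sum_mset image_mset.compositionality o_def)
  show ?thesis unfolding *[of a] *[of b] assms ..
qed

lemma elem_sym_1:
  fixes \<kappa> :: "real^'n"
  shows "elem_sym 1 \<kappa> = (\<Sum>i\<in>UNIV. \<kappa> $ i)"
proof -
  have *: "{I :: 'n set. card I = 1} = (\<lambda>i. {i}) ` UNIV" by (auto simp: card_1_singleton_iff)
  show ?thesis unfolding elem_sym_def * by (subst sum.reindex) (auto simp: inj_on_def)
qed

lemma elem_sym_2:
  fixes \<kappa> :: "real^'n"
  shows "2 * elem_sym 2 \<kappa> = (\<Sum>i\<in>UNIV. \<kappa> $ i)\<^sup>2 - (\<Sum>i\<in>UNIV. (\<kappa> $ i)\<^sup>2)"
proof -
  \<comment> \<open>Ordered pairs of distinct indices are grouped by their underlying two-element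
    set; each set is hit twice.\<close>
  let ?P = "{z :: 'n \<times> 'n. fst z \<noteq> snd z}" and ?g = "\<lambda>z. \<kappa> $ fst z * \<kappa> $ snd z"
  have "(\<Sum>z\<in>?P. ?g z) = (\<Sum>I\<in>{I. card I = 2}. \<Sum>z\<in>{z\<in>?P. {fst z, snd z} = I}. ?g z)"
    by (rule sum.group[symmetric]) auto
  also have "\<dots> = (\<Sum>I\<in>{I. card I = 2}. 2 * (\<Prod>i\<in>I. \<kappa> $ i))"
  proof (rule sum.cong[OF refl])
    fix I :: "'n set" assume "I \<in> {I. card I = 2}"
    then obtain i j where I: "I = {i, j}" "i \<noteq> j" by (auto simp: card_2_iff)
    then have "{z\<in>?P. {fst z, snd z} = I} = {(i, j), (j, i)}" by (auto simp: doubleton_eq_iff)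
    then show "(\<Sum>z\<in>{z\<in>?P. {fst z, snd z} = I}. ?g z) = 2 * (\<Prod>i\<in>I. \<kappa> $ i)"
      using I by auto
  qed
  finally have P: "(\<Sum>z\<in>?P. ?g z) = 2 * elem_sym 2 \<kappa>"
    by (simp add: elem_sym_def sum_distrib_left)
  have "(\<Sum>i\<in>UNIV. \<kappa> $ i)\<^sup>2 = (\<Sum>z\<in>UNIV. ?g z)"
    by (simp add: power2_eq_square sum_product sum.cartesian_product case_prod_beta)
  also have "\<dots> = (\<Sum>z\<in>?P. ?g z) + (\<Sum>z\<in>- ?P. ?g z)"
    by (subst sum.union_disjoint[symmetric]) auto
  also have "- ?P = (\<lambda>i. (i, i)) ` UNIV" by auto
  also have "(\<Sum>z\<in>(\<lambda>i. (i, i)) ` UNIV. ?g z) = (\<Sum>i\<in>UNIV. (\<kappa> $ i)\<^sup>2)"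
    by (subst sum.reindex) (auto simp: inj_on_def power2_eq_square)
  finally show ?thesis using P by simp
qed

text \<open>The diagonal entries are a witness for the choice in \<open>eigenvalue_vec\<close>, and
  unique factorization shows that the chosen vector has the same multiset of entries. Hence only
  conclusions symmetric in the entries are possible.\<close>

lemma eigenvalue_vec_of_diagonalization:
  fixes D E M :: "real^'n^'n"
  assumes DE: "D ** E = mat 1" and d: "D ** M ** E = (\<chi> i j. if i = j then \<kappa> i else 0)"
  shows "elem_sym 1 (eigenvalue_vec M) = (\<Sum>i\<in>UNIV. \<kappa> i)" (is ?A)
    and "2 * elem_sym 2 (eigenvalue_vec M) = (\<Sum>i\<in>UNIV. \<kappa> i)\<^sup>2 - (\<Sum>i\<in>UNIV. (\<kappa> i)\<^sup>2)" (is ?B)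
    and "range (($) (eigenvalue_vec M)) = range \<kappa>" (is ?C)
proof -
  have cp: "charpoly M = (\<Prod>i\<in>UNIV. [:- \<kappa> i, 1:])"
    using charpoly_similar[OF DE, of M] by (simp add: d charpoly_diagonal)
  have "charpoly M = (\<Prod>i\<in>UNIV. [:- (eigenvalue_vec M $ i), 1:])"
    unfolding eigenvalue_vec_def by (rule someI[of _ "\<chi> i. \<kappa> i"]) (simp add: cp)
  with cp have ms: "image_mset (($) (eigenvalue_vec M)) (mset_set UNIV) = image_mset \<kappa> (mset_set UNIV)"
    by (intro prod_linear_eq_imp_image_mset_eq) simp
  show ?A using sum_UNIV_cong_image_mset[OF ms, of id] unfolding elem_sym_1 by simp
  show ?B using sum_UNIV_cong_image_mset[OF ms, of id] sum_UNIV_cong_image_mset[OF ms, of power2]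
    by (simp add: elem_sym_2)
  show ?C using arg_cong[OF ms, of set_mset] by simp
qed

section \<open>The linearized operator applied to the mean curvature\<close>


text \<open>In a frame that diagonalizes both fundamental forms at a point, with \<open>b\<^sub>i = u\<^sub>i\<close>,
  \<open>u\<^sub>i\<^sub>j = \<mu>\<^sub>i \<delta>\<^sub>i\<^sub>j\<close>, \<open>T = D\<^sup>3u\<close>, \<open>Q i j k = u\<^sub>i\<^sub>j\<^sub>k\<^sub>k\<close> and \<open>v = 1/w\<close>: the first and second derivatives
  in direction \<open>k\<close> of the entry \<open>(i, j)\<close> of the shape operator.\<close>

definition shape_d1 where
  "shape_d1 v b \<mu> T k i j = v * (T i j k + (if i = j then \<mu> k * b k * \<mu> i else 0)
     + (if i = k then \<mu> k * b j * \<mu> j else 0) + (if j = k then b i * (\<mu> k)\<^sup>2 else (0::real)))"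

definition shape_d2 where
  "shape_d2 v b \<mu> T Q k i j = v * (
     (if i = j then \<mu> j * (2 * (\<mu> k)\<^sup>2 * (b k)\<^sup>2 + v\<^sup>2 * (\<mu> k)\<^sup>2 + (\<Sum>m\<in>UNIV. b m * T m k k)) else 0)
     + \<mu> j * (2 * ((\<mu> k)\<^sup>2 * b k * ((if i = k then b j else 0) + (if j = k then b i else 0))
         + (if i = k \<and> j = k then v\<^sup>2 * (\<mu> k)\<^sup>2 else 0) + (\<mu> k)\<^sup>2 * b i * b j)
         + T i k k * b j + b i * T j k k)
     + Q i j k
     + 2 * (\<mu> k * b k) * \<mu> k * ((if i = k then b j else 0) + (if j = k then b i else 0)) * \<mu> j
     + 2 * (\<mu> k * b k) * T i j k
     + 2 * \<mu> k * ((if i = k then (\<Sum>m\<in>UNIV. b m * T m j k) else 0) + b i * T k j (k::'n::finite)))"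
  for v :: real

text \<open>The components of the covariant derivative of the second fundamental form.\<close>

definition cov_h where
  "cov_h v b \<mu> T i j k = v * (T i j k + (if i = j then \<mu> k * b k * \<mu> i else 0)
     + (if i = k then \<mu> i * \<mu> j * b j else 0) + (if j = k then \<mu> j * \<mu> i * b i else (0::real)))"

lemma sum_delta_simps:
  fixes f c :: "'n::finite \<Rightarrow> real"
  shows "(\<Sum>i\<in>UNIV. f i * (if i = k then c i else 0)) = f k * c k"
    "(\<Sum>i\<in>UNIV. (if i = k then c i else 0) * f i) = c k * f k"
    "(\<Sum>i\<in>UNIV. (if k = i then c i else 0) * f i) = c k * f k"
  by (simp_all add: if_distrib[of "\<lambda>x. _ * x"] if_distrib[of "\<lambda>x. x * _"] cong: if_cong)

text \<open>Here \<open>U\<close> and \<open>R\<close> are first and second frame derivatives of u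
  along the line, \<open>\<pi> i\<close> is the pairing of Du with the dual vector
  \<open>d i\<close>, and \<open>W\<close> is 1 - |Du|^2. The bracket is the inverse metric in the
  dual frame, equal to the identity at t = 0. The jet is assembled from those of 1/sqrt W, of the
  inverse metric and of the Hessian.\<close>

lemma shape_jet2:
  fixes b \<mu> :: "'n::finite \<Rightarrow> real" and T Q :: "'n \<Rightarrow> 'n \<Rightarrow> 'n \<Rightarrow> real"
    and U :: "'n \<Rightarrow> real \<Rightarrow> real" and R :: "'n \<Rightarrow> 'n \<Rightarrow> real \<Rightarrow> real"
  assumes w: "0 < w" and v: "v = 1 / w" and b: "(\<Sum>i\<in>UNIV. (b i)\<^sup>2) = v\<^sup>2 - 1"
    and U: "\<And>i. jet2 (U i) (b i) (if i = k then \<mu> k else 0) (T i k k)"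
    and R: "\<And>i j. jet2 (R i j) (if i = j then \<mu> i else 0) (T i j k) (Q i j k)"
  defines "\<pi> \<equiv> \<lambda>i t. U i t - w\<^sup>2 * b i * (\<Sum>j\<in>UNIV. b j * U j t)"
  defines "W \<equiv> \<lambda>t. 1 - (\<Sum>i\<in>UNIV. U i t * \<pi> i t)"
  shows "jet2 (\<lambda>t. 1 / sqrt (W t) *
      (\<Sum>m\<in>UNIV. ((if i = m then 1 else 0) - w\<^sup>2 * b i * b m + \<pi> i t * \<pi> m t * (1 / W t)) * R m j t))
    (if i = j then v * \<mu> i else 0) (shape_d1 v b \<mu> T k i j) (shape_d2 v b \<mu> T Q k i j)"
proof -
  define \<tau> where "\<tau> = (\<Sum>m\<in>UNIV. b m * T m k k)"
  have wv: "w * v = 1" using w v by simp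
  have w2v2: "w\<^sup>2 * v\<^sup>2 = 1" using wv by (metis power_mult_distrib power_one)
  have bb: "(\<Sum>i\<in>UNIV. b i * b i) = v * v - 1" using b by (simp add: power2_eq_square)
  have A: "jet2 (\<lambda>t. \<Sum>j\<in>UNIV. b j * U j t) (v\<^sup>2 - 1) (b k * \<mu> k) \<tau>"
    using jet2_sum[of UNIV "\<lambda>j t. b j * U j t", OF finite jet2_cmult[OF U]]
    by (rule jet2_eqI) (simp_all add: bb power2_eq_square \<tau>_def sum_delta_simps)
  define \<delta> where "\<delta> = (\<lambda>i. if i = k then \<mu> k else 0)"
  have \<pi>: "jet2 (\<pi> i) (w\<^sup>2 * b i) (\<delta> i - w\<^sup>2 * b i * (b k * \<mu> k))
      (T i k k - w\<^sup>2 * b i * \<tau>)" for i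
    unfolding \<pi>_def \<delta>_def using jet2_diff[OF U jet2_cmult[OF A, of "w\<^sup>2 * b i"]]
  proof (rule jet2_eqI)
    show "b i - w\<^sup>2 * b i * (v\<^sup>2 - 1) = w\<^sup>2 * b i" using w2v2 by algebra
  qed simp_all
  have W: "jet2 W (w\<^sup>2) (- 2 * w\<^sup>2 * (b k * \<mu> k))
      (- 2 * (\<mu> k)\<^sup>2 + 2 * w\<^sup>2 * (b k * \<mu> k)\<^sup>2 - 2 * w\<^sup>2 * \<tau>)"
  proof -
    have Weq: "W = (\<lambda>t. 1 - ((\<Sum>i\<in>UNIV. U i t * U i t)
        - w\<^sup>2 * ((\<Sum>j\<in>UNIV. b j * U j t) * (\<Sum>j\<in>UNIV. b j * U j t))))"
      unfolding W_def \<pi>_def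
      by (rule ext) (simp add: right_diff_distrib sum_subtractf sum_distrib_left sum_distrib_right mult_ac)
    have UU: "jet2 (\<lambda>t. \<Sum>i\<in>UNIV. U i t * U i t) (v\<^sup>2 - 1) (2 * (b k * \<mu> k)) (2 * (\<mu> k)\<^sup>2 + 2 * \<tau>)"
      using jet2_sum[of UNIV "\<lambda>j t. U j t * U j t", OF finite jet2_mult[OF U U]]
    proof (rule jet2_eqI)
      show "(\<Sum>j\<in>UNIV. b j * b j) = v\<^sup>2 - 1" using bb by (simp add: power2_eq_square)
      show "(\<Sum>j\<in>UNIV. (if j = k then \<mu> k else 0) * b j + b j * (if j = k then \<mu> k else 0)) = 2 * (b k * \<mu> k)"
        by (simp add: sum_distrib_left[symmetric] sum_delta_simps)
      show "(\<Sum>j\<in>UNIV. T j k k * b j + 2 * (if j = k then \<mu> k else 0) * (if j = k then \<mu> k else 0) + b j * T j k k)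
          = 2 * (\<mu> k)\<^sup>2 + 2 * \<tau>"
        by (simp add: sum.distrib sum_delta_simps sum_distrib_left[symmetric] \<tau>_def[symmetric]
            power2_eq_square)
    qed
    show ?thesis unfolding Weq
      using jet2_diff[OF jet2_const[of 1] jet2_diff[OF UU jet2_cmult[OF jet2_mult[OF A A], of "w\<^sup>2"]]]
    proof (rule jet2_eqI)
      show "1 - (v\<^sup>2 - 1 - w\<^sup>2 * ((v\<^sup>2 - 1) * (v\<^sup>2 - 1))) = w\<^sup>2" using w2v2 by algebra
      show "0 - (2 * (b k * \<mu> k) - w\<^sup>2 * (b k * \<mu> k * (v\<^sup>2 - 1) + (v\<^sup>2 - 1) * (b k * \<mu> k)))
          = - 2 * w\<^sup>2 * (b k * \<mu> k)" using w2v2 by algebra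
      show "0 - (2 * (\<mu> k)\<^sup>2 + 2 * \<tau> - w\<^sup>2 * (\<tau> * (v\<^sup>2 - 1) + 2 * (b k * \<mu> k) * (b k * \<mu> k) + (v\<^sup>2 - 1) * \<tau>))
        = - 2 * (\<mu> k)\<^sup>2 + 2 * w\<^sup>2 * (b k * \<mu> k)\<^sup>2 - 2 * w\<^sup>2 * \<tau>" using w2v2 by algebra
    qed
  qed
  have iw: "1 / w ^ n = v ^ n" for n using v by (simp add: power_divide)
  have V: "jet2 (\<lambda>t. 1 / sqrt (W t)) v (v * (\<mu> k * b k))
      (v * (2 * (\<mu> k)\<^sup>2 * (b k)\<^sup>2 + v\<^sup>2 * (\<mu> k)\<^sup>2 + \<tau>))"
    using jet2_inverse_sqrt[OF W w]
  proof (rule jet2_eqI)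
    show "1 / w = v" using v by simp
    have "- (- 2 * w\<^sup>2 * (b k * \<mu> k)) / (2 * w ^ 3) = w\<^sup>2 * (b k * \<mu> k) * (1 / w ^ 3)" by simp
    also have "\<dots> = v * (\<mu> k * b k)" unfolding iw using w2v2 by algebra
    finally show "- (- 2 * w\<^sup>2 * (b k * \<mu> k)) / (2 * w ^ 3) = v * (\<mu> k * b k)" .
    have "3 * (- 2 * w\<^sup>2 * (b k * \<mu> k))\<^sup>2 / (4 * w ^ 5) -
        (- 2 * (\<mu> k)\<^sup>2 + 2 * w\<^sup>2 * (b k * \<mu> k)\<^sup>2 - 2 * w\<^sup>2 * \<tau>) / (2 * w ^ 3)
        = 3 * (w\<^sup>2 * (b k * \<mu> k))\<^sup>2 * (1 / w ^ 5)
          - (- (\<mu> k)\<^sup>2 + w\<^sup>2 * (b k * \<mu> k)\<^sup>2 - w\<^sup>2 * \<tau>) * (1 / w ^ 3)"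
      using w by (simp add: field_simps power2_eq_square)
    also have "\<dots> = v * (2 * (\<mu> k)\<^sup>2 * (b k)\<^sup>2 + v\<^sup>2 * (\<mu> k)\<^sup>2 + \<tau>)"
      unfolding iw using wv by algebra
    finally show "3 * (- 2 * w\<^sup>2 * (b k * \<mu> k))\<^sup>2 / (4 * w ^ 5) -
        (- 2 * (\<mu> k)\<^sup>2 + 2 * w\<^sup>2 * (b k * \<mu> k)\<^sup>2 - 2 * w\<^sup>2 * \<tau>) / (2 * w ^ 3)
        = v * (2 * (\<mu> k)\<^sup>2 * (b k)\<^sup>2 + v\<^sup>2 * (\<mu> k)\<^sup>2 + \<tau>)" .
  qed
  \<comment> \<open>Obtained as the square of the jet just computed; the two functions agree only
    where W > 0, that is, for small t.\<close>
  have J: "jet2 (\<lambda>t. 1 / W t) (v\<^sup>2) (2 * v\<^sup>2 * (b k * \<mu> k))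
      (v\<^sup>2 * (6 * (b k)\<^sup>2 * (\<mu> k)\<^sup>2 + 2 * v\<^sup>2 * (\<mu> k)\<^sup>2 + 2 * \<tau>))"
    using jet2_mult[OF V V] 
  proof (rule jet2_cong[OF jet2_eqI])
    have "\<forall>\<^sub>F t in nhds 0. 0 < W t"
    proof -
      have "(W \<longlongrightarrow> W 0) (nhds 0)"
        using jet2_isCont[OF W] by (simp add: isCont_def tendsto_nhds_iff)
      moreover have "0 < W 0" using W w by (simp add: jet2_def)
      ultimately show ?thesis by (rule order_tendstoD)
    qed
    then show "\<forall>\<^sub>F t in nhds 0. 1 / sqrt (W t) * (1 / sqrt (W t)) = 1 / W t"
      by eventually_elim simp
  qed (auto simp: power2_eq_square algebra_simps)
  define P1 where "P1 = (\<lambda>i m. \<delta> i * b m + b i * \<delta> m)"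
  define P2 where "P2 = (\<lambda>i m. 2 * (\<mu> k * b k * (\<delta> i * b m + b i * \<delta> m)
      + v\<^sup>2 * \<delta> i * \<delta> m + (\<mu> k)\<^sup>2 * b i * b m) + T i k k * b m + b i * T m k k)"
  have P: "jet2 (\<lambda>t. (if i = m then 1 else 0) - w\<^sup>2 * b i * b m + \<pi> i t * \<pi> m t * (1 / W t))
      (if i = m then 1 else 0) (P1 i m) (P2 i m)" for i m
    using jet2_add[OF jet2_const[of "(if i = m then 1 else 0) - w\<^sup>2 * b i * b m"]
        jet2_mult[OF jet2_mult[OF \<pi>[of i] \<pi>[of m]] J]]
  proof (rule jet2_eqI, goal_cases)
    case 1
    have "w\<^sup>2 * b i * (w\<^sup>2 * b m) * v\<^sup>2 = w\<^sup>2 * b i * b m" using w2v2 by algebra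
    then show ?case by simp
  next
    case 2
    show ?case unfolding P1_def using w2v2 by algebra
  next
    case 3
    show ?case unfolding P2_def using w2v2 by algebra
  qed
  have M: "jet2 (\<lambda>t. \<Sum>m\<in>UNIV. ((if i = m then 1 else 0) - w\<^sup>2 * b i * b m + \<pi> i t * \<pi> m t * (1 / W t)) * R m j t)
     (if i = j then \<mu> i else 0) (P1 i j * \<mu> j + T i j k)
     (P2 i j * \<mu> j + 2 * \<mu> k * ((if i = k then (\<Sum>m\<in>UNIV. b m * T m j k) else 0) + b i * T k j k) + Q i j k)"
    using jet2_sum[of UNIV "\<lambda>m t. ((if i = m then 1 else 0) - w\<^sup>2 * b i * b m + \<pi> i t * \<pi> m t * (1 / W t)) * R m j t",
        OF finite jet2_mult[OF P R]]
  proof (rule jet2_eqI, goal_cases)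
    case 1
    then show ?case by (simp add: sum_delta_simps)
  next
    case 2
    then show ?case by (simp add: sum_delta_simps sum.distrib)
  next
    case 3
    have "(\<Sum>m\<in>UNIV. 2 * P1 i m * T m j k)
      = 2 * \<mu> k * ((if i = k then (\<Sum>m\<in>UNIV. b m * T m j k) else 0) + b i * T k j k)"
    proof -
      have "(\<Sum>m\<in>UNIV. 2 * P1 i m * T m j k)
        = (\<Sum>m\<in>UNIV. 2 * \<delta> i * (b m * T m j k) + 2 * b i * T m j k * \<delta> m)"
        by (simp add: P1_def algebra_simps)
      also have "\<dots> = 2 * \<delta> i * (\<Sum>m\<in>UNIV. b m * T m j k) + 2 * b i * T k j k * \<mu> k"
        by (simp add: sum.distrib sum_distrib_left \<delta>_def sum_delta_simps)
      finally show ?thesis by (simp add: \<delta>_def algebra_simps)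
    qed
    then show ?case by (simp add: sum_delta_simps sum.distrib)
  qed
  show ?thesis
    using jet2_mult[OF V M]
    by (rule jet2_eqI)
       (auto simp: shape_d1_def shape_d2_def P1_def P2_def \<delta>_def \<tau>_def algebra_simps power2_eq_square)
qed

text \<open>The Codazzi equation: in flat ambient space the derivative of the second fundamental
  form is totally symmetric.\<close>

lemma cov_h_sym:
  assumes "\<And>i j k. T i j k = T j i k" "\<And>i j k. T i j k = T i k j"
  shows "cov_h v b \<mu> T i j k = cov_h v b \<mu> T j i k" "cov_h v b \<mu> T i j k = cov_h v b \<mu> T i k j"
proof -
  show "cov_h v b \<mu> T i j k = cov_h v b \<mu> T j i k"
    unfolding cov_h_def using assms(1)[of i j k] by auto
  show "cov_h v b \<mu> T i j k = cov_h v b \<mu> T i k j"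
    unfolding cov_h_def using assms(2)[of i j k] by auto
qed

lemma sum_sum_antisym:
  fixes E :: "'n::finite \<Rightarrow> 'n \<Rightarrow> real"
  assumes "\<And>i k. E i k + E k i = 0"
  shows "(\<Sum>k\<in>UNIV. \<Sum>i\<in>UNIV. E i k) = 0"
proof -
  have "2 * (\<Sum>k\<in>UNIV. \<Sum>i\<in>UNIV. E i k) = (\<Sum>k\<in>UNIV. \<Sum>i\<in>UNIV. E i k) + (\<Sum>k\<in>UNIV. \<Sum>i\<in>UNIV. E k i)"
    by (subst (3) sum.swap) simp
  also have "\<dots> = (\<Sum>k\<in>UNIV. \<Sum>i\<in>UNIV. E i k + E k i)" by (simp add: sum.distrib)
  also have "\<dots> = 0" using assms by simp
  finally show ?thesis by simp
qed

text \<open>Simons' identity for the linearized operator of \<open>\<sigma>\<^sub>2\<close>; \<open>f\<^sub>i = H - \<kappa>\<^sub>i\<close>, and the terms with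
  \<open>\<mu>\<^sub>k b\<^sub>m\<close> are the Christoffel corrections of the Hessians.\<close>

lemma simons_identity:
  fixes v :: real and b \<mu> :: "'n::finite \<Rightarrow> real" and T Q :: "'n \<Rightarrow> 'n \<Rightarrow> 'n \<Rightarrow> real"
  assumes T: "\<And>i j k. T i j k = T j i k" "\<And>i j k. T i j k = T i k j"
    and Q: "\<And>i k. Q i i k = Q k k i"
  defines "\<kappa> \<equiv> \<lambda>i. v * \<mu> i" 
  defines "H \<equiv> \<Sum>i\<in>UNIV. \<kappa> i"
  defines "f \<equiv> \<lambda>i. H - \<kappa> i"
  defines "B \<equiv> cov_h v b \<mu> T" and "S1 \<equiv> shape_d1 v b \<mu> T" and "D \<equiv> \<lambda>i k. shape_d2 v b \<mu> T Q k i i"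
  defines "H1 \<equiv> \<lambda>k. \<Sum>i\<in>UNIV. B i i k" and "s1 \<equiv> \<lambda>k. \<Sum>i\<in>UNIV. f i * B i i k"
  shows "(\<Sum>k\<in>UNIV. f k * ((\<Sum>i\<in>UNIV. D i k) + \<mu> k * (\<Sum>m\<in>UNIV. b m * H1 m)))
    = (\<Sum>k\<in>UNIV. (\<Sum>i\<in>UNIV. f i * D i k) + (H1 k)\<^sup>2 - (\<Sum>i\<in>UNIV. \<Sum>j\<in>UNIV. S1 k i j * S1 k j i)
         + \<mu> k * (\<Sum>m\<in>UNIV. b m * s1 m))
      + (\<Sum>k\<in>UNIV. \<Sum>i\<in>UNIV. \<Sum>j\<in>UNIV. (B i j k)\<^sup>2) - (\<Sum>k\<in>UNIV. (H1 k)\<^sup>2)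
      + (H * (\<Sum>i\<in>UNIV. f i * (\<kappa> i)\<^sup>2) - (H\<^sup>2 - (\<Sum>i\<in>UNIV. (\<kappa> i)\<^sup>2)) * (\<Sum>i\<in>UNIV. (\<kappa> i)\<^sup>2))"
proof -
  define \<beta> where "\<beta> = (\<lambda>i. \<Sum>m\<in>UNIV. b m * B i i m)"
  define \<tau> where "\<tau> = (\<lambda>k. \<Sum>m\<in>UNIV. b m * T m k k)"
  define \<Lambda> where "\<Lambda> = (\<Sum>m\<in>UNIV. \<mu> m * (b m)\<^sup>2)"
  have beta: "\<beta> i = v * (\<tau> i + \<mu> i * \<Lambda> + 2 * (\<mu> i)\<^sup>2 * (b i)\<^sup>2)" for i
  proof -
    have "\<beta> i = (\<Sum>m\<in>UNIV. v * (b m * T m i i) + v * \<mu> i * (\<mu> m * (b m)\<^sup>2)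
        + (if i = m then 2 * v * (\<mu> i)\<^sup>2 * (b i)\<^sup>2 else 0))"
      unfolding \<beta>_def
    proof (rule sum.cong[OF refl])
      fix m
      have "T i i m = T m i i" using T by metis
      then show "b m * B i i m = v * (b m * T m i i) + v * \<mu> i * (\<mu> m * (b m)\<^sup>2)
          + (if i = m then 2 * v * (\<mu> i)\<^sup>2 * (b i)\<^sup>2 else 0)"
        by (cases "i = m") (simp_all add: B_def cov_h_def algebra_simps power2_eq_square)
    qed
    also have "\<dots> = v * \<tau> i + v * \<mu> i * \<Lambda> + 2 * v * (\<mu> i)\<^sup>2 * (b i)\<^sup>2"
      unfolding \<tau>_def \<Lambda>_def sum_distrib_left by (simp add: sum.distrib)
    finally show ?thesis by (simp add: algebra_simps)
  qed
  have SS: "(\<Sum>i\<in>UNIV. \<Sum>j\<in>UNIV. S1 k i j * S1 k j i) = (\<Sum>i\<in>UNIV. \<Sum>j\<in>UNIV. (B i j k)\<^sup>2)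
      + (\<Sum>i\<in>UNIV. 2 * v * B i k k * b i * \<mu> k * (\<mu> k - \<mu> i))" for k
  proof -
    \<comment> \<open>Away from the base point the frame is no longer orthonormal and the mixed
      components are no longer symmetric. \<open>?c\<close> is the discrepancy between their
      ordinary derivative and the covariant one; it lives in column k only.\<close>
    let ?c = "\<lambda>i. v * b i * \<mu> k * (\<mu> k - \<mu> i)"
    have S1: "S1 k i j = B i j k + (if j = k then ?c i else 0)" for i j
      unfolding S1_def B_def shape_d1_def cov_h_def by (auto simp: algebra_simps power2_eq_square)
    have Bs: "B j i k = B i j k" for i j unfolding B_def by (rule cov_h_sym[OF T])
    have "S1 k i j * S1 k j i = (B i j k)\<^sup>2 + (if j = k then B i k k * ?c i else 0) + (if i = k then B j k k * ?c j else 0)"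
      for i j
      unfolding S1 Bs[of j i] using Bs[of k j] by (auto simp: algebra_simps power2_eq_square)
    then have "(\<Sum>i\<in>UNIV. \<Sum>j\<in>UNIV. S1 k i j * S1 k j i)
      = (\<Sum>i\<in>UNIV. \<Sum>j\<in>UNIV. (B i j k)\<^sup>2) + (\<Sum>i\<in>UNIV. B i k k * ?c i) 
        + (\<Sum>i\<in>UNIV. \<Sum>j\<in>UNIV. if i = k then B j k k * ?c j else 0)"
      by (simp add: sum.distrib)
    also have "(\<Sum>i\<in>UNIV. \<Sum>j\<in>UNIV. if i = k then B j k k * ?c j else 0) = (\<Sum>j\<in>UNIV. B j k k * ?c j)"
      by (subst sum.swap) simp
    finally show ?thesis by (simp add: sum_distrib_left[symmetric] sum.distrib[symmetric] algebra_simps)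
  qed
  \<comment> \<open>The identity says that the double sum of \<open>E\<close> vanishes, and
    \<open>E\<close> is antisymmetric. Fourth derivatives enter through (f_k - f_i) u_iikk, an
    antisymmetric times a symmetric factor. The quartic term plus its transpose is - \<kappa>_i
    \<kappa>_k (\<kappa>_i - \<kappa>_k)^2, in which - \<kappa>_i \<kappa>_k is the sectional
    curvature.\<close>
  define E where "E = (\<lambda>i k. (f k - f i) * D i k + 2 * v * B i k k * b i * \<mu> k * (\<mu> k - \<mu> i)
      + (f k - f i) * \<mu> k * \<beta> i - ((\<kappa> i)\<^sup>2 * (\<kappa> k)\<^sup>2 - \<kappa> i * (\<kappa> k) ^ 3))"
  have E0: "E i k + E k i = 0" for i k
  proof (cases "i = k")
    case True
    then show ?thesis by (simp add: E_def power2_eq_square power3_eq_cube)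
  next
    case False
    have t: "T k i k = T i k k" "T k k i = T i k k" "T i k i = T i i k" "T k i i = T i i k"
      using T by metis+
    have ff: "f k - f i = v * (\<mu> i - \<mu> k)" for i k by (simp add: f_def \<kappa>_def algebra_simps)
    have Dik: "D i k = v * (\<mu> i * (2 * (\<mu> k)\<^sup>2 * (b k)\<^sup>2 + v\<^sup>2 * (\<mu> k)\<^sup>2 + \<tau> k)
        + \<mu> i * (2 * (\<mu> k)\<^sup>2 * (b i)\<^sup>2 + 2 * T i k k * b i) + Q i i k + 2 * \<mu> k * b k * T i i k
        + 2 * \<mu> k * b i * T i k k)"
      using False t unfolding D_def shape_d2_def \<tau>_def by (simp add: power2_eq_square algebra_simps)
    have Dki: "D k i = v * (\<mu> k * (2 * (\<mu> i)\<^sup>2 * (b i)\<^sup>2 + v\<^sup>2 * (\<mu> i)\<^sup>2 + \<tau> i)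
        + \<mu> k * (2 * (\<mu> i)\<^sup>2 * (b k)\<^sup>2 + 2 * T i i k * b k) + Q i i k + 2 * \<mu> i * b i * T i k k
        + 2 * \<mu> i * b k * T i i k)"
      using False t Q[of i k] unfolding D_def shape_d2_def \<tau>_def by (simp add: power2_eq_square algebra_simps)
    have Bik: "B i k k = v * (T i k k + \<mu> k * \<mu> i * b i)" and Bki: "B k i i = v * (T i i k + \<mu> k * \<mu> i * b k)"
      using False t unfolding B_def cov_h_def by (auto simp: algebra_simps)
    show ?thesis
      unfolding E_def ff Dik Dki Bik Bki beta \<kappa>_def by algebra
  qed
  have sumE: "(\<Sum>k\<in>UNIV. \<Sum>i\<in>UNIV. E i k) = 0" by (rule sum_sum_antisym[OF E0])
  have K: "(\<Sum>k\<in>UNIV. \<Sum>i\<in>UNIV. (\<kappa> i)\<^sup>2 * (\<kappa> k)\<^sup>2 - \<kappa> i * (\<kappa> k) ^ 3)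
      = H * (\<Sum>i\<in>UNIV. f i * (\<kappa> i)\<^sup>2) - (H\<^sup>2 - (\<Sum>i\<in>UNIV. (\<kappa> i)\<^sup>2)) * (\<Sum>i\<in>UNIV. (\<kappa> i)\<^sup>2)"
  proof -
    have "(\<Sum>i\<in>UNIV. f i * (\<kappa> i)\<^sup>2) = H * (\<Sum>i\<in>UNIV. (\<kappa> i)\<^sup>2) - (\<Sum>i\<in>UNIV. (\<kappa> i) ^ 3)"
      by (simp add: f_def left_diff_distrib sum_subtractf sum_distrib_left power2_eq_square power3_eq_cube mult.assoc)
    moreover have "(\<Sum>k\<in>UNIV. \<Sum>i\<in>UNIV. (\<kappa> i)\<^sup>2 * (\<kappa> k)\<^sup>2 - \<kappa> i * (\<kappa> k) ^ 3)
        = (\<Sum>i\<in>UNIV. (\<kappa> i)\<^sup>2) * (\<Sum>i\<in>UNIV. (\<kappa> i)\<^sup>2) - H * (\<Sum>i\<in>UNIV. (\<kappa> i) ^ 3)"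
      by (simp add: sum_subtractf sum_product H_def sum.swap[of "\<lambda>i k. \<kappa> i * (\<kappa> k) ^ 3"] mult_ac)
    ultimately show ?thesis by algebra
  qed
  have G: "(\<Sum>k\<in>UNIV. f k * (\<mu> k * (\<Sum>m\<in>UNIV. b m * H1 m))) - (\<Sum>k\<in>UNIV. \<mu> k * (\<Sum>m\<in>UNIV. b m * s1 m))
      = (\<Sum>k\<in>UNIV. \<Sum>i\<in>UNIV. (f k - f i) * \<mu> k * \<beta> i)"
  proof -
    have 1: "(\<Sum>m\<in>UNIV. b m * H1 m) = (\<Sum>i\<in>UNIV. \<beta> i)"
      unfolding H1_def \<beta>_def sum_distrib_left by (rule sum.swap)
    have 2: "(\<Sum>m\<in>UNIV. b m * s1 m) = (\<Sum>i\<in>UNIV. f i * \<beta> i)"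
      unfolding s1_def \<beta>_def sum_distrib_left by (subst sum.swap) (simp add: mult_ac)
    show ?thesis unfolding 1 2
      by (simp add: left_diff_distrib right_diff_distrib sum_subtractf sum_distrib_left mult_ac)
  qed
  have "(\<Sum>k\<in>UNIV. \<Sum>i\<in>UNIV. E i k)
     = (\<Sum>k\<in>UNIV. \<Sum>i\<in>UNIV. f k * D i k) - (\<Sum>k\<in>UNIV. \<Sum>i\<in>UNIV. f i * D i k)
      + (\<Sum>k\<in>UNIV. \<Sum>i\<in>UNIV. 2 * v * B i k k * b i * \<mu> k * (\<mu> k - \<mu> i))
      + (\<Sum>k\<in>UNIV. \<Sum>i\<in>UNIV. (f k - f i) * \<mu> k * \<beta> i)
      - (\<Sum>k\<in>UNIV. \<Sum>i\<in>UNIV. (\<kappa> i)\<^sup>2 * (\<kappa> k)\<^sup>2 - \<kappa> i * (\<kappa> k) ^ 3)"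
    unfolding E_def by (simp add: sum.distrib sum_subtractf left_diff_distrib)
  then show ?thesis
    using sumE K G SS
    by (simp add: sum.distrib sum_subtractf distrib_left sum_distrib_left[symmetric])
qed

section \<open>The inequality at the maximum point\<close>


text \<open>Concavity of the square root of \<sigma>_2 as a function of \<kappa>: \<open>s\<close>
  is the first derivative of \<sigma>_2 in direction \<open>x\<close>, and X^2 - \<Sum> x_i^2 the
  second. It follows from Cauchy-Schwarz for \<kappa> and x, since the remaining discrepancy is the
  square (2 \<sigma> X - H s)^2 / (2 \<sigma>).\<close>

lemma sum_squares_concavity:
  fixes \<kappa> x :: "'n::finite \<Rightarrow> real"
  defines "H \<equiv> \<Sum>i\<in>UNIV. \<kappa> i" and "X \<equiv> \<Sum>i\<in>UNIV. x i"
  defines "s \<equiv> \<Sum>i\<in>UNIV. (H - \<kappa> i) * x i"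
  assumes \<sigma>: "2 * \<sigma> = H\<^sup>2 - (\<Sum>i\<in>UNIV. (\<kappa> i)\<^sup>2)" "0 < \<sigma>"
  shows "(\<Sum>i\<in>UNIV. (x i)\<^sup>2) - X\<^sup>2 \<ge> - (s\<^sup>2 / (2 * \<sigma>))"
proof -
  let ?q = "\<Sum>i\<in>UNIV. (x i)\<^sup>2" and ?A = "\<Sum>i\<in>UNIV. (\<kappa> i)\<^sup>2"
  have s: "s = H * X - (\<Sum>i\<in>UNIV. \<kappa> i * x i)"
    by (simp add: s_def X_def left_diff_distrib sum_subtractf sum_distrib_left)
  have "(H * X - s)\<^sup>2 \<le> ?A * ?q"
    using Cauchy_Schwarz_ineq_sum[of \<kappa> x UNIV] by (simp add: s)
  then have A: "(H * X - s)\<^sup>2 \<le> (H\<^sup>2 - 2 * \<sigma>) * ?q" using \<sigma>(1) by simp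
  have A0: "H\<^sup>2 - 2 * \<sigma> \<ge> 0" using \<sigma>(1) by (simp add: sum_nonneg)
  have "0 \<le> (2 * \<sigma> * X - H * s)\<^sup>2" by simp
  show ?thesis
  proof (cases "H\<^sup>2 - 2 * \<sigma> = 0")
    case True
    then have "H * X = s" using A by simp
    then have "s\<^sup>2 = 2 * \<sigma> * X\<^sup>2" using True by (metis eq_iff_diff_eq_0 power_mult_distrib)
    then have "s\<^sup>2 / (2 * \<sigma>) = X\<^sup>2" using \<sigma>(2) by simp
    then show ?thesis by (simp add: sum_nonneg)
  next
    case False
    then have pos: "0 < H\<^sup>2 - 2 * \<sigma>" using A0 by simp
    have "(H * X - s)\<^sup>2 - (H\<^sup>2 - 2 * \<sigma>) * (X\<^sup>2 - s\<^sup>2 / (2 * \<sigma>))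
        = (2 * \<sigma> * X - H * s)\<^sup>2 / (2 * \<sigma>)"
      using \<sigma>(2) by (simp add: field_simps power2_eq_square)
    also have "\<dots> \<ge> 0" using \<sigma>(2) by simp
    finally have "(H\<^sup>2 - 2 * \<sigma>) * (X\<^sup>2 - s\<^sup>2 / (2 * \<sigma>)) \<le> (H\<^sup>2 - 2 * \<sigma>) * ?q" using A by linarith
    then have "X\<^sup>2 - s\<^sup>2 / (2 * \<sigma>) \<le> ?q" using pos by simp
    then show ?thesis by simp
  qed
qed

lemma sum_UNIV_remove:
  fixes g :: "'n::finite \<Rightarrow> real"
  shows "(\<Sum>i\<in>UNIV. g i) = g a + (\<Sum>i\<in>UNIV - {a}. g i)"
  by (simp add: sum.remove)

text \<open>When \<open>\<kappa>\<^sub>o\<close> carries almost all of \<open>H\<close>, the coefficients \<open>3\<close> beat the constant \<open>1\<close> needed for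
  the logarithm of \<open>H\<close>, in every direction but \<open>o\<close>.\<close>

lemma dominated_gradient_inequality:
  fixes \<kappa> x :: "'n::finite \<Rightarrow> real"
  defines "H \<equiv> \<Sum>i\<in>UNIV. \<kappa> i" and "X \<equiv> \<Sum>i\<in>UNIV. x i"
  defines "s \<equiv> \<Sum>i\<in>UNIV. (H - \<kappa> i) * x i"
  assumes H: "0 < H" and A: "(\<Sum>i\<in>UNIV. (\<kappa> i)\<^sup>2) \<le> H\<^sup>2"
    and dom: "99 / 100 * H \<le> \<kappa> o'" and k: "k \<noteq> o'" and \<tau>: "0 \<le> \<tau>" "\<tau> \<le> 3 / 10"
  shows "(\<Sum>i\<in>UNIV. (if i = k then 1 else 3) * (x i)\<^sup>2) - X\<^sup>2
    \<ge> (1 + \<tau>) * ((H - \<kappa> k) / H) * X\<^sup>2 - 30 * s\<^sup>2 / H\<^sup>2"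
proof -
  let ?R = "UNIV - {o'}"
  define y where "y = (\<Sum>i\<in>?R. (x i)\<^sup>2)"
  define a where "a = \<kappa> o' * x o' / H"
  define b where "b = (\<Sum>i\<in>?R. \<kappa> i * x i) / H"
  define c where "c = s / H"
  have y0: "0 \<le> y" by (simp add: y_def sum_nonneg)
  have "(99/100 * H)\<^sup>2 \<le> (\<kappa> o')\<^sup>2" using dom H by (intro power_mono) auto
  then have "9801/10000 * H\<^sup>2 \<le> (\<kappa> o')\<^sup>2" by (simp add: power_mult_distrib power2_eq_square)
  then have oo: "99/100 * H\<^sup>2 \<le> (\<kappa> o')\<^sup>2 + H\<^sup>2 / 100"
    using zero_le_power2[of H] by linarith
  \<comment> \<open>The threshold 99/100 leaves at most 1 - 0.9801 < 0.02 of H^2 to all other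
    curvatures together.\<close>
  have rest: "(\<Sum>i\<in>?R. (\<kappa> i)\<^sup>2) \<le> 2/100 * H\<^sup>2"
    using A oo sum_UNIV_remove[of "\<lambda>i. (\<kappa> i)\<^sup>2" o'] by simp
  have "(\<kappa> o')\<^sup>2 \<le> H\<^sup>2"
    using A sum_UNIV_remove[of "\<lambda>i. (\<kappa> i)\<^sup>2" o'] sum_nonneg[of ?R "\<lambda>i. (\<kappa> i)\<^sup>2"] by simp
  then have a2: "a\<^sup>2 \<le> (x o')\<^sup>2"
    using H mult_right_mono[of "(\<kappa> o')\<^sup>2" "H\<^sup>2" "(x o')\<^sup>2"]
    by (simp add: a_def power_divide power_mult_distrib divide_le_eq mult.commute)
  have b2: "b\<^sup>2 \<le> 2/100 * y"
  proof -
    have "(\<Sum>i\<in>?R. \<kappa> i * x i)\<^sup>2 \<le> (\<Sum>i\<in>?R. (\<kappa> i)\<^sup>2) * y"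
      unfolding y_def by (rule Cauchy_Schwarz_ineq_sum)
    also have "\<dots> \<le> 2/100 * H\<^sup>2 * y" using rest y0 by (rule mult_right_mono)
    finally show ?thesis using H by (simp add: b_def power_divide divide_le_eq mult_ac)
  qed
  have "s = H * X - (\<Sum>i\<in>UNIV. \<kappa> i * x i)"
    by (simp add: s_def X_def left_diff_distrib sum_subtractf sum_distrib_left)
  then have "H * X = s + \<kappa> o' * x o' + (\<Sum>i\<in>?R. \<kappa> i * x i)"
    using sum_UNIV_remove[of "\<lambda>i. \<kappa> i * x i" o'] by simp
  then have X: "X = a + b + c"
    using H by (simp add: a_def b_def c_def field_simps)
  \<comment> \<open>The target 5/2 is 1, for the X^2 subtracted on the left, plus 3/2, which bounds
    (1 + \<tau>) f_k / H. The weight 30 on b^2 is affordable because b^2 is at most y/50, so that it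
    costs less than y.\<close>
  have "5/2 * X\<^sup>2 \<le> 3 * a\<^sup>2 + 30 * b\<^sup>2 + 30 * c\<^sup>2"
  proof -
    have "3 * a\<^sup>2 + 30 * b\<^sup>2 + 30 * c\<^sup>2 - 5/2 * (a + b + c)\<^sup>2
      = 1/4 * (a - 10 * b)\<^sup>2 + 1/4 * (a - 10 * c)\<^sup>2 + 5/2 * (b - c)\<^sup>2"
      by (simp add: power2_eq_square field_simps)
    also have "\<dots> \<ge> 0" by simp
    finally show ?thesis by (simp add: X)
  qed
  then have main: "5/2 * X\<^sup>2 \<le> 3 * (x o')\<^sup>2 + y + 30 * s\<^sup>2 / H\<^sup>2"
    using a2 b2 y0 by (simp add: c_def power_divide)
  have lhs: "(\<Sum>i\<in>UNIV. (if i = k then 1 else 3) * (x i)\<^sup>2) \<ge> 3 * (x o')\<^sup>2 + y"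
  proof -
    have "(\<Sum>i\<in>?R. (if i = k then 1 else 3) * (x i)\<^sup>2) \<ge> y"
      unfolding y_def by (rule sum_mono) auto
    then show ?thesis using sum_UNIV_remove[of "\<lambda>i. (if i = k then 1 else 3) * (x i)\<^sup>2" o'] k by simp
  qed
  have "(\<kappa> k)\<^sup>2 \<le> (\<Sum>i\<in>?R. (\<kappa> i)\<^sup>2)"
    using k by (intro member_le_sum) auto
  then have "(\<kappa> k)\<^sup>2 \<le> 225/10000 * H\<^sup>2" using rest zero_le_power2[of H] by linarith
  then have "(\<kappa> k)\<^sup>2 \<le> (15/100 * H)\<^sup>2" by (simp add: power_mult_distrib power2_eq_square)
  then have "\<bar>\<kappa> k\<bar> \<le> 15/100 * H" using H by (simp add: abs_le_square_iff[symmetric])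
  then have "(H - \<kappa> k) / H \<le> 115/100" using H by (simp add: divide_le_eq)
  moreover have "0 \<le> (H - \<kappa> k) / H" using \<open>\<bar>\<kappa> k\<bar> \<le> 15/100 * H\<close> H by simp
  ultimately have "(1 + \<tau>) * ((H - \<kappa> k) / H) \<le> (1 + 3/10) * (115/100)"
    using \<tau> by (intro mult_mono) auto
  also have "(1 + 3/10) * (115/100) \<le> (3/2 :: real)" by simp
  finally have "(1 + \<tau>) * ((H - \<kappa> k) / H) \<le> 3/2" .
  then have "(1 + \<tau>) * ((H - \<kappa> k) / H) * X\<^sup>2 \<le> 3/2 * X\<^sup>2" by (rule mult_right_mono) simp
  then show ?thesis using main lhs by linarith
qed

text \<open>For i \<noteq> k the value B_iik occupies three positions of the symmetric tensor, for i
  = k only one; entries with three distinct indices are dropped. The resulting 3 is what beats the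
  coefficient 1 of |\<nabla>H|^2.\<close>

lemma symmetric_tensor_norm_ge:
  fixes B :: "'n::finite \<Rightarrow> 'n \<Rightarrow> 'n \<Rightarrow> real"
  assumes B: "\<And>i j k. B i j k = B j i k" "\<And>i j k. B i j k = B i k j"
  shows "(\<Sum>k\<in>UNIV. \<Sum>i\<in>UNIV. (if i = k then 1 else 3) * (B i i k)\<^sup>2)
    \<le> (\<Sum>k\<in>UNIV. \<Sum>i\<in>UNIV. \<Sum>j\<in>UNIV. (B i j k)\<^sup>2)"
proof -
  let ?g = "\<lambda>i j k. (if i = j then (B i i k)\<^sup>2 else 0)
      + (if i = k then (if i \<noteq> j then (B i i j)\<^sup>2 else 0) else 0)
      + (if j = k then (if i \<noteq> j then (B j j i)\<^sup>2 else 0) else 0)"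
  let ?m = "\<lambda>k. \<Sum>i\<in>UNIV. (if k \<noteq> i then (B k k i)\<^sup>2 else 0)"
  let ?n = "\<lambda>k. \<Sum>i\<in>UNIV. (if k \<noteq> i then (B i i k)\<^sup>2 else 0)"
  have "?g i j k \<le> (B i j k)\<^sup>2" for i j k
  proof -
    have "B i j i = B i i j" "B i j j = B j j i" using B by metis+
    then show ?thesis by auto
  qed
  then have "(\<Sum>k\<in>UNIV. \<Sum>i\<in>UNIV. \<Sum>j\<in>UNIV. ?g i j k) \<le> (\<Sum>k\<in>UNIV. \<Sum>i\<in>UNIV. \<Sum>j\<in>UNIV. (B i j k)\<^sup>2)"
    by (intro sum_mono)
  moreover have "(\<Sum>i\<in>UNIV. \<Sum>j\<in>UNIV. ?g i j k) = (\<Sum>i\<in>UNIV. (B i i k)\<^sup>2) + ?m k + ?m k" for k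
  proof -
    have "(\<Sum>i\<in>UNIV. \<Sum>j\<in>UNIV. (if i = k then (if i \<noteq> j then (B i i j)\<^sup>2 else 0) else 0)) = ?m k"
      by (subst sum.swap) simp
    moreover have "(\<Sum>i\<in>UNIV. \<Sum>j\<in>UNIV. (if j = k then (if i \<noteq> j then (B j j i)\<^sup>2 else 0) else 0)) = ?m k"
      by (simp add: eq_commute)
    ultimately show ?thesis by (simp add: sum.distrib)
  qed
  moreover have "(\<Sum>k\<in>UNIV. ?m k) = (\<Sum>k\<in>UNIV. ?n k)"
    by (subst sum.swap) (simp add: eq_commute)
  moreover have "(\<Sum>i\<in>UNIV. (B i i k)\<^sup>2) + ?n k + ?n k = (\<Sum>i\<in>UNIV. (if i = k then 1 else 3) * (B i i k)\<^sup>2)" for k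
    unfolding sum.distrib[symmetric] by (intro sum.cong) auto
  moreover have "(\<Sum>k\<in>UNIV. (\<Sum>i\<in>UNIV. (B i i k)\<^sup>2) + ?n k + ?n k)
      = (\<Sum>k\<in>UNIV. \<Sum>i\<in>UNIV. (B i i k)\<^sup>2) + (\<Sum>k\<in>UNIV. ?n k) + (\<Sum>k\<in>UNIV. ?n k)"
    by (simp only: sum.distrib)
  moreover have "(\<Sum>k\<in>UNIV. (\<Sum>i\<in>UNIV. (B i i k)\<^sup>2) + ?m k + ?m k)
      = (\<Sum>k\<in>UNIV. \<Sum>i\<in>UNIV. (B i i k)\<^sup>2) + (\<Sum>k\<in>UNIV. ?m k) + (\<Sum>k\<in>UNIV. ?m k)"
    by (simp only: sum.distrib)
  ultimately show ?thesis by (simp only:)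
qed


text \<open>The scalar content of the maximum principle at a maximum point of
  \<open>ln H + \<beta> ln \<eta> + N |x|\<^sup>2 / 2\<close>: here \<open>LH\<close>, \<open>Le\<close>, \<open>LX\<close> are the values of the linearized operator on
  \<open>H\<close>, \<open>\<eta>\<close>, \<open>|x|\<^sup>2 / 2\<close>, and \<open>D\<close> is the Laplacian of \<open>\<sigma>\<close>. If no \<open>\<kappa>\<^sub>i\<close> dominates, the cubic
  term \<open>\<Sum> f\<^sub>i \<kappa>\<^sub>i\<^sup>2\<close> absorbs everything.\<close>

lemma pointwise_estimate:
  fixes \<kappa> x e1 :: "'n::finite \<Rightarrow> real" and B :: "'n \<Rightarrow> 'n \<Rightarrow> 'n \<Rightarrow> real" and N \<beta> C1 C2 C4 C5 m K R E \<eta> :: real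
  defines "n \<equiv> real CARD('n)"
  defines "H \<equiv> \<Sum>i\<in>UNIV. \<kappa> i"
  defines "f \<equiv> \<lambda>i. H - \<kappa> i"
  defines "H1 \<equiv> \<lambda>k. \<Sum>i\<in>UNIV. B i i k" and "s1 \<equiv> \<lambda>k. \<Sum>i\<in>UNIV. f i * B i i k"
  defines "C3 \<equiv> n * (30 * C2\<^sup>2 + C2\<^sup>2 / (2 * m))" and "a \<equiv> \<beta> * E + N * R * E"
  assumes pos: "0 \<le> C1" "0 \<le> C4" "0 \<le> C5" "0 < m" "0 \<le> K" "0 \<le> R" "0 \<le> E"
    and H: "0 < H" and \<sigma>: "2 * \<sigma> = H\<^sup>2 - (\<Sum>i\<in>UNIV. (\<kappa> i)\<^sup>2)" "m \<le> \<sigma>" "\<sigma> \<le> K"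
    and B: "\<And>i j k. B i j k = B j i k" "\<And>i j k. B i j k = B i k j"
    and LH: "LH = D + (\<Sum>k\<in>UNIV. \<Sum>i\<in>UNIV. \<Sum>j\<in>UNIV. (B i j k)\<^sup>2) - (\<Sum>k\<in>UNIV. (H1 k)\<^sup>2)
      + (H * (\<Sum>i\<in>UNIV. f i * (\<kappa> i)\<^sup>2) - 2 * \<sigma> * (\<Sum>i\<in>UNIV. (\<kappa> i)\<^sup>2))"
    and D: "- C1 * (H\<^sup>2 + (\<Sum>k\<in>UNIV. \<bar>H1 k\<bar>)) \<le> D"
    and s1: "\<And>k. \<bar>s1 k\<bar> \<le> C2 * H"
    and crit: "\<And>k. H1 k / H + \<beta> * (e1 k / \<eta>) + N * x k = 0"
    and x: "\<And>k. \<bar>x k\<bar> \<le> R" and e1: "\<And>k. \<bar>e1 k\<bar> \<le> E" and \<eta>: "0 < \<eta>" "\<eta> \<le> E"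
    and Le: "\<bar>Le\<bar> \<le> C4" and LX: "H - C5 \<le> LX"
    and max: "(LH / H - (\<Sum>k\<in>UNIV. f k * (H1 k)\<^sup>2) / H\<^sup>2)
      + \<beta> * (Le / \<eta> - (\<Sum>k\<in>UNIV. f k * (e1 k)\<^sup>2) / \<eta>\<^sup>2) + N * LX \<le> 0"
    and N: "C1 + C3 + 2 * K + 2 \<le> N" and \<beta>: "7 \<le> \<beta>" "4 * n * N\<^sup>2 * R\<^sup>2 \<le> \<beta>"
  shows "H * \<eta> \<le> E + 100 * (E\<^sup>2 * (4 * K + C1 + C3) + C1 * n * a * E + 2 * n * a\<^sup>2 + \<beta> * C4 * E
      + 2 * n * \<beta> * E\<^sup>2 + N * C5 * E\<^sup>2) + 1 + 2 * (a\<^sup>2 + \<beta> * E\<^sup>2 + 1) + (C1 * n * a + \<beta> * C4 + N * C5 * E)"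
proof -
  let ?A = "\<Sum>i\<in>UNIV. (\<kappa> i)\<^sup>2"
  have n0: "0 \<le> n" by (simp add: n_def)
  have C30: "0 \<le> C3" using n0 pos by (simp add: C3_def)
  have N0: "0 \<le> N" using N pos C30 by linarith
  have a0: "0 \<le> a" using \<beta> N0 pos by (simp add: a_def)
  define P where "P = E\<^sup>2 * (4 * K + C1 + C3) + C1 * n * a * E + 2 * n * a\<^sup>2 + \<beta> * C4 * E
      + 2 * n * \<beta> * E\<^sup>2 + N * C5 * E\<^sup>2"
  define Q where "Q = a\<^sup>2 + \<beta> * E\<^sup>2 + 1"
  define S where "S = C1 * n * a + \<beta> * C4 + N * C5 * E"
  have P0: "0 \<le> P" unfolding P_def using pos n0 C30 N0 a0 \<beta> by (intro add_nonneg_nonneg mult_nonneg_nonneg) auto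
  have Q0: "0 \<le> Q" unfolding Q_def using \<beta> by simp
  have S0: "0 \<le> S" unfolding S_def using pos n0 C30 N0 a0 \<beta> by (intro add_nonneg_nonneg mult_nonneg_nonneg) auto
  \<comment> \<open>The bound adds up the outcomes of all cases: E if H \<le> 1, 100 P + 1 if no
    curvature dominates, and 2 Q or S if one does.\<close>
  have "H * \<eta> \<le> E + 100 * P + 1 + 2 * Q + S"
  proof (cases "H \<le> 1")
    case True
    then have "H * \<eta> \<le> 1 * E" using \<eta> H by (intro mult_mono) auto
    then show ?thesis using P0 Q0 S0 by linarith
  next
    case False
    then have H1': "1 \<le> H" by simp
    have \<sigma>0: "0 < \<sigma>" using \<sigma> pos by linarith
    have AH: "?A \<le> H\<^sup>2" using \<sigma> \<sigma>0 by linarith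
    have kH: "\<bar>\<kappa> i\<bar> \<le> H" for i
    proof -
      have "(\<kappa> i)\<^sup>2 \<le> ?A" by (intro member_le_sum) auto
      then have "(\<kappa> i)\<^sup>2 \<le> H\<^sup>2" using AH by linarith
      then show ?thesis using H by (simp add: abs_le_square_iff[symmetric])
    qed
    have f0: "0 \<le> f i" and f2: "f i \<le> 2 * H" for i using kH[of i] by (auto simp: f_def)
    define y where "y = (\<lambda>k. H1 k / H)"
    have yeq: "y k = - (\<beta> * (e1 k / \<eta>) + N * x k)" for k using crit[of k] by (simp add: y_def)
    \<comment> \<open>The critical point equation trades the logarithmic gradient of H for that of
      \<eta>; the bounded term N x is put over \<eta> as well, using \<eta> \<le> E.\<close>
    have ya: "\<bar>y k\<bar> \<le> a / \<eta>" for k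
    proof -
      have "\<bar>e1 k / \<eta>\<bar> \<le> E / \<eta>" using e1[of k] \<eta> by (simp add: divide_right_mono)
      from mult_left_mono[OF this, of \<beta>]
      have "\<bar>\<beta> * (e1 k / \<eta>)\<bar> \<le> \<beta> * (E / \<eta>)" using \<beta> unfolding abs_mult by simp
      moreover have "\<bar>N * x k\<bar> \<le> N * R * E / \<eta>"
      proof -
        have "\<bar>N * x k\<bar> \<le> N * R" using N0 x by (simp add: abs_mult mult_left_mono)
        moreover have "N * R * \<eta> \<le> N * R * E" using \<eta> N0 pos by (intro mult_left_mono) auto
        ultimately show ?thesis using \<eta> by (simp add: le_divide_eq) (smt (verit) mult_right_mono)
      qed
      ultimately have "\<bar>\<beta> * (e1 k / \<eta>) + N * x k\<bar> \<le> \<beta> * (E / \<eta>) + N * R * E / \<eta>" by linarith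
      then show ?thesis unfolding yeq a_def by (simp add: add_divide_distrib)
    qed
    have e1sq: "(e1 k / \<eta>)\<^sup>2 \<le> (E / \<eta>)\<^sup>2" for k
      using power_mono[OF e1[of k], of 2] \<eta> by (simp add: power_divide divide_right_mono)
    have ysum: "(\<Sum>k\<in>UNIV. \<bar>y k\<bar>) \<le> n * a / \<eta>"
      using sum_mono[of UNIV "\<lambda>k. \<bar>y k\<bar>" "\<lambda>k. a / \<eta>"] ya by (simp add: n_def)
    have H1y: "H1 k = H * y k" for k using H by (simp add: y_def)
    \<comment> \<open>All third-order terms of direction k. Concavity alone bounds them below by a
      multiple of H^2, with no gain; the gain needs a dominating curvature.\<close>
    define G where "G = (\<lambda>k. (\<Sum>i\<in>UNIV. (if i = k then 1 else 3) * (B i i k)\<^sup>2) - (H1 k)\<^sup>2)"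
    have G1: "- C2\<^sup>2 * H\<^sup>2 / (2 * m) \<le> G k" for k
    proof -
      have "- ((s1 k)\<^sup>2 / (2 * \<sigma>)) \<le> (\<Sum>i\<in>UNIV. (B i i k)\<^sup>2) - (H1 k)\<^sup>2"
        unfolding s1_def f_def H_def H1_def
        by (rule sum_squares_concavity) (use \<sigma>(1) \<sigma>0 in \<open>auto simp: H_def\<close>)
      also have "\<dots> \<le> G k" unfolding G_def by (intro diff_right_mono sum_mono) auto
      finally have "- ((s1 k)\<^sup>2 / (2 * \<sigma>)) \<le> G k" .
      moreover have "(s1 k)\<^sup>2 / (2 * \<sigma>) \<le> (C2 * H)\<^sup>2 / (2 * m)"
      proof (rule frac_le)
        show "(s1 k)\<^sup>2 \<le> (C2 * H)\<^sup>2" using power_mono[OF s1[of k], of 2] by simp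
      qed (use \<sigma>(2) pos in auto)
      ultimately show ?thesis by (simp add: power_mult_distrib)
    qed
    have LHge: "D / H + (\<Sum>k\<in>UNIV. G k) / H + (\<Sum>i\<in>UNIV. f i * (\<kappa> i)\<^sup>2) - 2 * \<sigma> * ?A / H \<le> LH / H"
    proof -
      have "(\<Sum>k\<in>UNIV. G k) \<le> (\<Sum>k\<in>UNIV. \<Sum>i\<in>UNIV. \<Sum>j\<in>UNIV. (B i j k)\<^sup>2) - (\<Sum>k\<in>UNIV. (H1 k)\<^sup>2)"
        unfolding G_def using symmetric_tensor_norm_ge[OF B] by (simp add: sum_subtractf)
      then have "D + (\<Sum>k\<in>UNIV. G k) + H * (\<Sum>i\<in>UNIV. f i * (\<kappa> i)\<^sup>2) - 2 * \<sigma> * ?A \<le> LH"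
        unfolding LH by linarith
      from divide_right_mono[OF this, of H] show ?thesis
        using H by (simp add: add_divide_distrib diff_divide_distrib)
    qed
    have DH: "- C1 * H - C1 * n * a / \<eta> \<le> D / H"
    proof -
      have "(\<Sum>k\<in>UNIV. \<bar>H1 k\<bar>) = H * (\<Sum>k\<in>UNIV. \<bar>y k\<bar>)"
        using H by (simp add: H1y abs_mult sum_distrib_left)
      then have "- C1 * (H + (\<Sum>k\<in>UNIV. \<bar>y k\<bar>)) \<le> D / H"
        using D H by (simp add: le_divide_eq power2_eq_square algebra_simps)
      moreover have "C1 * (\<Sum>k\<in>UNIV. \<bar>y k\<bar>) \<le> C1 * (n * a / \<eta>)" using ysum pos by (intro mult_left_mono)
      ultimately show ?thesis by (simp add: algebra_simps)
    qed
    have AK: "2 * \<sigma> * ?A / H \<le> 2 * K * H"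
    proof -
      have "2 * \<sigma> * ?A \<le> 2 * K * H\<^sup>2" using \<sigma> \<sigma>0 AH by (intro mult_mono) (auto simp: sum_nonneg)
      then show ?thesis using H by (simp add: divide_le_eq power2_eq_square mult.assoc)
    qed
    have yy: "(\<Sum>k\<in>UNIV. f k * (H1 k)\<^sup>2) / H\<^sup>2 = (\<Sum>k\<in>UNIV. f k * (y k)\<^sup>2)"
      by (simp add: y_def power_divide sum_divide_distrib)
    have ee: "(\<Sum>k\<in>UNIV. f k * (e1 k)\<^sup>2) / \<eta>\<^sup>2 = (\<Sum>k\<in>UNIV. f k * (e1 k / \<eta>)\<^sup>2)"
      by (simp add: power_divide sum_divide_distrib)
    have Le': "- (\<beta> * C4 / \<eta>) \<le> \<beta> * (Le / \<eta>)"
      using Le \<eta> \<beta> by (simp add: divide_simps) (smt (verit) mult_left_mono mult_minus_right)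
    have LX': "N * H - N * C5 \<le> N * LX" using LX N0 by (metis mult_left_mono right_diff_distrib)
    have master: "- C1 * H - C1 * n * a / \<eta> + (\<Sum>k\<in>UNIV. G k) / H + (\<Sum>i\<in>UNIV. f i * (\<kappa> i)\<^sup>2) - 2 * K * H
        - (\<Sum>k\<in>UNIV. f k * (y k)\<^sup>2) - \<beta> * C4 / \<eta> - \<beta> * (\<Sum>k\<in>UNIV. f k * (e1 k / \<eta>)\<^sup>2) + N * H - N * C5 \<le> 0"
      using max LHge DH AK Le' LX' unfolding yy ee by (simp add: right_diff_distrib)
    show ?thesis
    proof (cases "\<exists>i. 99 / 100 * H \<le> \<kappa> i")
      case False
      then have nd: "\<kappa> i \<le> 99 / 100 * H" for i by (meson linear)
      \<comment> \<open>Every f_i is at least H/100, so the sum is at least H/100 times \<Sum>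
        \<kappa>_i^2 = H^2 - 2 \<sigma>.\<close>
      have cubic: "H / 100 * (H\<^sup>2 - 2 * K) \<le> (\<Sum>i\<in>UNIV. f i * (\<kappa> i)\<^sup>2)"
      proof -
        have "H / 100 * (H\<^sup>2 - 2 * K) \<le> H / 100 * ?A" using \<sigma> H by (intro mult_left_mono) auto
        also have "\<dots> \<le> (\<Sum>i\<in>UNIV. f i * (\<kappa> i)\<^sup>2)"
          unfolding sum_distrib_left
        proof (intro sum_mono mult_right_mono)
          show "H / 100 \<le> f i" for i using nd[of i] unfolding f_def by linarith
        qed simp
        finally show ?thesis .
      qed
      have G': "- C3 * H \<le> (\<Sum>k\<in>UNIV. G k) / H"
      proof -
        have "n * (- C2\<^sup>2 * H\<^sup>2 / (2 * m)) \<le> (\<Sum>k\<in>UNIV. G k)"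
          using sum_mono[of UNIV "\<lambda>k. - C2\<^sup>2 * H\<^sup>2 / (2 * m)" G] G1 by (simp add: n_def)
        moreover have "- C3 * H * H \<le> n * (- C2\<^sup>2 * H\<^sup>2 / (2 * m))"
        proof -
          have "0 \<le> n * (30 * C2\<^sup>2 * H\<^sup>2)" using n0 by simp
          moreover have "C3 * H * H = n * (30 * C2\<^sup>2 * H\<^sup>2) + n * (C2\<^sup>2 * H\<^sup>2 / (2 * m))"
            using pos(4) by (simp add: C3_def power2_eq_square field_simps)
          ultimately show ?thesis by simp
        qed
        ultimately show ?thesis using H by (simp add: le_divide_eq)
      qed
      have fy: "(\<Sum>k\<in>UNIV. f k * (y k)\<^sup>2) \<le> n * (2 * H * (a / \<eta>)\<^sup>2)"
      proof -
        have "f k * (y k)\<^sup>2 \<le> 2 * H * (a / \<eta>)\<^sup>2" for k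
          using f0 f2 H power_mono[OF ya[of k], of 2] by (intro mult_mono) auto
        then show ?thesis using sum_bounded_above[of UNIV "\<lambda>k. f k * (y k)\<^sup>2"] by (simp add: n_def)
      qed
      have fe: "(\<Sum>k\<in>UNIV. f k * (e1 k / \<eta>)\<^sup>2) \<le> n * (2 * H * (E / \<eta>)\<^sup>2)"
      proof -
        have "f k * (e1 k / \<eta>)\<^sup>2 \<le> 2 * H * (E / \<eta>)\<^sup>2" for k
          using f0 f2 H e1sq by (intro mult_mono) auto
        then show ?thesis using sum_bounded_above[of UNIV "\<lambda>k. f k * (e1 k / \<eta>)\<^sup>2"] by (simp add: n_def)
      qed
      have fe': "\<beta> * (\<Sum>k\<in>UNIV. f k * (e1 k / \<eta>)\<^sup>2) \<le> \<beta> * (n * (2 * H * (E / \<eta>)\<^sup>2))"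
        using fe \<beta> by (intro mult_left_mono) auto
      have "0 \<le> N * H" using N0 H by simp
      then have m1: "H / 100 * (H\<^sup>2 - 2 * K) \<le> C1 * H + C1 * n * a / \<eta> + C3 * H + 2 * K * H
          + n * (2 * H * (a / \<eta>)\<^sup>2) + \<beta> * C4 / \<eta> + \<beta> * (n * (2 * H * (E / \<eta>)\<^sup>2)) + N * C5"
        using master cubic G' fy fe' by linarith
      have main: "H / 100 * H\<^sup>2 \<le> H * (4 * K + C1 + C3) + C1 * n * a / \<eta>
          + n * (2 * H * (a / \<eta>)\<^sup>2) + \<beta> * C4 / \<eta> + \<beta> * (n * (2 * H * (E / \<eta>)\<^sup>2)) + N * C5"
      proof -
        have "0 \<le> H * K" using H pos by simp
        moreover have "H / 100 * (H\<^sup>2 - 2 * K) = H / 100 * H\<^sup>2 - (H * K) / 50" by (simp add: right_diff_distrib)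
        moreover have "H * (4 * K + C1 + C3) = 4 * (H * K) + C1 * H + C3 * H" by (simp add: algebra_simps)
        moreover have "2 * K * H = 2 * (H * K)" by simp
        ultimately show ?thesis using m1 by linarith
      qed
      \<comment> \<open>Multiplying by \<eta>^2 clears the denominators. Since H \<ge> 1, every term
        on the right is at most a multiple of H, and one factor H cancels.\<close>
      have "H / 100 * H\<^sup>2 * \<eta>\<^sup>2 \<le> (H * (4 * K + C1 + C3) + C1 * n * a / \<eta>
          + n * (2 * H * (a / \<eta>)\<^sup>2) + \<beta> * C4 / \<eta> + \<beta> * (n * (2 * H * (E / \<eta>)\<^sup>2)) + N * C5) * \<eta>\<^sup>2"
        using main by (rule mult_right_mono) simp
      also have "\<dots> = H * (\<eta>\<^sup>2 * (4 * K + C1 + C3)) + C1 * n * a * \<eta> + H * (2 * n * a\<^sup>2) + \<beta> * C4 * \<eta>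
          + H * (2 * n * \<beta> * E\<^sup>2) + N * C5 * \<eta>\<^sup>2"
        using \<eta> by (simp add: field_simps power2_eq_square)
      also have "\<dots> \<le> H * (E\<^sup>2 * (4 * K + C1 + C3)) + H * (C1 * n * a * E) + H * (2 * n * a\<^sup>2)
          + H * (\<beta> * C4 * E) + H * (2 * n * \<beta> * E\<^sup>2) + H * (N * C5 * E\<^sup>2)"
      proof -
        have e2: "\<eta>\<^sup>2 \<le> E\<^sup>2" using \<eta> by (intro power_mono) auto
        have "H * (\<eta>\<^sup>2 * (4 * K + C1 + C3)) \<le> H * (E\<^sup>2 * (4 * K + C1 + C3))"
          using e2 H pos C30 by (intro mult_left_mono mult_right_mono) auto
        moreover have "1 * (C1 * n * a * \<eta>) \<le> H * (C1 * n * a * E)"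
          using \<eta> H1' pos n0 a0 by (intro mult_mono) auto
        moreover have "1 * (\<beta> * C4 * \<eta>) \<le> H * (\<beta> * C4 * E)"
          using \<eta> H1' pos \<beta> by (intro mult_mono) auto
        moreover have "1 * (N * C5 * \<eta>\<^sup>2) \<le> H * (N * C5 * E\<^sup>2)"
          using e2 H1' pos N0 by (intro mult_mono) auto
        ultimately show ?thesis by linarith
      qed
      also have "\<dots> = H * P" by (simp add: P_def algebra_simps)
      finally have "H * ((H * \<eta>)\<^sup>2 / 100) \<le> H * P" by (simp add: power2_eq_square mult_ac)
      then have "(H * \<eta>)\<^sup>2 \<le> 100 * P" using H by simp
      moreover have "H * \<eta> \<le> (H * \<eta>)\<^sup>2 + 1"
        using zero_le_power2[of "H * \<eta> - 1/2"] by (simp add: power2_eq_square algebra_simps)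
      ultimately show ?thesis using Q0 S0 pos by linarith
    next
      case True
      then obtain o' where dom: "99 / 100 * H \<le> \<kappa> o'" by blast
      \<comment> \<open>The smallest gain that pays for \<eta>. The requirement \<beta> \<ge> 7
        makes it at most 2/7, below the 3/10 allowed by the gradient inequality.\<close>
      define \<tau> where "\<tau> = 2 / \<beta>"
      have \<tau>: "0 \<le> \<tau>" "\<tau> \<le> 3 / 10" "\<tau> * \<beta> = 2" using \<beta> by (auto simp: \<tau>_def field_simps)
      have Gk: "(1 + \<tau>) * f k * (y k)\<^sup>2 - 30 * C2\<^sup>2 * H \<le> G k / H" if k: "k \<noteq> o'" for k
      proof -
        have "(1 + \<tau>) * (f k / H) * (H1 k)\<^sup>2 - 30 * (s1 k)\<^sup>2 / H\<^sup>2 \<le> G k"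
          unfolding G_def f_def H1_def s1_def H_def
          by (rule dominated_gradient_inequality[OF _ _ _ k \<tau>(1,2)]) (use H AH dom in \<open>auto simp: H_def\<close>)
        moreover have "(s1 k)\<^sup>2 / H\<^sup>2 \<le> C2\<^sup>2"
          using power_mono[OF s1[of k], of 2] H by (simp add: divide_le_eq power_mult_distrib)
        moreover have "(1 + \<tau>) * (f k / H) * (H1 k)\<^sup>2 = H * ((1 + \<tau>) * f k * (y k)\<^sup>2)"
          using H by (simp add: H1y power2_eq_square)
        ultimately have "H * ((1 + \<tau>) * f k * (y k)\<^sup>2) - 30 * C2\<^sup>2 \<le> G k" by linarith
        moreover have "30 * C2\<^sup>2 \<le> H * (30 * C2\<^sup>2 * H)"
        proof -
          have "1 \<le> H\<^sup>2" using H1' by simp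
          from mult_left_mono[OF this, of "30 * C2\<^sup>2"] show ?thesis by (simp add: power2_eq_square mult_ac)
        qed
        ultimately have "H * ((1 + \<tau>) * f k * (y k)\<^sup>2 - 30 * C2\<^sup>2 * H) \<le> G k" by (simp add: right_diff_distrib)
        then show ?thesis using H by (simp add: le_divide_eq mult.commute)
      qed
      have Go: "- C2\<^sup>2 / (2 * m) * H \<le> G o' / H"
        using G1[of o'] H by (simp add: le_divide_eq power2_eq_square mult.assoc)
      define Z where "Z = (\<lambda>k. G k / H - f k * (y k)\<^sup>2 - \<beta> * (f k * (e1 k / \<eta>)\<^sup>2))"
      have c2: "0 \<le> C2\<^sup>2 / (2 * m) * H" "0 \<le> 30 * C2\<^sup>2 * H" using pos H by auto
      have Zk: "- (30 * C2\<^sup>2 + C2\<^sup>2 / (2 * m)) * H - H / n \<le> Z k" if k: "k \<noteq> o'" for k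
      proof -
        let ?u = "e1 k / \<eta>"
        \<comment> \<open>From (p + q)^2 \<ge> p^2/2 - q^2. After multiplication by \<tau> the first
          term is exactly the loss \<beta> ?u^2 caused by ln \<eta>; the second costs at most H/n by
          the lower bound on \<beta>, hence at most H over all directions.\<close>
        have sq: "\<beta>\<^sup>2 * ?u\<^sup>2 / 2 - (N * x k)\<^sup>2 \<le> (y k)\<^sup>2"
          unfolding yeq using zero_le_power2[of "\<beta> * ?u / 2 + N * x k"] zero_le_power2[of "\<beta> * ?u + 2 * (N * x k)"]
          by (simp add: power2_eq_square algebra_simps)
        have "\<tau> * (\<beta>\<^sup>2 * ?u\<^sup>2 / 2 - (N * x k)\<^sup>2) \<le> \<tau> * (y k)\<^sup>2" using sq \<tau>(1) by (rule mult_left_mono)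
        moreover have "\<tau> * (\<beta>\<^sup>2 * ?u\<^sup>2 / 2) = \<beta> * ?u\<^sup>2"
        proof -
          have "\<tau> * (\<beta>\<^sup>2 * ?u\<^sup>2 / 2) = (\<tau> * \<beta>) * (\<beta> * ?u\<^sup>2) / 2" by (simp add: power2_eq_square)
          then show ?thesis unfolding \<tau>(3) by simp
        qed
        moreover have "\<tau> * (\<beta>\<^sup>2 * ?u\<^sup>2 / 2 - (N * x k)\<^sup>2) = \<tau> * (\<beta>\<^sup>2 * ?u\<^sup>2 / 2) - \<tau> * (N * x k)\<^sup>2"
          by (rule right_diff_distrib)
        ultimately have "\<beta> * ?u\<^sup>2 - \<tau> * (N * x k)\<^sup>2 \<le> \<tau> * (y k)\<^sup>2" by linarith
        then have "f k * (\<beta> * ?u\<^sup>2 - \<tau> * (N * x k)\<^sup>2) \<le> f k * (\<tau> * (y k)\<^sup>2)" using f0 by (rule mult_left_mono)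
        moreover have "f k * (\<tau> * (N * x k)\<^sup>2) \<le> H / n"
        proof -
          have n1: "0 < n" by (simp add: n_def)
          have "(N * x k)\<^sup>2 \<le> (N * R)\<^sup>2"
            using x[of k] N0 by (intro power2_le_iff_abs_le[THEN iffD2]) (auto simp: abs_mult mult_left_mono pos)
          then have "f k * (\<tau> * (N * x k)\<^sup>2) \<le> 2 * H * (\<tau> * (N * R)\<^sup>2)"
            using f0 f2 \<tau> H by (intro mult_mono) auto
          also have "\<dots> = H * (4 * n * N\<^sup>2 * R\<^sup>2) / (n * \<beta>)" using n1 \<beta> by (simp add: \<tau>_def field_simps power_mult_distrib)
          also have "\<dots> \<le> H * \<beta> / (n * \<beta>)"
            using \<beta> n1 H by (intro divide_right_mono mult_left_mono) auto
          also have "\<dots> = H / n" using \<beta> by simp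
          finally show ?thesis .
        qed
        ultimately have "\<beta> * (f k * ?u\<^sup>2) - H / n \<le> \<tau> * f k * (y k)\<^sup>2" by (simp add: algebra_simps)
        moreover have "(1 + \<tau>) * f k * (y k)\<^sup>2 = f k * (y k)\<^sup>2 + \<tau> * f k * (y k)\<^sup>2" by (simp add: algebra_simps)
        ultimately show ?thesis unfolding Z_def using Gk[OF k] c2 by (simp add: algebra_simps)
      qed
      \<comment> \<open>In the dominating direction only concavity is available, so the losses from
        H and \<eta> remain, but with the factor \<open>f o'\<close> kept in front.\<close>
      have Zo: "- (30 * C2\<^sup>2 + C2\<^sup>2 / (2 * m)) * H - H / n - f o' * ((a / \<eta>)\<^sup>2 + \<beta> * (E / \<eta>)\<^sup>2) \<le> Z o'"
      proof -
        have c1: "(y o')\<^sup>2 \<le> (a / \<eta>)\<^sup>2" using power_mono[OF ya[of o'], of 2] by simp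
        have c2': "\<beta> * (e1 o' / \<eta>)\<^sup>2 \<le> \<beta> * (E / \<eta>)\<^sup>2"
          using \<beta> e1sq by (intro mult_left_mono) auto
        have "f o' * ((y o')\<^sup>2 + \<beta> * (e1 o' / \<eta>)\<^sup>2) \<le> f o' * ((a / \<eta>)\<^sup>2 + \<beta> * (E / \<eta>)\<^sup>2)"
          by (rule mult_left_mono[OF add_mono[OF c1 c2'] f0])
        moreover have "0 \<le> H / n" using H n0 by simp
        ultimately show ?thesis unfolding Z_def using Go c2 by (simp add: algebra_simps)
      qed
      have Zsum: "- C3 * H - H - f o' * ((a / \<eta>)\<^sup>2 + \<beta> * (E / \<eta>)\<^sup>2) \<le> (\<Sum>k\<in>UNIV. Z k)"
      proof -
        have "(\<Sum>k\<in>UNIV. - (30 * C2\<^sup>2 + C2\<^sup>2 / (2 * m)) * H - H / n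
            - (if k = o' then f o' * ((a / \<eta>)\<^sup>2 + \<beta> * (E / \<eta>)\<^sup>2) else 0)) \<le> (\<Sum>k\<in>UNIV. Z k)"
          using Zk Zo by (intro sum_mono) auto
        then show ?thesis by (simp add: sum_subtractf sum.distrib C3_def n_def algebra_simps)
      qed
      have m2: "- C1 * H - C1 * n * a / \<eta> + (\<Sum>k\<in>UNIV. Z k) + (\<Sum>i\<in>UNIV. f i * (\<kappa> i)\<^sup>2) - 2 * K * H
          - \<beta> * C4 / \<eta> + N * H - N * C5 \<le> 0"
      proof -
        have "(\<Sum>k\<in>UNIV. Z k) = (\<Sum>k\<in>UNIV. G k) / H - (\<Sum>k\<in>UNIV. f k * (y k)\<^sup>2) - \<beta> * (\<Sum>k\<in>UNIV. f k * (e1 k / \<eta>)\<^sup>2)"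
          unfolding Z_def by (simp add: sum_subtractf sum_divide_distrib sum_distrib_left)
        then show ?thesis using master by linarith
      qed
      \<comment> \<open>This has the same factor \<open>f o'\<close> as those losses and absorbs
        them as soon as (H \<eta>)^2 \<ge> 4 (a^2 + \<beta> E^2), however small \<open>f o'\<close>
        is.\<close>
      have cub: "f o' * (H\<^sup>2 / 4) \<le> (\<Sum>i\<in>UNIV. f i * (\<kappa> i)\<^sup>2)"
      proof -
        have "H / 2 \<le> \<kappa> o'" using dom H by linarith
        then have "(H / 2)\<^sup>2 \<le> (\<kappa> o')\<^sup>2" using H by (intro power_mono) auto
        then have "f o' * (H\<^sup>2 / 4) \<le> f o' * (\<kappa> o')\<^sup>2" using f0 by (intro mult_left_mono) (auto simp: power_divide)
        also have "\<dots> \<le> (\<Sum>i\<in>UNIV. f i * (\<kappa> i)\<^sup>2)" using f0 by (intro member_le_sum) auto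
        finally show ?thesis .
      qed
      show ?thesis
      proof (cases "H * \<eta> \<le> 2 * Q")
        case True
        then show ?thesis using P0 S0 pos by linarith
      next
        case False
        have q1: "1 \<le> Q" using \<beta> by (simp add: Q_def)
        have "4 * Q \<le> (H * \<eta>)\<^sup>2"
        proof -
          have "(2 * Q)\<^sup>2 \<le> (H * \<eta>)\<^sup>2" using False q1 by (intro power_mono) auto
          moreover have "4 * Q * 1 \<le> 4 * Q * Q" using q1 by (intro mult_left_mono) auto
          ultimately show ?thesis by (simp add: power2_eq_square)
        qed
        then have "4 * (a\<^sup>2 + \<beta> * E\<^sup>2) \<le> H\<^sup>2 * \<eta>\<^sup>2" by (simp add: power_mult_distrib Q_def)
        then have "(a / \<eta>)\<^sup>2 + \<beta> * (E / \<eta>)\<^sup>2 \<le> H\<^sup>2 / 4"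
          using \<eta> by (simp add: power_divide add_divide_distrib[symmetric] divide_le_eq)
        then have "f o' * ((a / \<eta>)\<^sup>2 + \<beta> * (E / \<eta>)\<^sup>2) \<le> f o' * (H\<^sup>2 / 4)" using f0 by (intro mult_left_mono)
        then have "N * H - (C1 + C3 + 2 * K + 1) * H \<le> C1 * n * a / \<eta> + \<beta> * C4 / \<eta> + N * C5"
          using m2 Zsum cub by (simp add: algebra_simps)
        \<comment> \<open>All remaining terms of order H have coefficients free of \<beta>, so N can
          be fixed beforehand with one H to spare.\<close>
        moreover have "H \<le> N * H - (C1 + C3 + 2 * K + 1) * H"
        proof -
          have "1 * H \<le> (N - (C1 + C3 + 2 * K + 1)) * H" using N H by (intro mult_right_mono) auto
          then show ?thesis by (simp add: left_diff_distrib)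
        qed
        ultimately have "H \<le> C1 * n * a / \<eta> + \<beta> * C4 / \<eta> + N * C5" by linarith
        then have "H * \<eta> \<le> (C1 * n * a / \<eta> + \<beta> * C4 / \<eta> + N * C5) * \<eta>" using \<eta> by (intro mult_right_mono) auto
        also have "\<dots> = C1 * n * a + \<beta> * C4 + N * C5 * \<eta>" using \<eta> by (simp add: algebra_simps)
        also have "\<dots> \<le> S" using \<eta> N0 pos by (simp add: S_def mult_left_mono)
        finally show ?thesis using P0 Q0 pos by linarith
      qed
    qed
  qed
  then show ?thesis by (simp only: P_def Q_def S_def)
qed

section \<open>The shape operator of a graph in an adapted frame\<close>


lemma sum_Basis_vec:
  "(\<Sum>b\<in>Basis. f (b :: real^'n)) = (\<Sum>i\<in>UNIV. f (axis i 1))"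
proof -
  have *: "(Basis :: (real^'n) set) = (\<lambda>i. axis i 1) ` UNIV" by (auto simp: Basis_vec_def)
  show ?thesis unfolding * by (subst sum.reindex) (auto simp: inj_on_def axis_eq_axis)
qed

lemma grad_inner:
  assumes "x \<in> \<Omega>" "u differentiable (at x)"
  shows "e \<bullet> grad \<Omega> u x = partials [e] u x"
proof -
  have "partials [e] u x = (\<Sum>i\<in>UNIV. (e $ i) * partials [axis i 1] u x)"
    using frechet_derivative_basis_expansion[OF assms(2), of e] by (simp add: sum_Basis_vec inner_axis)
  then show ?thesis
    using assms(1) by (simp add: grad_def bdry_ext_def inner_vec_def)
qed

text \<open>Linearity is available in the outermost direction only; expanding, swapping and
  expanding again reaches both slots.\<close>

lemma hess_inner:
  assumes "open \<Omega>" "x \<in> \<Omega>" "Ck_on 2 \<Omega> u"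
  shows "e \<bullet> (hess \<Omega> u x *v e') = partials [e, e'] u x"
proof -
  have C: "Ck_on (Suc 0) \<Omega> (partials [v] u)" for v
    using Ck_on_partials1[OF assms(1), of 1 u v] assms(3) by (simp add: numeral_2_eq_2)
  have exp: "partials [e, v] u x = (\<Sum>i\<in>UNIV. (e $ i) * partials [axis i 1, v] u x)" for e v
    using grad_inner[OF assms(2) Ck_on_differentiable[OF C assms(2), of v], of e] assms(2)
    by (simp add: grad_def bdry_ext_def inner_vec_def)
  have "partials [e, e'] u x = (\<Sum>i\<in>UNIV. (e $ i) * partials [e', axis i 1] u x)"
    unfolding exp[of e e'] using partials_swap2[OF assms(1,3,2)] by simp
  also have "\<dots> = (\<Sum>i\<in>UNIV. (e $ i) * (\<Sum>j\<in>UNIV. (e' $ j) * partials [axis i 1, axis j 1] u x))"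
    unfolding exp[of e'] using partials_swap2[OF assms(1,3,2)] by simp
  also have "\<dots> = e \<bullet> (hess \<Omega> u x *v e')"
    using assms(2) by (simp add: hess_def bdry_ext_def inner_vec_def matrix_vector_mult_def mult.commute)
  finally show ?thesis by simp
qed

lemma hess_sym:
  assumes "open \<Omega>" "x \<in> \<Omega>" "Ck_on 2 \<Omega> u"
  shows "hess \<Omega> u x $ i $ j = hess \<Omega> u x $ j $ i"
  using partials_swap2[OF assms(1,3,2)] assms(2) by (simp add: hess_def bdry_ext_def)

text \<open>The dual basis of a frame that is orthonormal for the induced metric \<open>I - p p\<^sup>T\<close>.\<close>

locale metric_frame =
  fixes p :: "real^'n" and e :: "'n \<Rightarrow> real^'n" and w v :: real and b :: "'n \<Rightarrow> real"
    and d :: "'n \<Rightarrow> real^'n"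
  assumes p: "norm p < 1"
    and e: "\<And>i j. e i \<bullet> e j - (e i \<bullet> p) * (e j \<bullet> p) = (if i = j then 1 else 0)"
    and w: "w = sqrt (1 - (norm p)\<^sup>2)" and v: "v = 1 / w"
    and b: "b = (\<lambda>i. e i \<bullet> p)" and d: "d = (\<lambda>i. e i - b i *\<^sub>R p)"
begin

lemma w_pos: "0 < w" and w_sq: "w\<^sup>2 = 1 - p \<bullet> p"
proof -
  have "(norm p)\<^sup>2 < 1" using p by (simp add: abs_square_less_1)
  then show "0 < w" "w\<^sup>2 = 1 - p \<bullet> p" by (simp_all add: w power2_norm_eq_inner)
qed

definition Dm :: "real^'n^'n" where "Dm = (\<chi> i a. d i $ a)"
definition Em :: "real^'n^'n" where "Em = (\<chi> a j. e j $ a)"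

lemma dual: "d i \<bullet> e j = (if i = j then 1 else 0)"
proof -
  have "d i \<bullet> e j = e i \<bullet> e j - (e i \<bullet> p) * (e j \<bullet> p)"
    by (simp add: d b inner_diff_left inner_commute[of p])
  then show ?thesis using e by simp
qed

lemma DE: "Dm ** Em = mat 1"
  using dual by (auto simp: Dm_def Em_def matrix_matrix_mult_def mat_def vec_eq_iff inner_vec_def)

lemma conjugate_entry: "(Dm ** M ** Em) $ i $ j = d i \<bullet> (M *v e j)"
proof -
  have "(Dm ** M ** Em) $ i $ j = (Dm ** (M ** Em)) $ i $ j" by (simp add: matrix_mul_assoc)
  then show ?thesis
    by (simp add: Dm_def Em_def matrix_matrix_mult_def matrix_vector_mult_def inner_vec_def)
qed

lemma expand: "z = (\<Sum>m\<in>UNIV. (e m \<bullet> z) *\<^sub>R d m)"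
proof -
  have "Em ** Dm = mat 1" using DE matrix_left_right_inverse by blast
  then have ED: "(\<Sum>m\<in>UNIV. e m $ a * d m $ c) = (if a = c then 1 else 0)" for a c
    by (simp add: Dm_def Em_def matrix_matrix_mult_def mat_def vec_eq_iff)
  have "(\<Sum>m\<in>UNIV. (e m \<bullet> z) *\<^sub>R d m) $ c = z $ c" for c
  proof -
    have "(\<Sum>m\<in>UNIV. (e m \<bullet> z) *\<^sub>R d m) $ c = (\<Sum>m\<in>UNIV. \<Sum>a\<in>UNIV. z $ a * (e m $ a * d m $ c))"
      by (simp add: inner_vec_def sum_distrib_left sum_distrib_right mult_ac)
    also have "\<dots> = (\<Sum>a\<in>UNIV. z $ a * (\<Sum>m\<in>UNIV. e m $ a * d m $ c))"
      by (subst sum.swap) (simp add: sum_distrib_left)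
    also have "\<dots> = z $ c" unfolding ED by (simp add: if_distrib[of "\<lambda>x. _ * x"] cong: if_cong)
    finally show ?thesis .
  qed
  then show ?thesis by (simp add: vec_eq_iff)
qed

lemma inner_expand: "y \<bullet> z = (\<Sum>m\<in>UNIV. (y \<bullet> d m) * (e m \<bullet> z))"
  by (subst (1) expand[of z]) (simp add: inner_sum_right mult.commute)

lemma d_inner_p: "d i \<bullet> p = w\<^sup>2 * b i"
  by (simp add: d b w_sq inner_diff_left algebra_simps)

lemma d_inner_d: "d i \<bullet> d m = (if i = m then 1 else 0) - w\<^sup>2 * b i * b m"
proof -
  have "d i \<bullet> d m = d i \<bullet> e m - b m * (d i \<bullet> p)" by (subst (2) d) (simp add: inner_diff_right)
  then show ?thesis by (simp add: dual d_inner_p)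
qed

lemma p_inner: "p \<bullet> y = w\<^sup>2 * (\<Sum>m\<in>UNIV. b m * (e m \<bullet> y))"
  unfolding inner_expand[of p y] by (simp add: d_inner_p inner_commute[of p] sum_distrib_left mult_ac)

lemma d_inner: "d i \<bullet> y = e i \<bullet> y - w\<^sup>2 * b i * (\<Sum>m\<in>UNIV. b m * (e m \<bullet> y))"
  using p_inner[of y] by (simp add: d inner_diff_left)

text \<open>The \<open>b i\<close> are the components of du in an orthonormal frame, and the squared
  length of du in the induced metric is |p|^2 / (1 - |p|^2).\<close>

lemma sum_b_sq: "(\<Sum>i\<in>UNIV. (b i)\<^sup>2) = v\<^sup>2 - 1"
proof -
  have "p \<bullet> p = w\<^sup>2 * (\<Sum>i\<in>UNIV. (b i)\<^sup>2)"
    using p_inner[of p] by (simp add: b power2_eq_square)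
  then have "w\<^sup>2 * (1 + (\<Sum>i\<in>UNIV. (b i)\<^sup>2)) = w\<^sup>2 + p \<bullet> p" by (simp only: distrib_left mult_1_right)
  also have "\<dots> = 1" using w_sq by simp
  finally show ?thesis using w_pos by (simp add: v power_divide field_simps)
qed

lemma norm_d_le: "norm (d i) \<le> 1"
proof -
  have "(norm (d i))\<^sup>2 \<le> 1\<^sup>2"
    using d_inner_d[of i i] w_pos by (simp add: power2_norm_eq_inner mult.assoc)
  then show ?thesis by (rule power2_le_imp_le) simp
qed

lemma norm_e_sq: "(norm (e i))\<^sup>2 = 1 + (b i)\<^sup>2"
proof -
  have "e i \<bullet> e i = 1 + b i * b i" using e[of i i] by (simp add: b)
  then show ?thesis by (simp only: power2_norm_eq_inner power2_eq_square[of "b i"])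
qed

lemma b_sq_le: "(b i)\<^sup>2 \<le> v\<^sup>2 - 1"
  unfolding sum_b_sq[symmetric] by (rule member_le_sum) auto

lemma norm_e_le: "norm (e i) \<le> v"
proof -
  have "(norm (e i))\<^sup>2 \<le> v\<^sup>2" using norm_e_sq[of i] b_sq_le[of i] by simp
  then show ?thesis by (rule power2_le_imp_le) (use w_pos v in simp)
qed

lemma v_ge_1: "1 \<le> v"
proof -
  have "0 \<le> v\<^sup>2 - 1" unfolding sum_b_sq[symmetric] by (simp add: sum_nonneg)
  then have "1\<^sup>2 \<le> v\<^sup>2" by simp
  then show ?thesis by (rule power2_le_imp_le) (use w_pos v in simp)
qed

text \<open>The entries, in this frame, of the shape operator of another graph with gradient \<open>p'\<close>.\<close>

lemma shape_entry:
  fixes p' :: "real^'n" and r :: "real^'n^'n"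
  defines "\<pi> \<equiv> \<lambda>i. e i \<bullet> p' - w\<^sup>2 * b i * (\<Sum>j\<in>UNIV. b j * (e j \<bullet> p'))"
  defines "W \<equiv> 1 - (\<Sum>i\<in>UNIV. (e i \<bullet> p') * \<pi> i)"
  assumes p': "norm p' < 1"
  defines "w' \<equiv> sqrt (1 - (norm p')\<^sup>2)"
  shows "(Dm ** ((1 / w') *\<^sub>R ((mat 1 + (1 / w'\<^sup>2) *\<^sub>R outer p' p') ** r)) ** Em) $ i $ j
    = 1 / sqrt W * (\<Sum>m\<in>UNIV. ((if i = m then 1 else 0) - w\<^sup>2 * b i * b m + \<pi> i * \<pi> m * (1 / W))
        * (e m \<bullet> (r *v e j)))"
proof -
  have \<pi>: "\<pi> i = d i \<bullet> p'" for i unfolding \<pi>_def d_inner ..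
  have "p' \<bullet> p' = (\<Sum>i\<in>UNIV. (e i \<bullet> p') * \<pi> i)"
    unfolding inner_expand[of p' p'] \<pi> by (simp add: inner_commute mult.commute)
  then have W: "W = 1 - (norm p')\<^sup>2" by (simp add: W_def power2_norm_eq_inner)
  have "(norm p')\<^sup>2 < 1" using p' by (simp add: abs_square_less_1)
  then have w': "w' = sqrt W" "w'\<^sup>2 = W" by (simp_all add: w'_def W)
  have out: "outer p' p' *v z = (p' \<bullet> z) *\<^sub>R p'" for z
    by (simp add: outer_def matrix_vector_mult_def vec_eq_iff inner_vec_def sum_distrib_left mult_ac)
  have mv: "((1 / w') *\<^sub>R ((mat 1 + (1 / w'\<^sup>2) *\<^sub>R outer p' p') ** r)) *v y
    = (1 / w') *\<^sub>R (r *v y + ((p' \<bullet> (r *v y)) / W) *\<^sub>R p')" for y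
    by (simp add: scaleR_matrix_vector_assoc[symmetric] matrix_vector_mul_assoc[symmetric]
        matrix_vector_mult_add_rdistrib out w'(2))
  have 1: "d i \<bullet> (r *v e j) = (\<Sum>m\<in>UNIV. ((if i = m then 1 else 0) - w\<^sup>2 * b i * b m) * (e m \<bullet> (r *v e j)))"
    unfolding inner_expand[of "d i" "r *v e j"] d_inner_d ..
  have 2: "p' \<bullet> (r *v e j) = (\<Sum>m\<in>UNIV. \<pi> m * (e m \<bullet> (r *v e j)))"
    unfolding inner_expand[of p' "r *v e j"] \<pi> by (simp only: inner_commute[of p'])
  show ?thesis
  proof -
    have "(Dm ** ((1 / w') *\<^sub>R ((mat 1 + (1 / w'\<^sup>2) *\<^sub>R outer p' p') ** r)) ** Em) $ i $ j
      = 1 / w' * (d i \<bullet> (r *v e j) + (p' \<bullet> (r *v e j)) / W * \<pi> i)"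
      unfolding conjugate_entry mv by (simp add: inner_add_right \<pi>)
    also have "\<dots> = 1 / sqrt W * ((\<Sum>m\<in>UNIV. ((if i = m then 1 else 0) - w\<^sup>2 * b i * b m) * (e m \<bullet> (r *v e j)))
        + (\<Sum>m\<in>UNIV. \<pi> m * (e m \<bullet> (r *v e j))) / W * \<pi> i)"
      unfolding 1 2 w'(1) ..
    also have "(\<Sum>m\<in>UNIV. \<pi> m * (e m \<bullet> (r *v e j))) / W * \<pi> i
        = (\<Sum>m\<in>UNIV. \<pi> i * \<pi> m * (1 / W) * (e m \<bullet> (r *v e j)))"
      by (simp add: sum_distrib_left sum_divide_distrib mult_ac)
    finally show ?thesis by (simp only: sum.distrib distrib_right)
  qed
qed

end


text \<open>A trace instead of a sum of eigenvalues: it is an explicit expression in Du and D^2 u,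
  whereas the eigenvalue vector comes from a choice at each point and cannot be differentiated
  directly.\<close>

definition mean_curv :: "(real^'n) set \<Rightarrow> (real^'n \<Rightarrow> real) \<Rightarrow> real^'n \<Rightarrow> real" where
  "mean_curv \<Omega> u x = trace (curv_matrix \<Omega> u x)"

text \<open>This is \<sigma>_2 in terms of traces; by the Gauss equation the intrinsic scalar
  curvature is -2 times it.\<close>

definition scal_curv :: "(real^'n) set \<Rightarrow> (real^'n \<Rightarrow> real) \<Rightarrow> real^'n \<Rightarrow> real" where
  "scal_curv \<Omega> u x =
     ((trace (curv_matrix \<Omega> u x))\<^sup>2 - trace (curv_matrix \<Omega> u x ** curv_matrix \<Omega> u x)) / 2"

text \<open>Products \<open>S1 i j * S1 j i\<close> appear rather than squares, because the matrix
  is symmetric only at t = 0.\<close>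

lemma jet2_sigma_2:
  fixes S :: "'n::finite \<Rightarrow> 'n \<Rightarrow> real \<Rightarrow> real"
  assumes S: "\<And>i j. jet2 (S i j) (if i = j then \<kappa> i else 0) (S1 i j) (S2 i j)"
  shows "jet2 (\<lambda>t. ((\<Sum>i\<in>UNIV. S i i t)\<^sup>2 - (\<Sum>i\<in>UNIV. \<Sum>j\<in>UNIV. S i j t * S j i t)) / 2)
    (((\<Sum>i\<in>UNIV. \<kappa> i)\<^sup>2 - (\<Sum>i\<in>UNIV. (\<kappa> i)\<^sup>2)) / 2)
    (\<Sum>i\<in>UNIV. ((\<Sum>j\<in>UNIV. \<kappa> j) - \<kappa> i) * S1 i i)
    ((\<Sum>i\<in>UNIV. ((\<Sum>j\<in>UNIV. \<kappa> j) - \<kappa> i) * S2 i i) + (\<Sum>i\<in>UNIV. S1 i i)\<^sup>2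
      - (\<Sum>i\<in>UNIV. \<Sum>j\<in>UNIV. S1 i j * S1 j i))"
proof -
  have T: "jet2 (\<lambda>t. \<Sum>i\<in>UNIV. S i i t) (\<Sum>i\<in>UNIV. \<kappa> i) (\<Sum>i\<in>UNIV. S1 i i) (\<Sum>i\<in>UNIV. S2 i i)"
    using jet2_sum[of UNIV "\<lambda>i t. S i i t", OF finite S] by simp
  have P: "jet2 (\<lambda>t. \<Sum>i\<in>UNIV. \<Sum>j\<in>UNIV. S i j t * S j i t) (\<Sum>i\<in>UNIV. (\<kappa> i)\<^sup>2)
     (2 * (\<Sum>i\<in>UNIV. \<kappa> i * S1 i i))
     (2 * (\<Sum>i\<in>UNIV. \<kappa> i * S2 i i) + 2 * (\<Sum>i\<in>UNIV. \<Sum>j\<in>UNIV. S1 i j * S1 j i))"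
    using jet2_sum[of UNIV "\<lambda>i t. \<Sum>j\<in>UNIV. S i j t * S j i t", OF finite
        jet2_sum[of UNIV "\<lambda>j t. S _ j t * S j _ t", OF finite jet2_mult[OF S S]]]
  proof (rule jet2_eqI)
    have *: "(if i = j then \<kappa> i else 0) * (if j = i then \<kappa> j else 0) = (if i = j then (\<kappa> i)\<^sup>2 else 0)" for i j
      by (simp add: power2_eq_square)
    show "(\<Sum>i\<in>UNIV. \<Sum>j\<in>UNIV. (if i = j then \<kappa> i else 0) * (if j = i then \<kappa> j else 0)) = (\<Sum>i\<in>UNIV. (\<kappa> i)\<^sup>2)"
      unfolding * by simp
    have 1: "S1 i j * (if j = i then \<kappa> j else 0) + (if i = j then \<kappa> i else 0) * S1 j i
        = (if i = j then 2 * (\<kappa> i * S1 i i) else 0)" for i j by simp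
    show "(\<Sum>i\<in>UNIV. \<Sum>j\<in>UNIV. S1 i j * (if j = i then \<kappa> j else 0) + (if i = j then \<kappa> i else 0) * S1 j i)
        = 2 * (\<Sum>i\<in>UNIV. \<kappa> i * S1 i i)"
      unfolding 1 by (simp add: sum_distrib_left)
    have 2: "S2 i j * (if j = i then \<kappa> j else 0) + 2 * S1 i j * S1 j i + (if i = j then \<kappa> i else 0) * S2 j i
        = (if i = j then 2 * (\<kappa> i * S2 i i) else 0) + 2 * (S1 i j * S1 j i)" for i j by simp
    show "(\<Sum>i\<in>UNIV. \<Sum>j\<in>UNIV. S2 i j * (if j = i then \<kappa> j else 0) + 2 * S1 i j * S1 j i + (if i = j then \<kappa> i else 0) * S2 j i)
        = 2 * (\<Sum>i\<in>UNIV. \<kappa> i * S2 i i) + 2 * (\<Sum>i\<in>UNIV. \<Sum>j\<in>UNIV. S1 i j * S1 j i)"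
      unfolding 2 by (simp add: sum.distrib sum_distrib_left)
  qed
  have eq: "(\<lambda>t. ((\<Sum>i\<in>UNIV. S i i t)\<^sup>2 - (\<Sum>i\<in>UNIV. \<Sum>j\<in>UNIV. S i j t * S j i t)) / 2)
    = (\<lambda>t. 1 / 2 * ((\<Sum>i\<in>UNIV. S i i t) * (\<Sum>i\<in>UNIV. S i i t) - (\<Sum>i\<in>UNIV. \<Sum>j\<in>UNIV. S i j t * S j i t)))"
    by (simp add: power2_eq_square)
  have r: "(\<Sum>i\<in>UNIV. ((\<Sum>j\<in>UNIV. \<kappa> j) - \<kappa> i) * g i)
      = (\<Sum>j\<in>UNIV. \<kappa> j) * (\<Sum>i\<in>UNIV. g i) - (\<Sum>i\<in>UNIV. \<kappa> i * g i)" for g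
    by (simp add: left_diff_distrib sum_subtractf sum_distrib_left)
  show ?thesis unfolding eq r
    using jet2_cmult[OF jet2_diff[OF jet2_mult[OF T T] P], of "1/2"]
  proof (rule jet2_eqI, goal_cases)
    case 1
    then show ?case by (simp add: power2_eq_square[of "sum \<kappa> UNIV"])
  next
    case 2
    show ?case by algebra
  next
    case 3
    show ?case by algebra
  qed
qed

text \<open>Everything the maximum principle needs about one point, in a single frame: jets of H and
  \<sigma>_2 along each frame vector, symmetries of the higher derivatives, and the link of
  \<open>\<kappa>\<close> to the chosen eigenvalues.\<close>

lemma curvature_jets:
  fixes \<Omega> :: "(real^'n) set" and u :: "real^'n \<Rightarrow> real"
  assumes \<Omega>: "open \<Omega>" "x0 \<in> \<Omega>" and u: "Ck_on 4 \<Omega> u"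
    and sp: "\<And>x. x \<in> \<Omega> \<Longrightarrow> norm (grad \<Omega> u x) < 1"
  obtains e d :: "'n \<Rightarrow> real^'n" and \<kappa> b \<mu> :: "'n \<Rightarrow> real" and w v :: real
    and T Q :: "'n \<Rightarrow> 'n \<Rightarrow> 'n \<Rightarrow> real"
  where "metric_frame (grad \<Omega> u x0) e w v b d"
    and "\<mu> = (\<lambda>i. w * \<kappa> i)"
    and "\<And>i j. partials [e i, e j] u x0 = (if i = j then \<mu> i else 0)"
    and "T = (\<lambda>i j k. partials [e i, e j, e k] u x0)"
    and "\<And>i j k. T i j k = T j i k" and "\<And>i j k. T i j k = T i k j"
    and "\<And>i k. Q i i k = Q k k i"
    and "\<And>k. jet2 (\<lambda>t. mean_curv \<Omega> u (x0 + t *\<^sub>R e k)) (\<Sum>i\<in>UNIV. \<kappa> i)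
          (\<Sum>i\<in>UNIV. cov_h v b \<mu> T i i k) (\<Sum>i\<in>UNIV. shape_d2 v b \<mu> T Q k i i)"
    and "\<And>k. jet2 (\<lambda>t. scal_curv \<Omega> u (x0 + t *\<^sub>R e k)) (((\<Sum>i\<in>UNIV. \<kappa> i)\<^sup>2 - (\<Sum>i\<in>UNIV. (\<kappa> i)\<^sup>2)) / 2)
          (\<Sum>i\<in>UNIV. ((\<Sum>j\<in>UNIV. \<kappa> j) - \<kappa> i) * cov_h v b \<mu> T i i k)
          ((\<Sum>i\<in>UNIV. ((\<Sum>j\<in>UNIV. \<kappa> j) - \<kappa> i) * shape_d2 v b \<mu> T Q k i i)
            + (\<Sum>i\<in>UNIV. cov_h v b \<mu> T i i k)\<^sup>2
            - (\<Sum>i\<in>UNIV. \<Sum>j\<in>UNIV. shape_d1 v b \<mu> T k i j * shape_d1 v b \<mu> T k j i))"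
    and "sigma_k 1 \<Omega> u x0 = (\<Sum>i\<in>UNIV. \<kappa> i)"
    and "2 * sigma_k 2 \<Omega> u x0 = (\<Sum>i\<in>UNIV. \<kappa> i)\<^sup>2 - (\<Sum>i\<in>UNIV. (\<kappa> i)\<^sup>2)"
    and "range (($) (principal_curvatures \<Omega> u x0)) = range \<kappa>"
proof -
  let ?p = "grad \<Omega> u x0"
  define w where "w = sqrt (1 - (norm ?p)\<^sup>2)"
  have u2: "Ck_on 2 \<Omega> u" using Ck_on_mono[OF u] by simp
  obtain e :: "'n \<Rightarrow> real^'n" and \<kappa> :: "'n \<Rightarrow> real" where e: "\<And>i j. e i \<bullet> e j - (e i \<bullet> ?p) * (e j \<bullet> ?p) = (if i = j then 1 else 0)"
    and r: "\<And>i j. e i \<bullet> (hess \<Omega> u x0 *v e j) = (if i = j then w * \<kappa> i else 0)"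
    using principal_frame[OF sp[OF \<Omega>(2)] hess_sym[OF \<Omega> u2], folded w_def] by blast
  define v where "v = 1 / w"
  define b where "b = (\<lambda>i. e i \<bullet> ?p)"
  define d where "d = (\<lambda>i. e i - b i *\<^sub>R ?p)"
  define \<mu> where "\<mu> = (\<lambda>i. w * \<kappa> i)"
  define T where "T = (\<lambda>i j k. partials [e i, e j, e k] u x0)"
  define Q where "Q = (\<lambda>i j k. partials [e k, e k, e i, e j] u x0)"
  interpret metric_frame ?p e w v b d
    by unfold_locales (use sp[OF \<Omega>(2)] e in \<open>simp_all add: w_def v_def b_def d_def\<close>)
  have T1: "T i j k = T j i k" and T2: "T i j k = T i k j" for i j k
    unfolding T_def
    using partials_swap[OF \<Omega>(1) _ \<Omega>(2), of "[e k]" u "[]" "e i" "e j"]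
      partials_swap[OF \<Omega>(1) _ \<Omega>(2), of "[]" u "[e i]" "e j" "e k"] Ck_on_mono[OF u]
    by simp_all
  have Qs: "Q i i k = Q k k i" for i k
  proof -
    have s: "partials (as @ a # c # bs) u x0 = partials (as @ c # a # bs) u x0" if "length bs \<le> 2" for as bs a c
      by (rule partials_swap[OF \<Omega>(1) _ \<Omega>(2)]) (use that Ck_on_mono[OF u] in simp)
    have "partials [e k, e k, e i, e i] u x0 = partials [e k, e i, e k, e i] u x0"
      using s[of "[e i]" "[e k]" "e k" "e i"] by simp
    also have "\<dots> = partials [e i, e k, e k, e i] u x0"
      using s[of "[e k, e i]" "[]" "e k" "e i"] by simp
    also have "\<dots> = partials [e i, e k, e i, e k] u x0"
      using s[of "[]" "[e i, e k]" "e k" "e i"] by simp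
    also have "\<dots> = partials [e i, e i, e k, e k] u x0"
      using s[of "[e k]" "[e i]" "e k" "e i"] by simp
    finally show ?thesis by (simp only: Q_def)
  qed
  have mu: "partials [e i, e j] u x0 = (if i = j then \<mu> i else 0)" for i j
    using r[of i j] hess_inner[OF \<Omega> u2, of "e i" "e j"] by (simp add: \<mu>_def)
  have b': "b i = partials [e i] u x0" for i
    unfolding b_def using grad_inner[OF \<Omega>(2) Ck_on_differentiable[of 1]] u2 \<Omega>(2) by (simp add: numeral_2_eq_2)
  have vmu: "v * \<mu> i = \<kappa> i" for i using w_pos by (simp add: v_def \<mu>_def)
  define U where "U = (\<lambda>k i t. partials [e i] u (x0 + t *\<^sub>R e k))"
  define R where "R = (\<lambda>k i j t. partials [e i, e j] u (x0 + t *\<^sub>R e k))"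
  have Uj: "jet2 (U k i) (b i) (if i = k then \<mu> k else 0) (T i k k)" for k i
  proof -
    have "Ck_on 2 \<Omega> (partials [e i] u)"
      by (rule Ck_on_partials[OF \<Omega>(1)]) (use Ck_on_mono[OF u] in simp)
    from jet2_line[OF \<Omega> this, of "e k"] show ?thesis
      unfolding U_def partials_append[symmetric]
      by (rule jet2_eqI) (use b' mu T1 T2 in \<open>auto simp: T_def simp del: partials.simps\<close>)
  qed
  have Rj: "jet2 (R k i j) (if i = j then \<mu> i else 0) (T i j k) (Q i j k)" for k i j
  proof -
    have "Ck_on 2 \<Omega> (partials [e i, e j] u)"
      by (rule Ck_on_partials[OF \<Omega>(1)]) (use u in simp)
    from jet2_line[OF \<Omega> this, of "e k"] show ?thesis
      unfolding R_def partials_append[symmetric]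
    proof (rule jet2_eqI)
      have "T k i j = T i j k" using T1 T2 by metis
      then show "partials ([e k] @ [e i, e j]) u x0 = T i j k" by (simp add: T_def del: partials.simps)
    qed (use mu in \<open>simp_all add: Q_def del: partials.simps\<close>)
  qed
  \<comment> \<open>The frame matrices stay frozen at \<open>x0\<close> along the whole line. Traces
    do not see the conjugation, and only first derivatives of the frame pairings with u are needed
    for the metric.\<close>
  define S where "S = (\<lambda>k i j t. (Dm ** curv_matrix \<Omega> u (x0 + t *\<^sub>R e k) ** Em) $ i $ j)"
  have Sj: "jet2 (S k i j) (if i = j then \<kappa> i else 0) (shape_d1 v b \<mu> T k i j) (shape_d2 v b \<mu> T Q k i j)" for k i j
  proof -
    have "jet2 (S k i j) (if i = j then v * \<mu> i else 0) (shape_d1 v b \<mu> T k i j) (shape_d2 v b \<mu> T Q k i j)"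
      using shape_jet2[where w = w and v = v and b = b and \<mu> = \<mu> and T = T and Q = Q and k = k
          and U = "U k" and R = "R k" and i = i and j = j, OF w_pos v sum_b_sq Uj Rj]
    proof (rule jet2_cong)
      show "\<forall>\<^sub>F t in nhds 0. 1 / sqrt (1 - (\<Sum>i\<in>UNIV. U k i t * (U k i t - w\<^sup>2 * b i * (\<Sum>j\<in>UNIV. b j * U k j t)))) *
         (\<Sum>m\<in>UNIV. ((if i = m then 1 else 0) - w\<^sup>2 * b i * b m
            + (U k i t - w\<^sup>2 * b i * (\<Sum>j\<in>UNIV. b j * U k j t)) * (U k m t - w\<^sup>2 * b m * (\<Sum>j\<in>UNIV. b j * U k j t)) *
             (1 / (1 - (\<Sum>i\<in>UNIV. U k i t * (U k i t - w\<^sup>2 * b i * (\<Sum>j\<in>UNIV. b j * U k j t)))))) * R k m j t) = S k i j t"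
      proof (rule eventually_mono[OF eventually_line_in_open[OF \<Omega>, of "e k"]])
        fix t assume t: "x0 + t *\<^sub>R e k \<in> \<Omega>"
        let ?x = "x0 + t *\<^sub>R e k"
        have U: "U k i t = e i \<bullet> grad \<Omega> u ?x" for i
          unfolding U_def using grad_inner[OF t Ck_on_differentiable[of 1]] u2 t by (simp add: numeral_2_eq_2)
        have R: "R k i j t = e i \<bullet> (hess \<Omega> u ?x *v e j)" for i j
          unfolding R_def using hess_inner[OF \<Omega>(1) t u2] by simp
        show "1 / sqrt (1 - (\<Sum>i\<in>UNIV. U k i t * (U k i t - w\<^sup>2 * b i * (\<Sum>j\<in>UNIV. b j * U k j t)))) *
         (\<Sum>m\<in>UNIV. ((if i = m then 1 else 0) - w\<^sup>2 * b i * b m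
            + (U k i t - w\<^sup>2 * b i * (\<Sum>j\<in>UNIV. b j * U k j t)) * (U k m t - w\<^sup>2 * b m * (\<Sum>j\<in>UNIV. b j * U k j t)) *
             (1 / (1 - (\<Sum>i\<in>UNIV. U k i t * (U k i t - w\<^sup>2 * b i * (\<Sum>j\<in>UNIV. b j * U k j t)))))) * R k m j t) = S k i j t"
          unfolding S_def curv_matrix_def Let_def U R shape_entry[OF sp[OF t]] ..
      qed
    qed
    then show ?thesis unfolding vmu .
  qed
  have ED: "Em ** Dm = mat 1" using DE matrix_left_right_inverse by blast
  have tr: "trace (Dm ** N ** Em) = trace N" for N :: "real^'n^'n"
    by (metis ED matrix_mul_assoc matrix_mul_rid trace_mul_sym)
  have H: "mean_curv \<Omega> u (x0 + t *\<^sub>R e k) = (\<Sum>i\<in>UNIV. S k i i t)" for k t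
  proof -
    have "mean_curv \<Omega> u (x0 + t *\<^sub>R e k) = trace (Dm ** curv_matrix \<Omega> u (x0 + t *\<^sub>R e k) ** Em)"
      unfolding mean_curv_def tr ..
    then show ?thesis by (simp add: trace_def S_def)
  qed
  have sc: "scal_curv \<Omega> u (x0 + t *\<^sub>R e k)
      = ((\<Sum>i\<in>UNIV. S k i i t)\<^sup>2 - (\<Sum>i\<in>UNIV. \<Sum>j\<in>UNIV. S k i j t * S k j i t)) / 2" for k t
  proof -
    let ?M = "curv_matrix \<Omega> u (x0 + t *\<^sub>R e k)"
    have "(Dm ** ?M ** Em) ** (Dm ** ?M ** Em) = Dm ** ?M ** (Em ** Dm) ** ?M ** Em"
      by (simp only: matrix_mul_assoc)
    also have "\<dots> = Dm ** (?M ** ?M) ** Em" unfolding ED by (simp only: matrix_mul_rid matrix_mul_assoc)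
    finally have "Dm ** (?M ** ?M) ** Em = (Dm ** ?M ** Em) ** (Dm ** ?M ** Em)" by (rule sym)
    then have "trace (?M ** ?M) = (\<Sum>i\<in>UNIV. \<Sum>j\<in>UNIV. S k i j t * S k j i t)"
      using tr[of "?M ** ?M"] by (simp add: S_def trace_def matrix_matrix_mult_def[of "Dm ** ?M ** Em"])
    then show ?thesis using H[of t k] by (simp add: scal_curv_def mean_curv_def)
  qed
  have d1: "shape_d1 v b \<mu> T k i i = cov_h v b \<mu> T i i k" for k i
    by (auto simp: shape_d1_def cov_h_def power2_eq_square)
  \<comment> \<open>The value of the jets at t = 0 is the same for all lines, so any index
    \<open>k\<close> serves.\<close>
  have diag: "Dm ** curv_matrix \<Omega> u x0 ** Em = (\<chi> i j. if i = j then \<kappa> i else 0)"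
    using Sj[of undefined] by (simp add: vec_eq_iff jet2_def S_def)
  note ev = eigenvalue_vec_of_diagonalization[OF DE diag]
  show ?thesis
  proof (rule that[of e w v b d \<mu> \<kappa> T Q])
    show "metric_frame ?p e w v b d" by (rule metric_frame_axioms)
    show "jet2 (\<lambda>t. mean_curv \<Omega> u (x0 + t *\<^sub>R e k)) (\<Sum>i\<in>UNIV. \<kappa> i)
          (\<Sum>i\<in>UNIV. cov_h v b \<mu> T i i k) (\<Sum>i\<in>UNIV. shape_d2 v b \<mu> T Q k i i)" for k
      unfolding H d1[symmetric]
      using jet2_sum[of UNIV "\<lambda>i t. S k i i t", OF finite Sj] by simp
    show "jet2 (\<lambda>t. scal_curv \<Omega> u (x0 + t *\<^sub>R e k)) (((\<Sum>i\<in>UNIV. \<kappa> i)\<^sup>2 - (\<Sum>i\<in>UNIV. (\<kappa> i)\<^sup>2)) / 2)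
          (\<Sum>i\<in>UNIV. ((\<Sum>j\<in>UNIV. \<kappa> j) - \<kappa> i) * cov_h v b \<mu> T i i k)
          ((\<Sum>i\<in>UNIV. ((\<Sum>j\<in>UNIV. \<kappa> j) - \<kappa> i) * shape_d2 v b \<mu> T Q k i i)
            + (\<Sum>i\<in>UNIV. cov_h v b \<mu> T i i k)\<^sup>2
            - (\<Sum>i\<in>UNIV. \<Sum>j\<in>UNIV. shape_d1 v b \<mu> T k i j * shape_d1 v b \<mu> T k j i))" for k
      unfolding sc d1[symmetric] by (rule jet2_sigma_2[OF Sj])
    show "sigma_k 1 \<Omega> u x0 = (\<Sum>i\<in>UNIV. \<kappa> i)"
      using ev(1) unfolding sigma_k_def principal_curvatures_def .
    show "2 * sigma_k 2 \<Omega> u x0 = (\<Sum>i\<in>UNIV. \<kappa> i)\<^sup>2 - (\<Sum>i\<in>UNIV. (\<kappa> i)\<^sup>2)"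
      using ev(2) unfolding sigma_k_def principal_curvatures_def .
    show "range (($) (principal_curvatures \<Omega> u x0)) = range \<kappa>"
      using ev(3) unfolding principal_curvatures_def .
  qed (use T1 T2 Qs mu \<mu>_def T_def in auto)
qed

section \<open>The right-hand side along lines\<close>


lemma sum_Basis_scaleR_DERIV:
  fixes Y :: "real \<Rightarrow> 'a::euclidean_space"
  assumes "\<And>c. c \<in> Basis \<Longrightarrow> ((\<lambda>t. Y t \<bullet> c) has_real_derivative g c) (at t)"
  shows "(Y has_derivative (\<lambda>s. s *\<^sub>R (\<Sum>c\<in>Basis. g c *\<^sub>R c))) (at t)"
proof -
  have "((\<lambda>t. \<Sum>c\<in>Basis. (Y t \<bullet> c) *\<^sub>R c) has_derivative (\<lambda>s. \<Sum>c\<in>Basis. (g c * s) *\<^sub>R c)) (at t)"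
    using assms unfolding has_field_derivative_def
    by (intro has_derivative_sum has_derivative_scaleR_left) (simp add: mult_commute_abs)
  then show ?thesis by (simp add: euclidean_representation scaleR_sum_right mult.commute)
qed

lemma jet2_chain:
  fixes f :: "'a::euclidean_space \<Rightarrow> real"
  assumes U: "open U" "Y 0 \<in> U" and f: "Ck_on 2 U f"
    and Y: "\<And>c. c \<in> Basis \<Longrightarrow> jet2 (\<lambda>t. Y t \<bullet> c) (Y 0 \<bullet> c) (y1 \<bullet> c) (y2 \<bullet> c)"
  shows "jet2 (\<lambda>t. f (Y t)) (f (Y 0)) (\<Sum>c\<in>Basis. (y1 \<bullet> c) * partials [c] f (Y 0))
    ((\<Sum>c\<in>Basis. \<Sum>c'\<in>Basis. (y1 \<bullet> c) * (y1 \<bullet> c') * partials [c', c] f (Y 0))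
      + (\<Sum>c\<in>Basis. (y2 \<bullet> c) * partials [c] f (Y 0)))"
proof -
  have C1: "Ck_on (Suc 0) U (partials [v] f)" for v
    using Ck_on_partials1[OF U(1), of 1 f v] f by (simp add: numeral_2_eq_2)
  have fd: "f differentiable (at y)" if "y \<in> U" for y
    using Ck_on_differentiable[of 1 U f] f that by (simp add: numeral_2_eq_2)
  have chain: "((\<lambda>t. h (Y t)) has_real_derivative (\<Sum>c\<in>Basis. g c * partials [c] h (Y t))) (at t)"
    if g: "\<And>c. c \<in> Basis \<Longrightarrow> ((\<lambda>t. Y t \<bullet> c) has_real_derivative g c) (at t)"
      and h: "h differentiable (at (Y t))" for g t and h :: "'a \<Rightarrow> real"
  proof -
    let ?D = "frechet_derivative h (at (Y t))"
    have lin: "linear ?D" using h by (rule linear_frechet_derivative)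
    have "((\<lambda>t. h (Y t)) has_derivative (\<lambda>s. ?D (s *\<^sub>R (\<Sum>c\<in>Basis. g c *\<^sub>R c)))) (at t)"
      using diff_chain_at[OF sum_Basis_scaleR_DERIV[of Y, OF g], where g = h and g' = ?D] h frechet_derivative_works
      by (auto simp: o_def)
    moreover have "?D (s *\<^sub>R (\<Sum>c\<in>Basis. g c *\<^sub>R c)) = (\<Sum>c\<in>Basis. g c * partials [c] h (Y t)) * s" for s
      using lin by (simp add: linear_scale linear_sum sum_distrib_right mult_ac)
    ultimately show ?thesis by (simp add: has_field_derivative_def)
  qed
  have "\<forall>c. \<exists>g. c \<in> Basis \<longrightarrow> (\<forall>\<^sub>F t in nhds 0. ((\<lambda>t. Y t \<bullet> c) has_real_derivative g t) (at t))
      \<and> g 0 = y1 \<bullet> c \<and> (g has_real_derivative (y2 \<bullet> c)) (at 0)"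
    using Y unfolding jet2_def by blast
  from choice[OF this] obtain g where
    gg: "\<forall>c. c \<in> Basis \<longrightarrow> (\<forall>\<^sub>F t in nhds 0. ((\<lambda>t. Y t \<bullet> c) has_real_derivative g c t) (at t))
      \<and> g c 0 = y1 \<bullet> c \<and> (g c has_real_derivative (y2 \<bullet> c)) (at 0)" ..
  have g: "\<And>c. c \<in> Basis \<Longrightarrow> \<forall>\<^sub>F t in nhds 0. ((\<lambda>t. Y t \<bullet> c) has_real_derivative g c t) (at t)"
    "\<And>c. c \<in> Basis \<Longrightarrow> g c 0 = y1 \<bullet> c" "\<And>c. c \<in> Basis \<Longrightarrow> (g c has_real_derivative (y2 \<bullet> c)) (at 0)"
    using gg by simp_all
  have ev: "\<forall>\<^sub>F t in nhds 0. \<forall>c\<in>Basis. ((\<lambda>t. Y t \<bullet> c) has_real_derivative g c t) (at t)"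
    using g(1) by (simp add: eventually_ball_finite_distrib)
  then have g0: "\<And>c. c \<in> Basis \<Longrightarrow> ((\<lambda>t. Y t \<bullet> c) has_real_derivative g c 0) (at 0)"
    using eventually_nhds_x_imp_x by blast
  have "isCont Y 0" using sum_Basis_scaleR_DERIV[OF g0] has_derivative_continuous by blast
  then have "(Y \<longlongrightarrow> Y 0) (nhds 0)" by (simp add: isCont_def tendsto_nhds_iff)
  then have inU: "\<forall>\<^sub>F t in nhds 0. Y t \<in> U" using U by (rule topological_tendstoD)
  define F where "F = (\<lambda>t. \<Sum>c\<in>Basis. g c t * partials [c] f (Y t))"
  have "\<forall>\<^sub>F t in nhds 0. ((\<lambda>t. f (Y t)) has_real_derivative F t) (at t)"
    using ev inU by eventually_elim (auto simp only: F_def intro!: chain fd)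
  moreover have "F 0 = (\<Sum>c\<in>Basis. (y1 \<bullet> c) * partials [c] f (Y 0))" using g(2) by (simp add: F_def)
  moreover have "(F has_real_derivative ((\<Sum>c\<in>Basis. \<Sum>c'\<in>Basis. (y1 \<bullet> c) * (y1 \<bullet> c') * partials [c', c] f (Y 0))
      + (\<Sum>c\<in>Basis. (y2 \<bullet> c) * partials [c] f (Y 0)))) (at 0)"
  proof -
    have p: "((\<lambda>t. partials [c] f (Y t)) has_real_derivative
        (\<Sum>c'\<in>Basis. (y1 \<bullet> c') * partials [c', c] f (Y 0))) (at 0)" for c
      using chain[OF g0, of "partials [c] f"] Ck_on_differentiable[OF C1 U(2)] g(2) by simp
    have "(F has_real_derivative (\<Sum>c\<in>Basis. (y2 \<bullet> c) * partials [c] f (Y 0)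
        + (\<Sum>c'\<in>Basis. (y1 \<bullet> c') * partials [c', c] f (Y 0)) * g c 0)) (at 0)"
      unfolding F_def by (intro DERIV_sum DERIV_mult g(3) p)
    then show ?thesis
      using g(2) by (simp add: sum.distrib sum_distrib_left sum_distrib_right mult_ac add.commute)
  qed
  ultimately show ?thesis unfolding jet2_def by blast
qed

lemma abs_sum_Basis_le:
  fixes y :: "'a::euclidean_space"
  assumes "\<And>c. c \<in> Basis \<Longrightarrow> \<bar>a c\<bar> \<le> K"
  shows "\<bar>\<Sum>c\<in>Basis. (y \<bullet> c) * a c\<bar> \<le> K * (real DIM('a) * norm y)"
proof -
  have "\<bar>\<Sum>c\<in>Basis. (y \<bullet> c) * a c\<bar> \<le> (\<Sum>c\<in>(Basis :: 'a set). norm y * K)"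
    using assms Basis_le_norm
    by (intro order.trans[OF sum_abs] sum_mono) (auto simp: abs_mult intro!: mult_mono)
  then show ?thesis by (simp add: mult_ac)
qed

text \<open>Third derivatives of u enter the Laplacian of \<psi> only linearly, through the second
  derivative of Du, and summing over \<open>k\<close> turns them into the traces \<Sum> T_kkm. These
  are controlled by \<nabla>H; untraced third derivatives would not be.\<close>

lemma psi_jets:
  fixes \<Omega> :: "(real^'n) set" and u :: "real^'n \<Rightarrow> real" and \<psi> :: "(real^'n) \<times> real \<times> (real^'n) \<Rightarrow> real"
    and e d :: "'n \<Rightarrow> real^'n" and \<mu> b :: "'n \<Rightarrow> real" and x0 :: "real^'n" and w v V H K :: real
  defines "T \<equiv> \<lambda>i j k. partials [e i, e j, e k] u x0"
  defines "n \<equiv> real CARD('n)" and "M \<equiv> real DIM((real^'n) \<times> real \<times> (real^'n))"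
  assumes \<Omega>: "open \<Omega>" "x0 \<in> \<Omega>" and u: "Ck_on 4 \<Omega> u" and \<psi>: "Ck_on 2 (psi_dom \<Omega>) \<psi>"
    and fr: "metric_frame (grad \<Omega> u x0) e w v b d"
    and mu: "\<And>i j. partials [e i, e j] u x0 = (if i = j then \<mu> i else 0)"
    and muH: "\<And>i. \<bar>\<mu> i\<bar> \<le> H" and vV: "v \<le> V" and K: "0 \<le> K"
    and K1: "\<And>c. c \<in> Basis \<Longrightarrow> \<bar>partials [c] \<psi> (x0, u x0, grad \<Omega> u x0)\<bar> \<le> K"
    and K2: "\<And>c c'. c \<in> Basis \<Longrightarrow> c' \<in> Basis \<Longrightarrow> \<bar>partials [c', c] \<psi> (x0, u x0, grad \<Omega> u x0)\<bar> \<le> K"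
  obtains P1 P2 where
    "\<And>k. jet2 (\<lambda>t. \<psi> (x0 + t *\<^sub>R e k, u (x0 + t *\<^sub>R e k), grad \<Omega> u (x0 + t *\<^sub>R e k)))
        (\<psi> (x0, u x0, grad \<Omega> u x0)) (P1 k) (P2 k)"
    "\<And>k. \<bar>P1 k\<bar> \<le> K * (M * (2 * V + H))"
    "(\<Sum>k\<in>UNIV. P2 k) \<ge> - (n * K * (M * (2 * V + H))\<^sup>2)
       - K * (M * (n * H + (\<Sum>m\<in>UNIV. \<bar>\<Sum>k\<in>UNIV. T k k m\<bar>)))"
proof -
  interpret metric_frame "grad \<Omega> u x0" e w v b d by (rule fr)
  let ?y0 = "(x0, u x0, grad \<Omega> u x0)"
  have u2: "Ck_on 2 \<Omega> u" and u3: "Ck_on 3 \<Omega> u" using Ck_on_mono[OF u] by simp_all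
  have ud: "u differentiable (at x)" if "x \<in> \<Omega>" for x
    using Ck_on_differentiable[of 1] u2 that by (simp add: numeral_2_eq_2)
  have b': "b i = partials [e i] u x0" for i
    using grad_inner[OF \<Omega>(2) ud[OF \<Omega>(2)]] by (simp add: b)
  define G1 where "G1 = (\<lambda>k. \<chi> i. partials [e k, axis i 1] u x0)"
  define G2 where "G2 = (\<lambda>k. \<chi> i. partials [e k, e k, axis i 1] u x0)"
  have G1: "G1 k = \<mu> k *\<^sub>R d k" for k
  proof -
    have "Ck_on (Suc 0) \<Omega> (partials [e k] u)"
      by (rule Ck_on_partials[OF \<Omega>(1)]) (use u2 in \<open>simp add: numeral_2_eq_2\<close>)
    from grad_inner[OF \<Omega>(2) Ck_on_differentiable[OF this \<Omega>(2)]]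
    have "a \<bullet> G1 k = partials [a, e k] u x0" for a
      using partials_swap2[OF \<Omega>(1) u2 \<Omega>(2)] \<Omega>(2)
      by (simp add: grad_def G1_def bdry_ext_def partials_append[of "[_]" "[_]", simplified append_Cons append_Nil] del: partials.simps)
    then have "G1 k = (\<Sum>m\<in>UNIV. (if m = k then \<mu> k else 0) *\<^sub>R d m)"
      by (subst expand[of "G1 k"]) (auto simp: mu simp del: partials.simps intro!: sum.cong)
    then show ?thesis by (simp add: if_distrib[of "\<lambda>x. x *\<^sub>R _"] cong: if_cong)
  qed
  have G2: "G2 k = (\<Sum>m\<in>UNIV. T k k m *\<^sub>R d m)" for k
  proof -
    have "Ck_on (Suc 0) \<Omega> (partials [e k, e k] u)"
      by (rule Ck_on_partials[OF \<Omega>(1)]) (use u3 in \<open>simp add: numeral_3_eq_3\<close>)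
    from grad_inner[OF \<Omega>(2) Ck_on_differentiable[OF this \<Omega>(2)]]
    have 1: "a \<bullet> grad \<Omega> (partials [e k, e k] u) x0 = partials [a, e k, e k] u x0" for a by simp
    have sw: "partials [a, e k, e k] u x0 = partials [e k, e k, a] u x0" for a
      using partials_swap[OF \<Omega>(1) _ \<Omega>(2), of "[e k]" u "[]" a "e k"]
        partials_swap[OF \<Omega>(1) _ \<Omega>(2), of "[]" u "[e k]" a "e k"] u2 u3 by simp
    have "G2 k = grad \<Omega> (partials [e k, e k] u) x0"
      using \<Omega>(2) sw by (simp add: grad_def G2_def bdry_ext_def)
    then have "a \<bullet> G2 k = partials [e k, e k, a] u x0" for a using 1 sw by simp
    then show ?thesis by (subst expand[of "G2 k"]) (simp add: T_def del: partials.simps)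
  qed
  \<comment> \<open>Velocity, and next acceleration, of the curve (x, u, Du) along a frame line. Du
    moves with velocity \<mu>_k d_k, which makes the quadratic part of order H^2.\<close>
  define y1 where "y1 = (\<lambda>k. (e k, b k, G1 k))"
  define y2 where "y2 = (\<lambda>k. (0 :: real^'n, \<mu> k, G2 k))"
  have oD: "open (psi_dom \<Omega>)" unfolding psi_dom_def using \<Omega>(1) by (simp add: open_Times)
  have jet: "jet2 (\<lambda>t. \<psi> (x0 + t *\<^sub>R e k, u (x0 + t *\<^sub>R e k), grad \<Omega> u (x0 + t *\<^sub>R e k))) (\<psi> ?y0)
     (\<Sum>c\<in>Basis. (y1 k \<bullet> c) * partials [c] \<psi> ?y0)
     ((\<Sum>c\<in>Basis. \<Sum>c'\<in>Basis. (y1 k \<bullet> c) * (y1 k \<bullet> c') * partials [c', c] \<psi> ?y0)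
      + (\<Sum>c\<in>Basis. (y2 k \<bullet> c) * partials [c] \<psi> ?y0))" for k
  proof -
    define Y where "Y = (\<lambda>t. (x0 + t *\<^sub>R e k, u (x0 + t *\<^sub>R e k), grad \<Omega> u (x0 + t *\<^sub>R e k)))"
    have Y0: "Y 0 = ?y0" by (simp add: Y_def)
    have "jet2 (\<lambda>t. Y t \<bullet> c) (Y 0 \<bullet> c) (y1 k \<bullet> c) (y2 k \<bullet> c)" if c: "c \<in> Basis" for c
    proof -
      obtain c1 c2 c3 where cc: "c = (c1, c2, c3)" by (metis prod_cases3)
      have j1: "jet2 (\<lambda>t. (x0 + t *\<^sub>R e k) \<bullet> c1) (x0 \<bullet> c1) (e k \<bullet> c1) 0"
        using jet2_linear[of "x0 \<bullet> c1" "e k \<bullet> c1"] by (simp add: inner_add_left)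
      have j2: "jet2 (\<lambda>t. u (x0 + t *\<^sub>R e k) * c2) (u x0 * c2) (b k * c2) (\<mu> k * c2)"
        using jet2_cmult[OF jet2_line[OF \<Omega> u2, of "e k"], of c2] mu[of k k] b'[of k] by (simp add: mult.commute)
      have j3: "jet2 (\<lambda>t. grad \<Omega> u (x0 + t *\<^sub>R e k) \<bullet> c3) (grad \<Omega> u x0 \<bullet> c3) (G1 k \<bullet> c3) (G2 k \<bullet> c3)"
      proof -
        have C2: "Ck_on 2 \<Omega> (partials [axis i 1] u)" for i
          by (rule Ck_on_partials[OF \<Omega>(1)]) (use u3 in simp)
        have "jet2 (\<lambda>t. \<Sum>i\<in>UNIV. (c3 $ i) * partials [axis i 1] u (x0 + t *\<^sub>R e k))
           (\<Sum>i\<in>UNIV. (c3 $ i) * partials [axis i 1] u x0) (\<Sum>i\<in>UNIV. (c3 $ i) * partials [e k, axis i 1] u x0)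
           (\<Sum>i\<in>UNIV. (c3 $ i) * partials [e k, e k, axis i 1] u x0)"
          using jet2_sum[of UNIV "\<lambda>i t. (c3 $ i) * partials [axis i 1] u (x0 + t *\<^sub>R e k)", OF finite
              jet2_cmult[OF jet2_line[OF \<Omega> C2, where e = "e k"]]] by simp
        then have "jet2 (\<lambda>t. \<Sum>i\<in>UNIV. (c3 $ i) * partials [axis i 1] u (x0 + t *\<^sub>R e k))
           (grad \<Omega> u x0 \<bullet> c3) (G1 k \<bullet> c3) (G2 k \<bullet> c3)"
          using \<Omega>(2) by (simp add: grad_def bdry_ext_def inner_vec_def G1_def G2_def mult.commute)
        then show ?thesis
        proof (rule jet2_cong)
          show "\<forall>\<^sub>F t in nhds 0. (\<Sum>i\<in>UNIV. (c3 $ i) * partials [axis i 1] u (x0 + t *\<^sub>R e k))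
              = grad \<Omega> u (x0 + t *\<^sub>R e k) \<bullet> c3"
            by (rule eventually_mono[OF eventually_line_in_open[OF \<Omega>, of "e k"]])
               (simp add: grad_def bdry_ext_def inner_vec_def mult.commute)
        qed
      qed
      from jet2_add[OF j1 jet2_add[OF j2 j3]] show ?thesis
        by (simp add: Y_def cc y1_def y2_def inner_Pair)
    qed
    from jet2_chain[OF oD _ \<psi> this] show ?thesis
      unfolding Y0 using \<Omega>(2) by (simp add: Y_def psi_dom_def)
  qed
  have M0: "0 \<le> M" by (simp add: M_def)
  have V1: "1 \<le> V" using v_ge_1 vV by simp
  have H0: "0 \<le> H" using muH abs_ge_zero order_trans by blast
  have y1n: "norm (y1 k) \<le> 2 * V + H" for k
  proof -
    have "norm (y1 k) \<le> norm (e k) + (norm (b k) + norm (G1 k))"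
      unfolding y1_def by (intro order.trans[OF norm_Pair_le] add_mono order.refl)
    moreover have "norm (G1 k) \<le> H * 1"
      unfolding G1 using muH[of k] norm_d_le[of k] H0 by (simp only: norm_scaleR, intro mult_mono) auto
    moreover have "\<bar>b k\<bar> \<le> v"
    proof -
      have "(b k)\<^sup>2 \<le> v\<^sup>2" using b_sq_le[of k] by simp
      then show ?thesis using v_ge_1 by (simp add: abs_le_square_iff[symmetric])
    qed
    ultimately show ?thesis using norm_e_le[of k] vV by simp
  qed
  have P1: "\<bar>\<Sum>c\<in>Basis. (y1 k \<bullet> c) * partials [c] \<psi> ?y0\<bar> \<le> K * (M * (2 * V + H))" for k
  proof -
    have "\<bar>\<Sum>c\<in>Basis. (y1 k \<bullet> c) * partials [c] \<psi> ?y0\<bar> \<le> K * (M * norm (y1 k))"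
      unfolding M_def by (rule abs_sum_Basis_le[OF K1])
    also have "\<dots> \<le> K * (M * (2 * V + H))" using y1n K M0 by (intro mult_left_mono)
    finally show ?thesis by simp
  qed
  have quad: "- (K * (M * (2 * V + H))\<^sup>2)
      \<le> (\<Sum>c\<in>Basis. \<Sum>c'\<in>Basis. (y1 k \<bullet> c) * (y1 k \<bullet> c') * partials [c', c] \<psi> ?y0)" for k
  proof -
    have "\<bar>\<Sum>c\<in>Basis. (y1 k \<bullet> c) * (\<Sum>c'\<in>Basis. (y1 k \<bullet> c') * partials [c', c] \<psi> ?y0)\<bar>
        \<le> K * (M * norm (y1 k)) * (M * norm (y1 k))"
      unfolding M_def by (rule abs_sum_Basis_le[OF abs_sum_Basis_le[OF K2]])
    also have "\<dots> = K * (M * norm (y1 k))\<^sup>2" by (simp add: power2_eq_square)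
    also have "\<dots> \<le> K * (M * (2 * V + H))\<^sup>2"
      using y1n[of k] K M0 by (intro mult_left_mono power_mono) auto
    finally show ?thesis by (simp add: sum_distrib_left mult.assoc)
  qed
  have lin: "\<bar>\<Sum>k\<in>UNIV. \<Sum>c\<in>Basis. (y2 k \<bullet> c) * partials [c] \<psi> ?y0\<bar>
      \<le> K * (M * (n * H + (\<Sum>m\<in>UNIV. \<bar>\<Sum>k\<in>UNIV. T k k m\<bar>)))"
  proof -
    have "(\<Sum>k\<in>UNIV. \<Sum>c\<in>Basis. (y2 k \<bullet> c) * partials [c] \<psi> ?y0)
        = (\<Sum>c\<in>Basis. ((\<Sum>k\<in>UNIV. y2 k) \<bullet> c) * partials [c] \<psi> ?y0)"
      by (subst sum.swap) (simp add: inner_sum_left sum_distrib_right del: partials.simps)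
    then have "\<bar>\<Sum>k\<in>UNIV. \<Sum>c\<in>Basis. (y2 k \<bullet> c) * partials [c] \<psi> ?y0\<bar> \<le> K * (M * norm (\<Sum>k\<in>UNIV. y2 k))"
      unfolding M_def using abs_sum_Basis_le[OF K1, where y = "\<Sum>k\<in>UNIV. y2 k"] by simp
    also have "\<dots> \<le> K * (M * (n * H + (\<Sum>m\<in>UNIV. \<bar>\<Sum>k\<in>UNIV. T k k m\<bar>)))"
    proof (intro mult_left_mono K M0)
      have "(\<Sum>k\<in>UNIV. y2 k) = (0, \<Sum>k\<in>UNIV. \<mu> k, \<Sum>k\<in>UNIV. G2 k)"
        unfolding y2_def by (simp add: sum_prod)
      then have "norm (\<Sum>k\<in>UNIV. y2 k) \<le> \<bar>\<Sum>k\<in>UNIV. \<mu> k\<bar> + norm (\<Sum>k\<in>UNIV. G2 k)"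
        using norm_Pair_le[of "0 :: real^'n" "(\<Sum>k\<in>UNIV. \<mu> k, \<Sum>k\<in>UNIV. G2 k)"]
          norm_Pair_le[of "\<Sum>k\<in>UNIV. \<mu> k" "\<Sum>k\<in>UNIV. G2 k"] by simp
      moreover have "\<bar>\<Sum>k\<in>UNIV. \<mu> k\<bar> \<le> n * H"
        using order.trans[OF sum_abs[of \<mu> UNIV] sum_bounded_above[of UNIV "\<lambda>k. \<bar>\<mu> k\<bar>" H]] muH by (simp add: n_def)
      moreover have "norm (\<Sum>k\<in>UNIV. G2 k) \<le> (\<Sum>m\<in>UNIV. \<bar>\<Sum>k\<in>UNIV. T k k m\<bar>)"
      proof -
        have "(\<Sum>k\<in>UNIV. G2 k) = (\<Sum>m\<in>UNIV. (\<Sum>k\<in>UNIV. T k k m) *\<^sub>R d m)"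
          unfolding G2 by (subst sum.swap) (simp add: scaleR_sum_left)
        also have "norm \<dots> \<le> (\<Sum>m\<in>UNIV. \<bar>\<Sum>k\<in>UNIV. T k k m\<bar>)"
        proof (rule order.trans[OF norm_sum sum_mono])
          fix m
          show "norm ((\<Sum>k\<in>UNIV. T k k m) *\<^sub>R d m) \<le> \<bar>\<Sum>k\<in>UNIV. T k k m\<bar>"
            using mult_left_mono[OF norm_d_le[of m], of "\<bar>\<Sum>k\<in>UNIV. T k k m\<bar>"] by simp
        qed
        finally show ?thesis .
      qed
      ultimately show "norm (\<Sum>k\<in>UNIV. y2 k) \<le> n * H + (\<Sum>m\<in>UNIV. \<bar>\<Sum>k\<in>UNIV. T k k m\<bar>)" by linarith
    qed
    finally show ?thesis .
  qed
  show ?thesis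
  proof (rule that[OF jet])
    show "\<bar>\<Sum>c\<in>Basis. (y1 k \<bullet> c) * partials [c] \<psi> ?y0\<bar> \<le> K * (M * (2 * V + H))" for k
      using P1[of k] by simp
    have "n * (- (K * (M * (2 * V + H))\<^sup>2))
      \<le> (\<Sum>k\<in>UNIV. \<Sum>c\<in>Basis. \<Sum>c'\<in>Basis. (y1 k \<bullet> c) * (y1 k \<bullet> c') * partials [c', c] \<psi> ?y0)"
      using sum_bounded_below[of "UNIV :: 'n set", OF quad] by (simp add: n_def)
    then show "- (n * K * (M * (2 * V + H))\<^sup>2) - K * (M * (n * H + (\<Sum>m\<in>UNIV. \<bar>\<Sum>k\<in>UNIV. T k k m\<bar>)))
      \<le> (\<Sum>k\<in>UNIV. (\<Sum>c\<in>Basis. \<Sum>c'\<in>Basis. (y1 k \<bullet> c) * (y1 k \<bullet> c') * partials [c', c] \<psi> ?y0)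
      + (\<Sum>c\<in>Basis. (y2 k \<bullet> c) * partials [c] \<psi> ?y0))"
      using lin by (simp only: sum.distrib)
  qed
qed

section \<open>The maximum principle\<close>


lemma metric_frame_bounds:
  assumes fr: "metric_frame p e w v b d" and \<theta>: "0 < \<theta>" "norm p \<le> 1 - \<theta>"
  defines "V \<equiv> 1 / sqrt (1 - (1 - \<theta>)\<^sup>2)"
  shows "0 < w" "w \<le> 1" "w * v = 1" "1 \<le> v" "v \<le> V" "norm (e i) \<le> V" "\<bar>b i\<bar> \<le> V"
proof -
  interpret metric_frame p e w v b d by (rule fr)
  have th: "\<theta> \<le> 1" using \<theta> norm_ge_zero[of p] by linarith
  have s0: "0 < 1 - (1 - \<theta>)\<^sup>2"
  proof -
    have "1 - (1 - \<theta>)\<^sup>2 = \<theta> * (2 - \<theta>)" by (simp add: power2_eq_square algebra_simps)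
    then show ?thesis using \<theta> th by simp
  qed
  show w0: "0 < w" by (rule w_pos)
  show wv: "w * v = 1" using w_pos by (simp add: v)
  show v1: "1 \<le> v" by (rule v_ge_1)
  show "w \<le> 1" using mult_left_mono[OF v1, of w] w0 wv by simp
  have "(norm p)\<^sup>2 \<le> (1 - \<theta>)\<^sup>2" using \<theta>(2) by (intro power_mono) auto
  then have "sqrt (1 - (1 - \<theta>)\<^sup>2) \<le> w" unfolding w by simp
  then show vV: "v \<le> V" unfolding v V_def using s0 by (intro divide_left_mono) (auto simp: w0)
  show "norm (e i) \<le> V" using norm_e_le[of i] vV by simp
  have "(b i)\<^sup>2 \<le> v\<^sup>2" using b_sq_le[of i] by simp
  then have "\<bar>b i\<bar> \<le> v" using v1 by (simp add: abs_le_square_iff[symmetric])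
  then show "\<bar>b i\<bar> \<le> V" using vV by simp
qed

lemma abs_sum_le_card:
  fixes g :: "'n::finite \<Rightarrow> real"
  assumes "\<And>i. \<bar>g i\<bar> \<le> c"
  shows "\<bar>\<Sum>i\<in>UNIV. g i\<bar> \<le> real CARD('n) * c"
  using order.trans[OF sum_abs[of g UNIV] sum_bounded_above[of UNIV "\<lambda>i. \<bar>g i\<bar>" c]] assms by simp

text \<open>The formula for \<nabla>H is solved for the trace of the third derivatives; what is left
  is quadratic in the second derivatives.\<close>

lemma third_derivative_trace_bound:
  fixes \<mu> b :: "'n::finite \<Rightarrow> real" and T :: "'n \<Rightarrow> 'n \<Rightarrow> 'n \<Rightarrow> real"
  defines "n \<equiv> real CARD('n)"
  assumes w: "0 < w" "w \<le> 1" "w * v = 1" and mu: "\<And>i. \<bar>\<mu> i\<bar> \<le> H" and b: "\<And>i. \<bar>b i\<bar> \<le> V"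
  shows "(\<Sum>m\<in>UNIV. \<bar>\<Sum>k\<in>UNIV. T k k m\<bar>)
    \<le> (\<Sum>m\<in>UNIV. \<bar>\<Sum>i\<in>UNIV. cov_h v b \<mu> T i i m\<bar>) + n * (n + 2) * V * H\<^sup>2"
proof -
  have H0: "0 \<le> H" using mu abs_ge_zero order_trans by blast
  have V0: "0 \<le> V" using b abs_ge_zero order_trans by blast
  have "\<bar>\<Sum>k\<in>UNIV. T k k m\<bar> \<le> \<bar>\<Sum>i\<in>UNIV. cov_h v b \<mu> T i i m\<bar> + (n + 2) * V * H\<^sup>2" for m
  proof -
    let ?S = "\<Sum>i\<in>UNIV. cov_h v b \<mu> T i i m"
    have "cov_h v b \<mu> T i i m = v * (T i i m + \<mu> m * b m * \<mu> i + (if i = m then 2 * (\<mu> m)\<^sup>2 * b m else 0))" for i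
      by (simp add: cov_h_def power2_eq_square)
    then have "?S = v * ((\<Sum>k\<in>UNIV. T k k m) + \<mu> m * b m * (\<Sum>i\<in>UNIV. \<mu> i) + 2 * (\<mu> m)\<^sup>2 * b m)"
      by (simp add: sum_distrib_left[symmetric] sum.distrib)
    then have "w * ?S = (w * v) * ((\<Sum>k\<in>UNIV. T k k m) + \<mu> m * b m * (\<Sum>i\<in>UNIV. \<mu> i) + 2 * (\<mu> m)\<^sup>2 * b m)"
      by (simp only: mult.assoc)
    then have eq: "(\<Sum>k\<in>UNIV. T k k m) = w * ?S - \<mu> m * b m * (\<Sum>i\<in>UNIV. \<mu> i) - 2 * (\<mu> m)\<^sup>2 * b m"
      using w(3) by simp
    have 1: "\<bar>w * ?S\<bar> \<le> \<bar>?S\<bar>" using w mult_right_mono[of w 1 "\<bar>?S\<bar>"] by (simp add: abs_mult)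
    have 2: "\<bar>\<mu> m * b m * (\<Sum>i\<in>UNIV. \<mu> i)\<bar> \<le> H * V * (n * H)"
      unfolding abs_mult n_def using mu b H0 V0 abs_sum_le_card[OF mu] by (intro mult_mono) auto
    have 3: "\<bar>2 * (\<mu> m)\<^sup>2 * b m\<bar> \<le> 2 * H\<^sup>2 * V"
      unfolding abs_mult using b H0 power_mono[OF mu[of m], of 2] by (intro mult_mono) auto
    have "(n + 2) * V * H\<^sup>2 = H * V * (n * H) + 2 * H\<^sup>2 * V" by (simp add: power2_eq_square algebra_simps)
    then show ?thesis unfolding eq using 1 2 3 by linarith
  qed
  then have "(\<Sum>m\<in>UNIV. \<bar>\<Sum>k\<in>UNIV. T k k m\<bar>) \<le> (\<Sum>m\<in>UNIV. \<bar>\<Sum>i\<in>UNIV. cov_h v b \<mu> T i i m\<bar> + (n + 2) * V * H\<^sup>2)"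
    by (rule sum_mono)
  then show ?thesis by (simp add: sum.distrib n_def mult.assoc)
qed

lemma abs_double_sum_le:
  fixes \<mu> b P :: "'n::finite \<Rightarrow> real"
  assumes "\<And>i. \<bar>\<mu> i\<bar> \<le> H" "\<And>i. \<bar>b i\<bar> \<le> V" "\<And>i. \<bar>P i\<bar> \<le> c"
  shows "\<bar>\<Sum>k\<in>UNIV. \<mu> k * (\<Sum>m\<in>UNIV. b m * P m)\<bar> \<le> real CARD('n) * (H * (real CARD('n) * (V * c)))"
proof (rule abs_sum_le_card)
  fix k
  have H0: "0 \<le> H" and V0: "0 \<le> V"
    using assms(1,2)[of k] abs_ge_zero[of "\<mu> k"] abs_ge_zero[of "b k"] by linarith+
  have "\<bar>b m * P m\<bar> \<le> V * c" for m
    unfolding abs_mult by (rule mult_mono[OF assms(2,3) V0 abs_ge_zero])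
  then have "\<bar>\<Sum>m\<in>UNIV. b m * P m\<bar> \<le> real CARD('n) * (V * c)" by (rule abs_sum_le_card)
  then show "\<bar>\<mu> k * (\<Sum>m\<in>UNIV. b m * P m)\<bar> \<le> H * (real CARD('n) * (V * c))"
    unfolding abs_mult by (rule mult_mono[OF assms(1) _ H0 abs_ge_zero])
qed

text \<open>Collects exactly what the estimate may use of a solution: bounds by the fixed numbers
  \<open>R\<close>, \<open>\<theta>\<close>, \<open>K\<close>, \<open>m\<close>. The function \<psi>
  is controlled only at the points (x, u, Du), and \<open>a\<close>, \<open>c\<close> are the
  coefficients of the affine boundary function.\<close>

definition dirichlet_data ::
  "(real^'n) set \<Rightarrow> real \<Rightarrow> real \<Rightarrow> real \<Rightarrow> real \<Rightarrow> (real^'n \<Rightarrow> real)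
    \<Rightarrow> ((real^'n) \<times> real \<times> (real^'n) \<Rightarrow> real) \<Rightarrow> real^'n \<Rightarrow> real \<Rightarrow> bool" where
  "dirichlet_data \<Omega> R \<theta> K m u \<psi> a c \<longleftrightarrow> Ck_on 4 \<Omega> u \<and> Ck_on 2 (psi_dom \<Omega>) \<psi> \<and> norm a \<le> 1 \<and>
    (\<forall>x\<in>\<Omega>. norm x \<le> R \<and> norm (grad \<Omega> u x) \<le> 1 - \<theta> \<and> 0 < sigma_k 1 \<Omega> u x \<and>
      0 < a \<bullet> x + c - u x \<and> a \<bullet> x + c - u x \<le> 6 * R \<and>
      sigma_k 2 \<Omega> u x = \<psi> (x, u x, grad \<Omega> u x) \<and>
      m \<le> \<psi> (x, u x, grad \<Omega> u x) \<and> \<psi> (x, u x, grad \<Omega> u x) \<le> K \<and>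
      (\<forall>i\<in>Basis. \<bar>partials [i] \<psi> (x, u x, grad \<Omega> u x)\<bar> \<le> K) \<and>
      (\<forall>i\<in>Basis. \<forall>j\<in>Basis. \<bar>partials [j, i] \<psi> (x, u x, grad \<Omega> u x)\<bar> \<le> K))"

text \<open>For the last claim, \<kappa>_i^2 \<le> \<Sum> \<kappa>_j^2 = \<sigma>_1^2 - 2 \<sigma>_2
  < \<sigma>_1^2.\<close>

lemma mean_scal_curv_eq:
  fixes \<Omega> :: "(real^'n) set"
  assumes "open \<Omega>" "x \<in> \<Omega>" "Ck_on 4 \<Omega> u" "\<And>x. x \<in> \<Omega> \<Longrightarrow> norm (grad \<Omega> u x) < 1"
  shows "mean_curv \<Omega> u x = sigma_k 1 \<Omega> u x" "scal_curv \<Omega> u x = sigma_k 2 \<Omega> u x"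
    "0 < sigma_k 1 \<Omega> u x \<Longrightarrow> 0 < sigma_k 2 \<Omega> u x \<Longrightarrow> kappa_max \<Omega> u x \<le> mean_curv \<Omega> u x"
proof -
  have "mean_curv \<Omega> u x = sigma_k 1 \<Omega> u x \<and> scal_curv \<Omega> u x = sigma_k 2 \<Omega> u x \<and>
    (0 < sigma_k 1 \<Omega> u x \<longrightarrow> 0 < sigma_k 2 \<Omega> u x \<longrightarrow> kappa_max \<Omega> u x \<le> mean_curv \<Omega> u x)"
  proof (rule curvature_jets[OF assms], assumption, goal_cases)
    case (1 e d \<kappa> b \<mu> w v T Q)
    have m: "mean_curv \<Omega> u x = sigma_k 1 \<Omega> u x" using 1(8)[of undefined] 1(10) by (simp add: jet2_def)
    moreover have "scal_curv \<Omega> u x = sigma_k 2 \<Omega> u x" using 1(9)[of undefined] 1(11) by (simp add: jet2_def)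
    moreover have "kappa_max \<Omega> u x \<le> mean_curv \<Omega> u x" if s: "0 < sigma_k 1 \<Omega> u x" "0 < sigma_k 2 \<Omega> u x"
    proof -
      have "kappa_max \<Omega> u x = Max (range \<kappa>)"
        unfolding kappa_max_def using 1(12) by simp
      also have "\<dots> \<in> range \<kappa>" by (rule Max_in) auto
      finally obtain i where i: "kappa_max \<Omega> u x = \<kappa> i" by blast
      have "(\<kappa> i)\<^sup>2 \<le> (\<Sum>i\<in>UNIV. (\<kappa> i)\<^sup>2)" by (rule member_le_sum) auto
      also have "\<dots> \<le> (sigma_k 1 \<Omega> u x)\<^sup>2" using 1(10,11) s(2) by simp
      finally have "\<bar>\<kappa> i\<bar> \<le> \<bar>sigma_k 1 \<Omega> u x\<bar>" by (simp only: abs_le_square_iff)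
      then show ?thesis unfolding i m using s(1) by linarith
    qed
    ultimately show ?case by blast
  qed
  then show "mean_curv \<Omega> u x = sigma_k 1 \<Omega> u x" "scal_curv \<Omega> u x = sigma_k 2 \<Omega> u x"
    "0 < sigma_k 1 \<Omega> u x \<Longrightarrow> 0 < sigma_k 2 \<Omega> u x \<Longrightarrow> kappa_max \<Omega> u x \<le> mean_curv \<Omega> u x"
    by blast+
qed

lemma log_test_function_jet:
  fixes u :: "real^'n \<Rightarrow> real"
  assumes H: "jet2 (\<lambda>t. h (x0 + t *\<^sub>R e)) H0 H1 H2" "0 < H0"
    and u: "jet2 (\<lambda>t. u (x0 + t *\<^sub>R e)) u0 u1 u2" and \<eta>: "\<eta> = a \<bullet> x0 + c - u0" "0 < \<eta>"
  shows "jet2 (\<lambda>t. ln (h (x0 + t *\<^sub>R e)) + (\<beta> * ln (a \<bullet> (x0 + t *\<^sub>R e) + c - u (x0 + t *\<^sub>R e))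
        + N * ((norm (x0 + t *\<^sub>R e))\<^sup>2 / 2)))
     (ln H0 + (\<beta> * ln \<eta> + N * ((norm x0)\<^sup>2 / 2)))
     (H1 / H0 + (\<beta> * ((a \<bullet> e - u1) / \<eta>) + N * (x0 \<bullet> e)))
     ((H2 / H0 - H1\<^sup>2 / H0\<^sup>2) + (\<beta> * (- u2 / \<eta> - (a \<bullet> e - u1)\<^sup>2 / \<eta>\<^sup>2) + N * (norm e)\<^sup>2))"
proof -
  have E: "jet2 (\<lambda>t. a \<bullet> (x0 + t *\<^sub>R e) + c - u (x0 + t *\<^sub>R e)) \<eta> (a \<bullet> e - u1) (- u2)"
    unfolding \<eta>(1) using jet2_diff[OF jet2_linear[of "a \<bullet> x0 + c" "a \<bullet> e"] u]
    by (simp add: inner_add_right algebra_simps)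
  have X: "jet2 (\<lambda>t. (norm (x0 + t *\<^sub>R e))\<^sup>2 / 2) ((norm x0)\<^sup>2 / 2) (x0 \<bullet> e) ((norm e)\<^sup>2)"
  proof -
    have "(\<lambda>t. (norm (x0 + t *\<^sub>R e))\<^sup>2 / 2) = (\<lambda>t. 1 / 2 * (x0 \<bullet> x0) + t * (x0 \<bullet> e) + 1 / 2 * ((0 + t * 1) * (0 + t * 1) * (e \<bullet> e)))"
      by (rule ext) (simp add: power2_norm_eq_inner inner_add_left inner_add_right inner_commute algebra_simps add_divide_distrib)
    moreover have "jet2 (\<lambda>t. 1 / 2 * (x0 \<bullet> x0) + t * (x0 \<bullet> e) + 1 / 2 * ((0 + t * 1) * (0 + t * 1) * (e \<bullet> e)))
       ((norm x0)\<^sup>2 / 2) (x0 \<bullet> e) ((norm e)\<^sup>2)"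
      using jet2_add[OF jet2_linear[of "1 / 2 * (x0 \<bullet> x0)" "x0 \<bullet> e"]
          jet2_cmult[OF jet2_mult[OF jet2_mult[OF jet2_linear[of 0 1] jet2_linear[of 0 1]] jet2_const[of "e \<bullet> e"]], of "1/2"]]
      by (rule jet2_eqI) (simp_all add: power2_norm_eq_inner)
    ultimately show ?thesis by simp
  qed
  show ?thesis
    by (rule jet2_add[OF jet2_ln[OF H] jet2_add[OF jet2_cmult[OF jet2_ln[OF E \<eta>(2)]] jet2_cmult[OF X]]])
qed


text \<open>Uniformity is the point: \<open>N\<close>, \<open>\<beta>\<close> and \<open>C\<close>
  are produced before the solution. The exponent is a natural number so that the test function
  remains continuous, with value 0, where \<eta> vanishes; logarithms are taken only in the
  interior.\<close>

lemma max_point_estimate: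
  fixes \<Omega> :: "(real^'n) set" and \<theta> K m R :: real
  assumes \<Omega>: "open \<Omega>" and \<theta>: "0 < \<theta>" "\<theta> < 1" and pos: "0 < m" "0 \<le> K" "0 \<le> R"
  obtains N :: real and \<beta> :: nat and C :: real where "0 \<le> N" "1 \<le> \<beta>"
    "\<And>u \<psi> a c x0. \<lbrakk>dirichlet_data \<Omega> R \<theta> K m u \<psi> a c; x0 \<in> \<Omega>;
       \<And>x. x \<in> \<Omega> \<Longrightarrow> mean_curv \<Omega> u x * (a \<bullet> x + c - u x) ^ \<beta> * exp (N * ((norm x)\<^sup>2 / 2))
         \<le> mean_curv \<Omega> u x0 * (a \<bullet> x0 + c - u x0) ^ \<beta> * exp (N * ((norm x0)\<^sup>2 / 2))\<rbrakk>
       \<Longrightarrow> mean_curv \<Omega> u x0 * (a \<bullet> x0 + c - u x0) \<le> C"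
proof -
  define n where "n = real CARD('n)"
  define M where "M = real DIM((real^'n) \<times> real \<times> (real^'n))"
  define V where "V = 1 / sqrt (1 - (1 - \<theta>)\<^sup>2)"
  \<comment> \<open>A lower bound for H, since H^2 \<ge> 2 \<sigma>. It lets constants be absorbed
    into multiples of H: \<open>A1\<close> is such that 2 V + H \<le> A1 H.\<close>
  define h0 where "h0 = sqrt (2 * m)"
  define A1 where "A1 = 2 * V / h0 + 1"
  define C2 where "C2 = K * (M * A1)"
  \<comment> \<open>In this order: second derivatives of \<psi>; first derivatives of \<psi> against
    D^2 u, against the quadratic part of the third-derivative traces, and against \<nabla>H (the 1);
    the Christoffel correction.\<close>
  define C1 where "C1 = n * K * (M * A1)\<^sup>2 + K * M * (n / h0 + n * (n + 2) * V + 1) + n * n * V * C2"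
  define C4 where "C4 = 2 * K * (1 + n * (V * (2 * V)))"
  define C5 where "C5 = 2 * K * (n * (V * (R * V)))"
  \<comment> \<open>One constant for both \<eta> (at most 6 R) and its frame derivatives (at most 2
    V).\<close>
  define E where "E = 2 * V + 6 * R"
  define C3 where "C3 = n * (30 * C2\<^sup>2 + C2\<^sup>2 / (2 * m))"
  define N where "N = C1 + C3 + 2 * K + 2"
  define \<beta> where "\<beta> = nat \<lceil>7 + 4 * n * N\<^sup>2 * (R * V)\<^sup>2\<rceil>"
  define a' where "a' = real \<beta> * E + N * (R * V) * E"
  define C where "C = E + 100 * (E\<^sup>2 * (4 * K + C1 + C3) + C1 * n * a' * E + 2 * n * a'\<^sup>2 + real \<beta> * C4 * E
      + 2 * n * real \<beta> * E\<^sup>2 + N * C5 * E\<^sup>2) + 1 + 2 * (a'\<^sup>2 + real \<beta> * E\<^sup>2 + 1) + (C1 * n * a' + real \<beta> * C4 + N * C5 * E)"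
  have n0: "0 \<le> n" and M0: "0 \<le> M" by (simp_all add: n_def M_def)
  have V0: "0 < V"
  proof -
    have "1 - (1 - \<theta>)\<^sup>2 = \<theta> * (2 - \<theta>)" by (simp add: power2_eq_square algebra_simps)
    then show ?thesis using \<theta> by (simp add: V_def)
  qed
  have h0: "0 < h0" using pos by (simp add: h0_def)
  have A10: "0 \<le> A1" using V0 h0 by (simp add: A1_def)
  have C20: "0 \<le> C2" using pos M0 A10 by (simp add: C2_def)
  have C10: "0 \<le> C1" unfolding C1_def using pos n0 M0 V0 h0 C20
    by (intro add_nonneg_nonneg mult_nonneg_nonneg divide_nonneg_nonneg) auto
  have C1KM: "K * M \<le> C1"
  proof -
    have "0 \<le> n * K * (M * A1)\<^sup>2 + K * M * (n / h0 + n * (n + 2) * V) + n * n * V * C2"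
      using pos n0 M0 V0 h0 C20
      by (intro add_nonneg_nonneg mult_nonneg_nonneg divide_nonneg_nonneg) auto
    then show ?thesis by (simp add: C1_def algebra_simps)
  qed
  have C30: "0 \<le> C3" unfolding C3_def using n0 pos by simp
  have C40: "0 \<le> C4" unfolding C4_def using n0 pos V0 by simp
  have C50: "0 \<le> C5" unfolding C5_def using n0 pos V0 by simp
  have E0: "0 \<le> E" unfolding E_def using pos V0 by simp
  have N0: "0 \<le> N" unfolding N_def using pos C10 C30 by simp
  have RV: "0 \<le> R * V" using pos V0 by simp
  have beta: "7 \<le> real \<beta>" "4 * n * N\<^sup>2 * (R * V)\<^sup>2 \<le> real \<beta>"
  proof -
    have "0 \<le> 4 * n * N\<^sup>2 * (R * V)\<^sup>2" using n0 by simp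
    moreover have "7 + 4 * n * N\<^sup>2 * (R * V)\<^sup>2 \<le> real \<beta>" unfolding \<beta>_def by (rule real_nat_ceiling_ge)
    ultimately show "7 \<le> real \<beta>" "4 * n * N\<^sup>2 * (R * V)\<^sup>2 \<le> real \<beta>" by linarith+
  qed
  have main: "mean_curv \<Omega> u x0 * (a \<bullet> x0 + c - u x0) \<le> C"
    if D: "dirichlet_data \<Omega> R \<theta> K m u \<psi> a c" and x0: "x0 \<in> \<Omega>"
    and mx: "\<And>x. x \<in> \<Omega> \<Longrightarrow> mean_curv \<Omega> u x * (a \<bullet> x + c - u x) ^ \<beta> * exp (N * ((norm x)\<^sup>2 / 2))
         \<le> mean_curv \<Omega> u x0 * (a \<bullet> x0 + c - u x0) ^ \<beta> * exp (N * ((norm x0)\<^sup>2 / 2))" for u \<psi> a c x0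
  proof -
    have u4: "Ck_on 4 \<Omega> u" and p2: "Ck_on 2 (psi_dom \<Omega>) \<psi>" and na: "norm a \<le> 1"
      using D by (auto simp: dirichlet_data_def)
    have u2: "Ck_on 2 \<Omega> u" using Ck_on_mono[OF u4] by simp
    have gr: "norm (grad \<Omega> u x) \<le> 1 - \<theta>" if "x \<in> \<Omega>" for x using D that by (auto simp: dirichlet_data_def)
    have sp: "norm (grad \<Omega> u x) < 1" if "x \<in> \<Omega>" for x using gr[OF that] \<theta> by linarith
    have s1pos: "0 < sigma_k 1 \<Omega> u x" if "x \<in> \<Omega>" for x using D that by (auto simp: dirichlet_data_def)
    have eq: "sigma_k 2 \<Omega> u x = \<psi> (x, u x, grad \<Omega> u x)" if "x \<in> \<Omega>" for x
      using D that by (auto simp: dirichlet_data_def)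
    define \<eta> where "\<eta> = a \<bullet> x0 + c - u x0"
    have etax: "0 < a \<bullet> x + c - u x" if "x \<in> \<Omega>" for x using D that by (auto simp: dirichlet_data_def)
    have eta: "0 < \<eta>" "\<eta> \<le> E"
      using D x0 V0 by (auto simp: dirichlet_data_def \<eta>_def E_def intro: add_increasing)
    define \<sigma> where "\<sigma> = \<psi> (x0, u x0, grad \<Omega> u x0)"
    have sig: "m \<le> \<sigma>" "\<sigma> \<le> K" using D x0 by (auto simp: dirichlet_data_def \<sigma>_def)
    have K1: "\<And>i. i \<in> Basis \<Longrightarrow> \<bar>partials [i] \<psi> (x0, u x0, grad \<Omega> u x0)\<bar> \<le> K"
      and K2: "\<And>i j. i \<in> Basis \<Longrightarrow> j \<in> Basis \<Longrightarrow> \<bar>partials [j, i] \<psi> (x0, u x0, grad \<Omega> u x0)\<bar> \<le> K"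
      using D x0 by (simp_all add: dirichlet_data_def del: partials.simps)
    have nx0: "norm x0 \<le> R" using D x0 by (auto simp: dirichlet_data_def)
    show ?thesis
    proof (rule curvature_jets[OF \<Omega> x0 u4 sp], assumption, goal_cases)
      case c: (1 e d \<kappa> b \<mu> w v T Q)
      note fr = c(1)
      note fb = metric_frame_bounds[OF fr \<theta>(1) gr[OF x0], folded V_def]
      define H where "H = (\<Sum>i\<in>UNIV. \<kappa> i)"
      define f where "f = (\<lambda>i. H - \<kappa> i)"
      define h1 where "h1 = (\<lambda>k. \<Sum>i\<in>UNIV. cov_h v b \<mu> T i i k)"
      define h2 where "h2 = (\<lambda>k. \<Sum>i\<in>UNIV. shape_d2 v b \<mu> T Q k i i)"
      define x where "x = (\<lambda>k. x0 \<bullet> e k)"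
      define e1 where "e1 = (\<lambda>k. a \<bullet> e k - b k)"
      have mc0: "mean_curv \<Omega> u x0 = H" using c(8)[of undefined] by (simp add: jet2_def H_def)
      have H0: "0 < H" using s1pos[OF x0] c(10) by (simp add: H_def)
      have sigma: "2 * \<sigma> = H\<^sup>2 - (\<Sum>i\<in>UNIV. (\<kappa> i)\<^sup>2)"
        using c(11) eq[OF x0] by (simp add: H_def \<sigma>_def)
      have kH: "\<bar>\<kappa> i\<bar> \<le> H" for i
      proof -
        have "(\<kappa> i)\<^sup>2 \<le> (\<Sum>i\<in>UNIV. (\<kappa> i)\<^sup>2)" by (rule member_le_sum) auto
        then have "(\<kappa> i)\<^sup>2 \<le> H\<^sup>2" using sigma sig pos by linarith
        then show ?thesis using H0 by (simp add: abs_le_square_iff[symmetric])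
      qed
      have f0: "0 \<le> f i" for i using kH[of i] by (simp add: f_def)
      have muw: "\<mu> i = w * \<kappa> i" for i using c(2) by simp
      have vk: "v * \<mu> i = \<kappa> i" for i
      proof -
        have "v * \<mu> i = (w * v) * \<kappa> i" by (simp add: muw)
        then show ?thesis using fb(3) by simp
      qed
      have muH: "\<bar>\<mu> i\<bar> \<le> H" for i
      proof -
        have "\<bar>\<mu> i\<bar> \<le> 1 * H" unfolding muw abs_mult using fb(1,2) kH H0 by (intro mult_mono) auto
        then show ?thesis by simp
      qed
      have Hh0: "h0 \<le> H"
      proof -
        have "0 \<le> (\<Sum>i\<in>UNIV. (\<kappa> i)\<^sup>2)" by (simp add: sum_nonneg)
        then have "2 * m \<le> H\<^sup>2" using sigma sig by linarith
        then show ?thesis using H0 real_le_lsqrt by (simp add: h0_def)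
      qed
      have A1H: "2 * V + H \<le> A1 * H"
      proof -
        have "2 * V * h0 \<le> 2 * V * H" using Hh0 V0 by (intro mult_left_mono) auto
        then have "2 * V \<le> 2 * V / h0 * H" using h0 by (simp add: field_simps)
        then show ?thesis by (simp add: A1_def distrib_right)
      qed
      \<comment> \<open>In dimension one \<sigma>_2 is zero, contrary to \<sigma> \<ge> m. Hence
        \<Sum> f_k = (n - 1) H is at least H.\<close>
      have n2: "2 \<le> n"
      proof (rule ccontr)
        assume "\<not> 2 \<le> n"
        then have "CARD('n) < 2" unfolding n_def by linarith
        moreover have "0 < CARD('n)" by simp
        ultimately have "CARD('n) = 1" by linarith
        then obtain i where U: "(UNIV :: 'n set) = {i}" by (auto simp: card_1_singleton_iff)
        have "2 * \<sigma> = 0" unfolding sigma H_def U by simp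
        then show False using sig pos by simp
      qed
      have bj: "b k = partials [e k] u x0" for k
      proof -
        interpret metric_frame "grad \<Omega> u x0" e w v b d by (rule fr)
        show ?thesis using grad_inner[OF x0 Ck_on_differentiable[of 1]] u2 x0
          by (simp add: numeral_2_eq_2 b)
      qed
      have uj: "jet2 (\<lambda>t. u (x0 + t *\<^sub>R e k)) (u x0) (b k) (\<mu> k)" for k
        using jet2_line[OF \<Omega> x0 u2, of "e k"] c(3)[of k k] bj[of k] by (simp del: partials.simps)
      define q where "q = (\<lambda>x. ln (mean_curv \<Omega> u x) + (real \<beta> * ln (a \<bullet> x + c - u x) + N * ((norm x)\<^sup>2 / 2)))"
      have qj: "jet2 (\<lambda>t. q (x0 + t *\<^sub>R e k)) (q x0)
          (h1 k / H + (real \<beta> * (e1 k / \<eta>) + N * x k))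
          ((h2 k / H - (h1 k)\<^sup>2 / H\<^sup>2) + (real \<beta> * (- \<mu> k / \<eta> - (e1 k)\<^sup>2 / \<eta>\<^sup>2) + N * (norm (e k))\<^sup>2))" for k
        using log_test_function_jet[OF c(8)[of k] _ uj[of k] \<eta>_def eta(1), of "real \<beta>" N] H0
        unfolding q_def h1_def h2_def e1_def x_def H_def[symmetric] mc0 \<eta>_def[symmetric] by blast
      have qmax: "q y \<le> q x0" if y: "y \<in> \<Omega>" for y
      proof -
        have ex: "exp (q z) = mean_curv \<Omega> u z * (a \<bullet> z + c - u z) ^ \<beta> * exp (N * ((norm z)\<^sup>2 / 2))" if "z \<in> \<Omega>" for z
        proof -
          have "0 < mean_curv \<Omega> u z" using mean_scal_curv_eq(1)[OF \<Omega> that u4 sp] s1pos[OF that] by simp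
          then show ?thesis using etax[OF that]
            by (simp add: q_def exp_add exp_of_nat_mult)
        qed
        have "exp (q y) \<le> exp (q x0)" using mx[OF y] unfolding ex[OF y] ex[OF x0] .
        then show ?thesis by simp
      qed
      have lm: "\<forall>\<^sub>F t in nhds 0. q (x0 + t *\<^sub>R e k) \<le> q x0" for k
        by (rule eventually_mono[OF eventually_line_in_open[OF \<Omega> x0, of "e k"]]) (rule qmax)
      note first = jet2_local_max(1)[OF qj lm] and second = jet2_local_max(2)[OF qj lm]
      define LH where "LH = (\<Sum>k\<in>UNIV. f k * (h2 k + \<mu> k * (\<Sum>m\<in>UNIV. b m * h1 m)))"
      define Le where "Le = (\<Sum>k\<in>UNIV. f k * (- \<mu> k + \<mu> k * (\<Sum>m\<in>UNIV. b m * e1 m)))"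
      define LX where "LX = (\<Sum>k\<in>UNIV. f k * ((norm (e k))\<^sup>2 + \<mu> k * (\<Sum>m\<in>UNIV. b m * x m)))"
      \<comment> \<open>The second derivative tests are summed with the weights f_k \<ge> 0. The
        Christoffel corrections add up to a multiple of the first derivatives of \<open>q\<close>,
        which vanish, so ordinary second derivatives may be replaced by covariant ones.\<close>
      have max: "(LH / H - (\<Sum>k\<in>UNIV. f k * (h1 k)\<^sup>2) / H\<^sup>2)
        + real \<beta> * (Le / \<eta> - (\<Sum>k\<in>UNIV. f k * (e1 k)\<^sup>2) / \<eta>\<^sup>2) + N * LX \<le> 0"
      proof -
        let ?g = "\<lambda>k. h1 k / H + (real \<beta> * (e1 k / \<eta>) + N * x k)"
        let ?s = "\<lambda>k. (h2 k / H - (h1 k)\<^sup>2 / H\<^sup>2) + (real \<beta> * (- \<mu> k / \<eta> - (e1 k)\<^sup>2 / \<eta>\<^sup>2) + N * (norm (e k))\<^sup>2)"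
        define B1 where "B1 = (\<Sum>m\<in>UNIV. b m * h1 m)"
        define B2 where "B2 = (\<Sum>m\<in>UNIV. b m * e1 m)"
        define B3 where "B3 = (\<Sum>m\<in>UNIV. b m * x m)"
        have "(\<Sum>m\<in>UNIV. b m * ?g m) = B1 / H + real \<beta> * B2 / \<eta> + N * B3"
          unfolding B1_def B2_def B3_def
          by (simp add: distrib_left sum.distrib sum_divide_distrib sum_distrib_left mult_ac)
        then have B: "B1 / H + real \<beta> * B2 / \<eta> + N * B3 = 0" using first by simp
        have "(LH / H - (\<Sum>k\<in>UNIV. f k * (h1 k)\<^sup>2) / H\<^sup>2)
            + real \<beta> * (Le / \<eta> - (\<Sum>k\<in>UNIV. f k * (e1 k)\<^sup>2) / \<eta>\<^sup>2) + N * LX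
          = (\<Sum>k\<in>UNIV. (f k * (h2 k + \<mu> k * B1) / H - f k * (h1 k)\<^sup>2 / H\<^sup>2)
            + real \<beta> * (f k * (- \<mu> k + \<mu> k * B2) / \<eta> - f k * (e1 k)\<^sup>2 / \<eta>\<^sup>2) + N * (f k * ((norm (e k))\<^sup>2 + \<mu> k * B3)))"
          unfolding LH_def Le_def LX_def B1_def[symmetric] B2_def[symmetric] B3_def[symmetric]
          by (simp only: sum.distrib sum_subtractf sum_divide_distrib[symmetric] sum_distrib_left[symmetric])
        also have "\<dots> = (\<Sum>k\<in>UNIV. f k * (?s k + \<mu> k * (B1 / H + real \<beta> * B2 / \<eta> + N * B3)))"
          by (intro sum.cong refl) (simp add: algebra_simps add_divide_distrib diff_divide_distrib)
        also have "\<dots> = (\<Sum>k\<in>UNIV. f k * ?s k)" unfolding B by simp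
        also have "\<dots> \<le> 0" using f0 second by (intro sum_nonpos mult_nonneg_nonpos) auto
        finally show ?thesis .
      qed
      \<comment> \<open>Euler's relation for the quadratic function \<sigma>_2: the trace of the
        linearized operator against D^2 u is bounded independently of H.\<close>
      have fmu: "(\<Sum>k\<in>UNIV. f k * \<mu> k) = w * (2 * \<sigma>)"
      proof -
        have "(\<Sum>k\<in>UNIV. f k * \<mu> k) = (\<Sum>k\<in>UNIV. w * (H * \<kappa> k - (\<kappa> k)\<^sup>2))"
          by (simp add: f_def muw algebra_simps power2_eq_square)
        also have "\<dots> = w * (H * (\<Sum>k\<in>UNIV. \<kappa> k) - (\<Sum>k\<in>UNIV. (\<kappa> k)\<^sup>2))"
          by (simp add: sum_distrib_left sum_subtractf right_diff_distrib)
        also have "\<dots> = w * (2 * \<sigma>)" unfolding sigma H_def[symmetric] by (simp add: power2_eq_square)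
        finally show ?thesis .
      qed
      have fmuK: "0 \<le> w * (2 * \<sigma>)" "w * (2 * \<sigma>) \<le> 2 * K"
      proof -
        show "0 \<le> w * (2 * \<sigma>)" using fb(1) sig pos by simp
        have "w * (2 * \<sigma>) \<le> 1 * (2 * K)" using fb(1,2) sig pos by (intro mult_mono) auto
        then show "w * (2 * \<sigma>) \<le> 2 * K" by simp
      qed
      define S where "S = w * (2 * \<sigma>)"
      note fmu = fmu[folded S_def] and fmuK = fmuK[folded S_def]
      have e1V: "\<bar>e1 k\<bar> \<le> 2 * V" for k
      proof -
        have "\<bar>a \<bullet> e k\<bar> \<le> norm a * norm (e k)" by (rule Cauchy_Schwarz_ineq2)
        also have "\<dots> \<le> 1 * V" using na fb(6)[of k] by (intro mult_mono) auto
        finally show ?thesis using fb(7)[of k] by (simp add: e1_def)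
      qed
      have xV: "\<bar>x k\<bar> \<le> R * V" for k
      proof -
        have "\<bar>x k\<bar> \<le> norm x0 * norm (e k)" unfolding x_def by (rule Cauchy_Schwarz_ineq2)
        also have "\<dots> \<le> R * V" using nx0 fb(6)[of k] pos by (intro mult_mono) auto
        finally show ?thesis .
      qed
      have bsum: "\<bar>\<Sum>m\<in>UNIV. b m * g m\<bar> \<le> n * (V * r)" if "\<And>m. \<bar>g m\<bar> \<le> r" for g r
        unfolding n_def
      proof (rule abs_sum_le_card)
        show "\<bar>b m * g m\<bar> \<le> V * r" for m
          unfolding abs_mult by (rule mult_mono[OF fb(7) that]) (use V0 in auto)
      qed
      have Le: "\<bar>Le\<bar> \<le> C4"
      proof -
        have "Le = (\<Sum>k\<in>UNIV. f k * \<mu> k) * (- 1 + (\<Sum>m\<in>UNIV. b m * e1 m))"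
          unfolding Le_def sum_distrib_right by (simp add: algebra_simps)
        then have "\<bar>Le\<bar> = S * \<bar>- 1 + (\<Sum>m\<in>UNIV. b m * e1 m)\<bar>"
          unfolding fmu using fmuK(1) by (simp only: abs_mult abs_of_nonneg)
        also have "\<dots> \<le> 2 * K * (1 + n * (V * (2 * V)))"
          using fmuK pos bsum[of e1, OF e1V] by (intro mult_mono) auto
        finally show ?thesis by (simp only: C4_def)
      qed
      have LX: "H - C5 \<le> LX"
      proof -
        interpret metric_frame "grad \<Omega> u x0" e w v b d by (rule fr)
        have "LX = (\<Sum>k\<in>UNIV. f k * (norm (e k))\<^sup>2) + (\<Sum>k\<in>UNIV. f k * \<mu> k) * (\<Sum>m\<in>UNIV. b m * x m)"
          unfolding LX_def sum_distrib_right[of _ UNIV "\<Sum>m\<in>UNIV. b m * x m"] by (simp add: distrib_left sum.distrib mult.assoc)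
        moreover have "\<bar>S * (\<Sum>m\<in>UNIV. b m * x m)\<bar> \<le> C5"
          unfolding C5_def abs_mult using fmuK pos bsum[of x, OF xV]
          by (intro mult_mono) auto
        moreover have "H \<le> (\<Sum>k\<in>UNIV. f k * (norm (e k))\<^sup>2)"
        proof -
          have "H \<le> (n - 1) * H" using n2 H0 by simp
          also have "\<dots> = (\<Sum>k\<in>UNIV. f k)" by (simp add: f_def sum_subtractf n_def H_def[symmetric] algebra_simps)
          also have "\<dots> \<le> (\<Sum>k\<in>UNIV. f k * (norm (e k))\<^sup>2)"
          proof (rule sum_mono)
            fix k
            have "f k * 1 \<le> f k * (norm (e k))\<^sup>2" using f0 norm_e_sq[of k] by (intro mult_left_mono) auto
            then show "f k \<le> f k * (norm (e k))\<^sup>2" by simp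
          qed
          finally show ?thesis .
        qed
        ultimately show ?thesis unfolding fmu by linarith
      qed
      show ?case
      proof (rule psi_jets[OF \<Omega> x0 u4 p2 fr c(3) muH fb(5) pos(2) K1 K2, folded n_def M_def], assumption, assumption, assumption, goal_cases)
        case P: (1 P1 P2)
        define s1 where "s1 = (\<lambda>k. \<Sum>i\<in>UNIV. f i * cov_h v b \<mu> T i i k)"
        \<comment> \<open>The equation \<sigma>_2 = \<psi>, differentiated twice along the line by
          uniqueness of jets.\<close>
        have sj: "P1 k = s1 k \<and> P2 k = (\<Sum>i\<in>UNIV. f i * shape_d2 v b \<mu> T Q k i i) + (h1 k)\<^sup>2
            - (\<Sum>i\<in>UNIV. \<Sum>j\<in>UNIV. shape_d1 v b \<mu> T k i j * shape_d1 v b \<mu> T k j i)" for k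
        proof -
          have "\<forall>\<^sub>F t in nhds 0. scal_curv \<Omega> u (x0 + t *\<^sub>R e k)
              = \<psi> (x0 + t *\<^sub>R e k, u (x0 + t *\<^sub>R e k), grad \<Omega> u (x0 + t *\<^sub>R e k))"
          proof (rule eventually_mono[OF eventually_line_in_open[OF \<Omega> x0, of "e k"]])
            fix t assume t: "x0 + t *\<^sub>R e k \<in> \<Omega>"
            show "scal_curv \<Omega> u (x0 + t *\<^sub>R e k)
              = \<psi> (x0 + t *\<^sub>R e k, u (x0 + t *\<^sub>R e k), grad \<Omega> u (x0 + t *\<^sub>R e k))"
              using mean_scal_curv_eq(2)[OF \<Omega> t u4 sp] eq[OF t] by simp
          qed
          from jet2_cong[OF c(9)[of k] this] jet2_unique(2,3)[OF P(1)[of k]]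
          show ?thesis unfolding s1_def f_def H_def h1_def by blast
        qed
        define Dd where "Dd = (\<Sum>k\<in>UNIV. P2 k + \<mu> k * (\<Sum>m\<in>UNIV. b m * P1 m))"
        have simons: "LH = Dd + (\<Sum>k\<in>UNIV. \<Sum>i\<in>UNIV. \<Sum>j\<in>UNIV. (cov_h v b \<mu> T i j k)\<^sup>2) - (\<Sum>k\<in>UNIV. (h1 k)\<^sup>2)
            + (H * (\<Sum>i\<in>UNIV. f i * (\<kappa> i)\<^sup>2) - 2 * \<sigma> * (\<Sum>i\<in>UNIV. (\<kappa> i)\<^sup>2))"
          using simons_identity[where T = T and Q = Q and v = v and \<mu> = \<mu> and b = b, OF c(5) c(6) c(7)] sj
          unfolding LH_def Dd_def h1_def h2_def s1_def f_def H_def sigma[unfolded H_def] vk by simp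
        have P1H: "\<bar>P1 k\<bar> \<le> C2 * H" for k
        proof -
          have "K * (M * (2 * V + H)) \<le> K * (M * (A1 * H))" using A1H pos M0 by (intro mult_left_mono) auto
          then show ?thesis using P(2)[of k] by (simp add: C2_def mult.assoc)
        qed
        have Dge: "- C1 * (H\<^sup>2 + (\<Sum>k\<in>UNIV. \<bar>h1 k\<bar>)) \<le> Dd"
        proof -
          let ?h = "\<Sum>k\<in>UNIV. \<bar>h1 k\<bar>" and ?t = "\<Sum>m\<in>UNIV. \<bar>\<Sum>k\<in>UNIV. T k k m\<bar>"
          have t: "?t \<le> ?h + n * (n + 2) * V * H\<^sup>2"
            unfolding h1_def n_def by (rule third_derivative_trace_bound[OF fb(1-3) muH fb(7)])
          have q1: "n * K * (M * (2 * V + H))\<^sup>2 \<le> n * K * (M * A1)\<^sup>2 * H\<^sup>2"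
          proof -
            have "(M * (2 * V + H))\<^sup>2 \<le> (M * (A1 * H))\<^sup>2"
              using A1H M0 V0 H0 by (intro power_mono mult_left_mono) auto
            then have "n * K * (M * (2 * V + H))\<^sup>2 \<le> n * K * (M * (A1 * H))\<^sup>2" using n0 pos by (intro mult_left_mono) auto
            then show ?thesis by (simp add: power_mult_distrib mult_ac)
          qed
          \<comment> \<open>The bound H \<ge> h0 raises a term of order H to order H^2.\<close>
          have q2: "n * H \<le> n / h0 * H\<^sup>2"
          proof -
            have "H * h0 \<le> H * H" using Hh0 H0 by (intro mult_left_mono) auto
            from mult_left_mono[OF this n0] have "n * (H * h0) \<le> n * (H * H)" .
            then show ?thesis using h0 by (simp add: field_simps power2_eq_square)
          qed
          have q3: "K * (M * (n * H + ?t)) \<le> K * M * (n / h0 + n * (n + 2) * V) * H\<^sup>2 + K * M * ?h"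
          proof -
            have "n * H + ?t \<le> (n / h0 + n * (n + 2) * V) * H\<^sup>2 + ?h" using t q2 by (simp add: distrib_right)
            then have "K * M * (n * H + ?t) \<le> K * M * ((n / h0 + n * (n + 2) * V) * H\<^sup>2 + ?h)"
              using pos M0 by (intro mult_left_mono) auto
            also have "\<dots> = K * M * (n / h0 + n * (n + 2) * V) * H\<^sup>2 + K * M * ?h"
              unfolding distrib_left[of "K * M" "(n / h0 + n * (n + 2) * V) * H\<^sup>2" ?h] by (simp only: mult.assoc)
            finally show ?thesis by (simp only: mult.assoc)
          qed
          have q4: "\<bar>\<Sum>k\<in>UNIV. \<mu> k * (\<Sum>m\<in>UNIV. b m * P1 m)\<bar> \<le> n * n * V * C2 * H\<^sup>2"
            using abs_double_sum_le[OF muH fb(7) P1H] by (simp add: n_def power2_eq_square mult_ac)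
          have q5: "K * M * ?h \<le> C1 * ?h" using C1KM by (intro mult_right_mono) (auto simp: sum_nonneg)
          have q6: "n * K * (M * A1)\<^sup>2 * H\<^sup>2 + K * M * (n / h0 + n * (n + 2) * V) * H\<^sup>2 + n * n * V * C2 * H\<^sup>2 \<le> C1 * H\<^sup>2"
          proof -
            have "C1 * H\<^sup>2 = (n * K * (M * A1)\<^sup>2 * H\<^sup>2 + K * M * (n / h0 + n * (n + 2) * V) * H\<^sup>2 + n * n * V * C2 * H\<^sup>2)
                + K * M * H\<^sup>2"
              by (simp add: C1_def algebra_simps)
            then show ?thesis using pos M0 by simp
          qed
          have "Dd = (\<Sum>k\<in>UNIV. P2 k) + (\<Sum>k\<in>UNIV. \<mu> k * (\<Sum>m\<in>UNIV. b m * P1 m))"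
            by (simp add: Dd_def sum.distrib)
          moreover have "- (n * K * (M * (2 * V + H))\<^sup>2) - K * (M * (n * H + ?t)) \<le> (\<Sum>k\<in>UNIV. P2 k)"
            using P(3) c(4) by simp
          moreover have "- C1 * (H\<^sup>2 + ?h) = - (C1 * H\<^sup>2) - C1 * ?h" by (simp add: algebra_simps)
          ultimately show ?thesis using q1 q3 q4 q5 q6 by linarith
        qed
        have crit: "h1 k / H + real \<beta> * (e1 k / \<eta>) + N * x k = 0" for k using first[of k] by simp
        have e1E: "\<bar>e1 k\<bar> \<le> E" for k using e1V[of k] pos by (simp add: E_def)
        have s1b: "\<bar>s1 k\<bar> \<le> C2 * H" for k using P1H[of k] sj[of k] by simp
        have Nb: "C1 + n * (30 * C2\<^sup>2 + C2\<^sup>2 / (2 * m)) + 2 * K + 2 \<le> N"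
          by (simp add: N_def C3_def)
        note defs = n_def f_def h1_def s1_def H_def
        have "H * \<eta> \<le> C"
          unfolding C_def a'_def C3_def defs
          by (rule pointwise_estimate[where \<kappa> = \<kappa> and x = x and ?e1.0 = e1 and B = "cov_h v b \<mu> T"
                and N = N and \<beta> = "real \<beta>" and \<sigma> = \<sigma> and LH = LH and D = Dd and Le = Le and LX = LX
                and m = m and ?C2.0 = C2,
                OF C10 C40 C50 pos(1) pos(2) RV E0 H0[unfolded defs] sigma[unfolded defs] sig
                  cov_h_sym[where T = T and v = v and b = b and \<mu> = \<mu>, OF c(5) c(6)]
                  simons[unfolded defs] Dge[unfolded defs] s1b[unfolded defs] crit[unfolded defs] xV e1E
                  eta Le LX[unfolded defs] max[unfolded defs] Nb[unfolded defs] beta[unfolded defs]])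
        then show ?case unfolding mc0 \<eta>_def .
      qed
    qed
  qed
  show ?thesis by (rule that[of N \<beta> C]) (use N0 beta(1) main in auto)
qed

section \<open>Barriers and the interior estimate\<close>


text \<open>If u minus the affine function minus \<epsilon> |y - x1|^2 had an interior maximum,
  every \<mu>_k would be at most 2 \<epsilon> V^2, against the lower bound sqrt (2 m) / V for their
  sum w H. So the maximum lies on the boundary, at distance at least \<rho> from \<open>x1\<close>,
  and comparison with \<open>x1\<close> gives the claim.\<close>

lemma barrier:
  fixes \<Omega> :: "(real^'n) set" and u :: "real^'n \<Rightarrow> real" and \<theta> m :: real
  defines "V \<equiv> 1 / sqrt (1 - (1 - \<theta>)\<^sup>2)"
  assumes \<Omega>: "open \<Omega>" "bounded \<Omega>" and u: "Ck_on 4 \<Omega> u" "continuous_on (closure \<Omega>) u"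
    and \<theta>: "0 < \<theta>" "\<theta> < 1" and gr: "\<And>x. x \<in> \<Omega> \<Longrightarrow> norm (grad \<Omega> u x) \<le> 1 - \<theta>"
    and s: "\<And>x. x \<in> \<Omega> \<Longrightarrow> 0 < sigma_k 1 \<Omega> u x" "\<And>x. x \<in> \<Omega> \<Longrightarrow> m \<le> sigma_k 2 \<Omega> u x" and m: "0 < m"
    and bd: "\<And>x. x \<in> frontier \<Omega> \<Longrightarrow> u x = a \<bullet> x + c"
    and x1: "x1 \<in> \<Omega>" and \<rho>: "\<And>y. y \<in> frontier \<Omega> \<Longrightarrow> \<rho> \<le> norm (y - x1)" "0 \<le> \<rho>"
  shows "sqrt (2 * m) / (4 * real CARD('n) * V ^ 3) * \<rho>\<^sup>2 \<le> a \<bullet> x1 + c - u x1"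
proof -
  define n where "n = real CARD('n)"
  \<comment> \<open>The 4 makes n times 2 \<epsilon> V^2 exactly half of sqrt (2 m) / V, a strict
    contradiction.\<close>
  define \<epsilon> where "\<epsilon> = sqrt (2 * m) / (4 * n * V ^ 3)"
  have sp: "norm (grad \<Omega> u x) < 1" if "x \<in> \<Omega>" for x using gr[OF that] \<theta> by linarith
  have u2: "Ck_on 2 \<Omega> u" using Ck_on_mono[OF u(1)] by simp
  have "1 - (1 - \<theta>)\<^sup>2 = \<theta> * (2 - \<theta>)" by (simp add: power2_eq_square algebra_simps)
  then have V0: "0 < V" using \<theta> by (simp add: V_def)
  have n0: "0 < n" by (simp add: n_def)
  have e0: "0 < \<epsilon>" using m n0 V0 by (simp add: \<epsilon>_def)
  let ?g = "\<lambda>y. u y - (a \<bullet> y + c) - \<epsilon> * ((y - x1) \<bullet> (y - x1))"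
  have "compact (closure \<Omega>)" using \<Omega>(2) by (simp add: compact_closure)
  moreover have "closure \<Omega> \<noteq> {}" using x1 by auto
  moreover have "continuous_on (closure \<Omega>) ?g" by (intro continuous_intros u(2))
  ultimately obtain y0 where y0: "y0 \<in> closure \<Omega>" "\<And>y. y \<in> closure \<Omega> \<Longrightarrow> ?g y \<le> ?g y0"
    using continuous_attains_sup[of "closure \<Omega>" ?g] by blast
  have "y0 \<notin> \<Omega>"
  proof
    assume y0O: "y0 \<in> \<Omega>"
    show False
    proof (rule curvature_jets[OF \<Omega>(1) y0O u(1) sp], assumption, goal_cases)
      case cj: (1 e d \<kappa> b \<mu> w v T Q)
      note fb = metric_frame_bounds[OF cj(1) \<theta>(1) gr[OF y0O], folded V_def]
      have le: "\<mu> k \<le> 2 * \<epsilon> * V\<^sup>2" for k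
      proof -
        have uj: "jet2 (\<lambda>t. u (y0 + t *\<^sub>R e k)) (u y0) (partials [e k] u y0) (\<mu> k)"
          using jet2_line[OF \<Omega>(1) y0O u2, of "e k"] cj(3)[of k k] by (simp del: partials.simps)
        let ?z = "y0 - x1"
        have "jet2 (\<lambda>t. u (y0 + t *\<^sub>R e k) - ((a \<bullet> y0 + c) + t * (a \<bullet> e k))
            - \<epsilon> * ((?z \<bullet> ?z + t * (2 * (?z \<bullet> e k))) + (0 + t * 1) * (0 + t * 1) * (e k \<bullet> e k)))
          (u y0 - (a \<bullet> y0 + c) - \<epsilon> * (?z \<bullet> ?z + 0 * 0 * (e k \<bullet> e k)))
          (partials [e k] u y0 - a \<bullet> e k - \<epsilon> * (2 * (?z \<bullet> e k) + ((1 * 0 + 0 * 1) * (e k \<bullet> e k) + 0 * 0 * 0)))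
          (\<mu> k - 0 - \<epsilon> * (0 + ((0 * 0 + 2 * 1 * 1 + 0 * 0) * (e k \<bullet> e k) + 2 * (1 * 0 + 0 * 1) * 0 + 0 * 0 * 0)))"
          by (intro jet2_diff uj jet2_cmult jet2_add jet2_mult jet2_linear jet2_const)
        then have "jet2 (\<lambda>t. ?g (y0 + t *\<^sub>R e k)) (?g y0)
            (partials [e k] u y0 - a \<bullet> e k - \<epsilon> * (2 * (?z \<bullet> e k))) (\<mu> k - \<epsilon> * (2 * (e k \<bullet> e k)))"
          by (simp add: inner_add_left inner_add_right inner_diff_left inner_diff_right inner_commute algebra_simps
              del: partials.simps)
        moreover have "\<forall>\<^sub>F t in nhds 0. ?g (y0 + t *\<^sub>R e k) \<le> ?g y0"
          using closure_subset[of \<Omega>]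
          by (intro eventually_mono[OF eventually_line_in_open[OF \<Omega>(1) y0O, of "e k"]] y0(2)) blast
        ultimately have "\<mu> k - \<epsilon> * (2 * (e k \<bullet> e k)) \<le> 0" by (rule jet2_local_max(2))
        moreover have "e k \<bullet> e k \<le> V\<^sup>2"
          using power_mono[OF fb(6)[of k], of 2] by (simp add: power2_norm_eq_inner)
        then have "\<epsilon> * (2 * (e k \<bullet> e k)) \<le> \<epsilon> * (2 * V\<^sup>2)" using e0 by (intro mult_left_mono) auto
        ultimately show ?thesis by linarith
      qed
      have "(\<Sum>k\<in>UNIV. \<mu> k) \<le> n * (2 * \<epsilon> * V\<^sup>2)"
        using sum_bounded_above[of UNIV \<mu>, OF le] by (simp add: n_def)
      moreover have "(\<Sum>k\<in>UNIV. \<mu> k) = w * sigma_k 1 \<Omega> u y0" unfolding cj(10) cj(2) by (simp add: sum_distrib_left)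
      moreover have "sqrt (2 * m) / V \<le> w * sigma_k 1 \<Omega> u y0"
      proof -
        have "0 \<le> (\<Sum>i\<in>UNIV. (\<kappa> i)\<^sup>2)" by (simp add: sum_nonneg)
        then have "2 * m \<le> (sigma_k 1 \<Omega> u y0)\<^sup>2" using cj(10,11) s(2)[OF y0O] by simp
        then have h: "sqrt (2 * m) \<le> sigma_k 1 \<Omega> u y0" using s(1)[OF y0O] real_le_lsqrt by simp
        have "1 = w * v" using fb(3) by simp
        also have "\<dots> \<le> w * V" using fb(1,5) by (intro mult_left_mono) auto
        finally have "1 / V \<le> w" using V0 by (simp add: divide_le_eq)
        then have "1 / V * sqrt (2 * m) \<le> w * sigma_k 1 \<Omega> u y0"
          using h m V0 fb(1) by (intro mult_mono) auto
        then show ?thesis by simp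
      qed
      ultimately have "sqrt (2 * m) / V \<le> n * (2 * \<epsilon> * V\<^sup>2)" by linarith
      also have "\<dots> = sqrt (2 * m) / V / 2" using n0 V0 by (simp add: \<epsilon>_def eval_nat_numeral)
      finally show False using m V0 by (simp add: divide_le_eq)
    qed
  qed
  then have f: "y0 \<in> frontier \<Omega>" using y0(1) \<Omega>(1) by (simp add: frontier_def interior_open)
  have "?g x1 \<le> ?g y0" using y0(2) x1 closure_subset[of \<Omega>] by blast
  moreover have "\<rho>\<^sup>2 \<le> (y0 - x1) \<bullet> (y0 - x1)"
    using power_mono[OF \<rho>(1)[OF f] \<rho>(2), of 2] by (simp add: power2_norm_eq_inner)
  then have "\<epsilon> * \<rho>\<^sup>2 \<le> \<epsilon> * ((y0 - x1) \<bullet> (y0 - x1))" using e0 by (intro mult_left_mono) auto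
  ultimately have "\<epsilon> * \<rho>\<^sup>2 \<le> a \<bullet> x1 + c - u x1" using bd[OF f] by simp
  then show ?thesis by (simp add: \<epsilon>_def n_def)
qed

text \<open>A function vanishing on the boundary with gradient of length at most \<open>2\<close>, compared with a
  linear function of slope \<open>3\<close>.\<close>

lemma height_bound:
  fixes \<Omega> :: "(real^'n) set" and u :: "real^'n \<Rightarrow> real"
  assumes \<Omega>: "open \<Omega>" and R: "\<And>x. x \<in> closure \<Omega> \<Longrightarrow> norm x \<le> R"
    and u: "Ck_on 2 \<Omega> u" "continuous_on (closure \<Omega>) u"
    and gr: "\<And>x. x \<in> \<Omega> \<Longrightarrow> norm (grad \<Omega> u x) \<le> 1" and a: "norm a \<le> 1"
    and bd: "\<And>x. x \<in> frontier \<Omega> \<Longrightarrow> u x = a \<bullet> x + c" and x1: "x1 \<in> \<Omega>"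
  shows "a \<bullet> x1 + c - u x1 \<le> 6 * R"
proof -
  define L :: "real^'n" where "L = 3 *\<^sub>R axis undefined 1"
  have L: "norm L = 3" by (simp add: L_def)
  let ?g = "\<lambda>y. ((a + L) \<bullet> y + c) - u y"
  have "bounded (closure \<Omega>)" using R by (auto simp: bounded_iff)
  then have "compact (closure \<Omega>)" by (simp add: compact_eq_bounded_closed)
  moreover have "closure \<Omega> \<noteq> {}" using x1 by auto
  moreover have "continuous_on (closure \<Omega>) ?g" by (intro continuous_intros u(2))
  ultimately obtain y0 where y0: "y0 \<in> closure \<Omega>" "\<And>y. y \<in> closure \<Omega> \<Longrightarrow> ?g y \<le> ?g y0"
    using continuous_attains_sup[of "closure \<Omega>" ?g] by blast
  have "y0 \<notin> \<Omega>"
  proof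
    assume y0O: "y0 \<in> \<Omega>"
    \<comment> \<open>The gradient of \<open>?g\<close> at \<open>y0\<close>; the derivative in its
      own direction is |G|^2. Its vanishing would give L = Du - a, of length at most 2.\<close>
    define G where "G = a + L - grad \<Omega> u y0"
    have "jet2 (\<lambda>t. (((a + L) \<bullet> y0 + c) + t * ((a + L) \<bullet> G)) - u (y0 + t *\<^sub>R G)) (?g y0)
        ((a + L) \<bullet> G - partials [G] u y0) (0 - partials [G, G] u y0)"
      by (intro jet2_diff jet2_linear jet2_line[OF \<Omega> y0O u(1)])
    then have "jet2 (\<lambda>t. ?g (y0 + t *\<^sub>R G)) (?g y0) ((a + L) \<bullet> G - partials [G] u y0) (0 - partials [G, G] u y0)"
      by (simp add: inner_add_left inner_add_right algebra_simps del: partials.simps)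
    moreover have "\<forall>\<^sub>F t in nhds 0. ?g (y0 + t *\<^sub>R G) \<le> ?g y0"
      using closure_subset[of \<Omega>]
      by (intro eventually_mono[OF eventually_line_in_open[OF \<Omega> y0O, of G]] y0(2)) blast
    ultimately have "(a + L) \<bullet> G - partials [G] u y0 = 0" by (rule jet2_local_max(1))
    moreover have "partials [G] u y0 = G \<bullet> grad \<Omega> u y0"
    proof -
      have "u differentiable (at y0)"
        using Ck_on_differentiable[of 1 \<Omega> u y0] u(1) y0O by (simp add: numeral_2_eq_2)
      from grad_inner[OF y0O this, of G] show ?thesis by (rule sym)
    qed
    moreover have "G \<bullet> G = (a + L) \<bullet> G - G \<bullet> grad \<Omega> u y0"
    proof -
      have "G \<bullet> G = G \<bullet> (a + L - grad \<Omega> u y0)" by (simp only: G_def)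
      also have "\<dots> = G \<bullet> (a + L) - G \<bullet> grad \<Omega> u y0" by (rule inner_diff_right)
      finally show ?thesis by (simp only: inner_commute[of G "a + L"])
    qed
    ultimately have "G \<bullet> G = 0" by linarith
    then have "G = 0" by simp
    then have "L = grad \<Omega> u y0 - a" by (simp add: G_def algebra_simps)
    then have "norm L \<le> norm (grad \<Omega> u y0) + norm a" by (simp add: norm_triangle_ineq4)
    then show False using L gr[OF y0O] a by linarith
  qed
  then have f: "y0 \<in> frontier \<Omega>" using y0(1) \<Omega>(1) by (simp add: frontier_def interior_open)
  have x1c: "x1 \<in> closure \<Omega>" using x1 closure_subset[of \<Omega>] by blast
  have "?g x1 \<le> ?g y0" using y0(2) x1c by blast
  then have "a \<bullet> x1 + c - u x1 \<le> L \<bullet> y0 - L \<bullet> x1" using bd[OF f] by (simp add: inner_add_left)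
  moreover have "\<bar>L \<bullet> y0\<bar> \<le> 3 * R" "\<bar>L \<bullet> x1\<bar> \<le> 3 * R"
    using Cauchy_Schwarz_ineq2[of L y0] Cauchy_Schwarz_ineq2[of L x1] L R[OF y0(1)] R[OF x1c] by auto
  ultimately show ?thesis by linarith
qed

section \<open>From the hypotheses to the interior estimate\<close>

lemma grad_affine:
  fixes \<Omega> :: "(real^'n) set"
  assumes "open \<Omega>" "x \<in> \<Omega>" "\<And>x. x \<in> \<Omega> \<Longrightarrow> \<phi> x = a \<bullet> x + c"
  shows "grad \<Omega> \<phi> x = a"
proof -
  have "partials [b] \<phi> x = a \<bullet> b" for b
  proof -
    have "((\<lambda>x. a \<bullet> x + c) has_derivative (\<lambda>h. a \<bullet> h)) (at x)"
      by (auto intro!: derivative_eq_intros)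
    from frechet_derivative_at[OF this]
    have "partials [b] (\<lambda>x. a \<bullet> x + c) x = a \<bullet> b" by (metis partials.simps)
    then show ?thesis using partials_cong_on[OF assms(1,3,2), where bs = "[b]"] by simp
  qed
  then show ?thesis using assms(2) by (simp add: grad_def bdry_ext_def vec_eq_iff inner_axis)
qed

text \<open>Continuity up to the boundary is what guarantees that the test function attains its
  maximum on the compact closure, before the maximum is known to be interior.\<close>

lemma continuous_on_mean_curv:
  fixes \<Omega> :: "(real^'n) set"
  assumes u: "Ck_closure 2 \<Omega> u" and gr: "\<And>x. x \<in> closure \<Omega> \<Longrightarrow> norm (grad \<Omega> u x) < 1"
  shows "continuous_on (closure \<Omega>) (mean_curv \<Omega> u)"
proof -
  have b: "axis i 1 \<in> (Basis :: (real^'n) set)" for i by (auto simp: Basis_vec_def)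
  have g: "continuous_on (closure \<Omega>) (\<lambda>x. grad \<Omega> u x $ i)" for i
    using u b[of i] unfolding Ck_closure_def grad_def
    by (auto dest!: spec[of _ 1] bspec[of _ _ "[axis i 1]"] simp: multi_indices_def simp del: partials.simps)
  have h: "continuous_on (closure \<Omega>) (\<lambda>x. hess \<Omega> u x $ i $ j)" for i j
    using u b[of i] b[of j] unfolding Ck_closure_def hess_def
    by (auto dest!: spec[of _ 2] bspec[of _ _ "[axis i 1, axis j 1]"] simp: multi_indices_def simp del: partials.simps)
  have p: "continuous_on (closure \<Omega>) (grad \<Omega> u)"
    using continuous_on_vec_lambda[where S = "closure \<Omega>" and f = "\<lambda>i x. grad \<Omega> u x $ i", OF g] by simp
  have w: "sqrt (1 - (norm (grad \<Omega> u x))\<^sup>2) \<noteq> 0" if "x \<in> closure \<Omega>" for x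
  proof -
    have "(norm (grad \<Omega> u x))\<^sup>2 < 1" using gr[OF that] by (simp add: abs_square_less_1)
    then show ?thesis by simp
  qed
  have "mean_curv \<Omega> u = (\<lambda>x. \<Sum>i\<in>UNIV. 1 / sqrt (1 - (norm (grad \<Omega> u x))\<^sup>2) *
    (\<Sum>k\<in>UNIV. (mat 1 $ i $ k + 1 / (sqrt (1 - (norm (grad \<Omega> u x))\<^sup>2))\<^sup>2 * (grad \<Omega> u x $ i * grad \<Omega> u x $ k)) * hess \<Omega> u x $ k $ i))"
    by (rule ext) (simp add: mean_curv_def trace_def curv_matrix_def Let_def matrix_matrix_mult_def outer_def)
  then show ?thesis using w by (auto intro!: continuous_intros g h p)
qed

text \<open>One derivative at one point is bounded by its summand in the norm, and the other
  summands are nonnegative. The point is taken in \<open>U\<close>, where the extension to the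
  boundary is the derivative itself.\<close>

lemma Ck_norm_bound:
  fixes U D :: "'a::euclidean_space set"
  assumes "Ck_norm k U D f \<le> ereal K" "j \<le> k" "bs \<in> multi_indices j" "y \<in> D" "y \<in> U"
  shows "\<bar>partials bs f y\<bar> \<le> K"
proof -
  let ?t = "\<lambda>j. SUP bs\<in>multi_indices j. SUP x\<in>D. ereal \<bar>bdry_ext U (partials bs f) x\<bar>"
  have nn: "0 \<le> ?t i" for i
  proof -
    obtain b :: 'a where "b \<in> Basis" using nonempty_Basis by blast
    then have "replicate i b \<in> multi_indices i" by (auto simp: multi_indices_def)
    then show ?thesis using assms(4) by (intro SUP_upper2[of "replicate i b"] SUP_upper2[of y]) auto
  qed
  have "ereal \<bar>partials bs f y\<bar> \<le> ?t j"
    using assms(3-5) by (intro SUP_upper2[of bs] SUP_upper2[of y]) (auto simp: bdry_ext_def)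
  also have "\<dots> \<le> (\<Sum>i\<le>k. ?t i)" using sum_mono2[of "{..k}" "{j}" ?t] assms(2) nn by simp
  also have "\<dots> \<le> ereal K" using assms(1) by (simp add: Ck_norm_def)
  finally show ?thesis by simp
qed

text \<open>What the constant may depend on is expressed by the order of quantifiers: the domains
  and the numbers bounding the data precede it, the functions \<phi>, \<psi>, u follow it.\<close>

theorem theorem4p1:
  fixes \<Omega> \<Omega>' :: "(real^'n) set" and \<theta> K m M :: real
  assumes "smooth_bounded_domain \<Omega>" and "admissible_domain 1 \<Omega>"
    and "\<Omega>' \<subset>\<subset> \<Omega>"
    and "0 < \<theta>" and "\<theta> < 1" and "0 < m"
  shows "\<exists>C>0. \<forall>(\<phi> :: real^'n \<Rightarrow> real) (\<psi> :: (real^'n) \<times> real \<times> (real^'n) \<Rightarrow> real) (u :: real^'n \<Rightarrow> real).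
    Ck_on 2 \<Omega> \<phi> \<and> continuous_on (closure \<Omega>) \<phi> \<and>
    spacelike \<Omega> \<phi> \<and> affine_on (closure \<Omega>) \<phi> \<and>
    (\<forall>k. Ck_closure k (psi_dom \<Omega>) \<psi>) \<and> (\<forall>y\<in>closure (psi_dom \<Omega>). \<psi> y > 0) \<and>
    Ck_on 4 \<Omega> u \<and> Ck_closure 2 \<Omega> u \<and> k_admissible 2 \<Omega> u \<and>
    (\<forall>x\<in>\<Omega>. sigma_k 2 \<Omega> u x = \<psi> (x, u x, grad \<Omega> u x)) \<and>
    (\<forall>x\<in>frontier \<Omega>. u x = \<phi> x) \<and>
    (SUP x\<in>closure \<Omega>. ereal (norm (grad \<Omega> u x))) \<le> ereal (1 - \<theta>) \<and>
    Ck_norm 2 (psi_dom \<Omega>) (DD \<Omega> u) \<psi> \<le> ereal K \<and>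
    ereal m \<le> (INF y\<in>DD \<Omega> u. ereal (\<psi> y)) \<and>
    Ck_norm 1 \<Omega> (closure \<Omega>) \<phi> \<le> ereal M
    \<longrightarrow> (SUP x\<in>\<Omega>'. ereal (kappa_max \<Omega> u x)) \<le> ereal C"
proof (cases "\<Omega>' = {}")
  case True
  \<comment> \<open>The supremum over the empty set is minus infinity.\<close>
  then show ?thesis by (intro exI[of _ 1]) (auto simp: bot_ereal_def)
next
  case False
  have \<Omega>: "open \<Omega>" "bounded \<Omega>" using assms(1) by (auto simp: smooth_bounded_domain_def)
  obtain R where R: "0 < R" "\<And>x. x \<in> closure \<Omega> \<Longrightarrow> norm x \<le> R"
    using bounded_closure[OF \<Omega>(2)] unfolding bounded_pos by blast
  obtain \<rho> where \<rho>: "0 < \<rho>" "\<And>x y. x \<in> \<Omega>' \<Longrightarrow> y \<in> frontier \<Omega> \<Longrightarrow> \<rho> \<le> norm (y - x)" and sub: "\<Omega>' \<subseteq> \<Omega>"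
  proof -
    have c: "compact (closure \<Omega>')" "closure \<Omega>' \<subseteq> \<Omega>"
      using assms(3) by (auto simp: compactly_contained_def)
    obtain \<rho> where r: "0 < \<rho>" "(\<Union>x\<in>closure \<Omega>'. ball x \<rho>) \<subseteq> \<Omega>"
      using compact_subset_open_imp_ball_epsilon_subset[OF c(1) \<Omega>(1) c(2)] by blast
    have "\<rho> \<le> norm (y - x)" if "x \<in> \<Omega>'" "y \<in> frontier \<Omega>" for x y
    proof (rule ccontr)
      assume "\<not> ?thesis"
      then have "y \<in> ball x \<rho>" by (simp add: dist_norm norm_minus_commute)
      moreover have "x \<in> closure \<Omega>'" using that(1) closure_subset by blast
      ultimately have "y \<in> \<Omega>" using r(2) by blast
      then show False using that(2) \<Omega>(1) by (simp add: frontier_def interior_open)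
    qed
    moreover have "\<Omega>' \<subseteq> \<Omega>" using c(2) closure_subset by blast
    ultimately show ?thesis using that r(1) by blast
  qed
  \<comment> \<open>The absolute value supplies the nonnegative bound required, since
    \<open>K\<close> is an arbitrary real here.\<close>
  obtain N \<beta> C where NC: "0 \<le> N" "1 \<le> \<beta>" and est:
    "\<And>u \<psi> a c x0. \<lbrakk>dirichlet_data \<Omega> R \<theta> \<bar>K\<bar> m u \<psi> a c; x0 \<in> \<Omega>;
       \<And>x. x \<in> \<Omega> \<Longrightarrow> mean_curv \<Omega> u x * (a \<bullet> x + c - u x) ^ \<beta> * exp (N * ((norm x)\<^sup>2 / 2))
         \<le> mean_curv \<Omega> u x0 * (a \<bullet> x0 + c - u x0) ^ \<beta> * exp (N * ((norm x0)\<^sup>2 / 2))\<rbrakk>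
       \<Longrightarrow> mean_curv \<Omega> u x0 * (a \<bullet> x0 + c - u x0) \<le> C"
    using max_point_estimate[OF \<Omega>(1) assms(4,5,6) abs_ge_zero[of K] less_imp_le[OF R(1)]] by metis
  define V where "V = 1 / sqrt (1 - (1 - \<theta>)\<^sup>2)"
  define \<delta> where "\<delta> = sqrt (2 * m) / (4 * real CARD('n) * V ^ 3) * \<rho>\<^sup>2"
  have "1 - (1 - \<theta>)\<^sup>2 = \<theta> * (2 - \<theta>)" by (simp add: power2_eq_square algebra_simps)
  then have V0: "0 < V" using assms(4,5) by (simp add: V_def)
  have \<delta>0: "0 < \<delta>" using V0 \<rho>(1) assms(6) by (simp add: \<delta>_def)
  \<comment> \<open>On \<Omega>' the test function is at least H \<delta>^\<beta>; at its maximum it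
    is (H \<eta>) \<eta>^(\<beta> - 1) times the exponential, with H \<eta> \<le> C and \<eta> \<le>
    6 R. The final 1 makes the constant positive.\<close>
  define C' where "C' = \<bar>C\<bar> * (6 * R) ^ (\<beta> - 1) * exp (N * (R\<^sup>2 / 2)) / \<delta> ^ \<beta> + 1"
  have C'0: "0 < C'" using \<delta>0 R(1) by (auto simp: C'_def intro!: add_nonneg_pos divide_nonneg_pos)
  show ?thesis
  proof (intro exI[of _ C'] conjI C'0 allI impI, elim conjE)
    fix \<phi> u :: "real^'n \<Rightarrow> real" and \<psi> :: "(real^'n) \<times> real \<times> (real^'n) \<Rightarrow> real"
    assume \<phi>: "spacelike \<Omega> \<phi>" "affine_on (closure \<Omega>) \<phi>"
      and \<psi>: "\<forall>k. Ck_closure k (psi_dom \<Omega>) \<psi>"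
      and u: "Ck_on 4 \<Omega> u" "Ck_closure 2 \<Omega> u" "k_admissible 2 \<Omega> u"
      and eq: "\<forall>x\<in>\<Omega>. sigma_k 2 \<Omega> u x = \<psi> (x, u x, grad \<Omega> u x)"
      and bd: "\<forall>x\<in>frontier \<Omega>. u x = \<phi> x"
      and gr: "(SUP x\<in>closure \<Omega>. ereal (norm (grad \<Omega> u x))) \<le> ereal (1 - \<theta>)"
      and K: "Ck_norm 2 (psi_dom \<Omega>) (DD \<Omega> u) \<psi> \<le> ereal K"
      and m: "ereal m \<le> (INF y\<in>DD \<Omega> u. ereal (\<psi> y))"
    obtain a c where ac: "\<And>x. x \<in> closure \<Omega> \<Longrightarrow> \<phi> x = a \<bullet> x + c" using \<phi>(2) by (auto simp: affine_on_def)
    have cl: "x \<in> closure \<Omega>" if "x \<in> \<Omega>" for x using that closure_subset by blast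
    have fcl: "x \<in> closure \<Omega>" if "x \<in> frontier \<Omega>" for x using that by (simp add: frontier_def)
    have gr': "norm (grad \<Omega> u x) \<le> 1 - \<theta>" if "x \<in> closure \<Omega>" for x
    proof -
      have "ereal (norm (grad \<Omega> u x)) \<le> (SUP x\<in>closure \<Omega>. ereal (norm (grad \<Omega> u x)))"
        using that by (rule SUP_upper)
      also note gr
      finally show ?thesis by simp
    qed
    have gr1: "norm (grad \<Omega> u x) < 1" if "x \<in> closure \<Omega>" for x using gr'[OF that] assms(4) by linarith
    \<comment> \<open>The vector \<open>a\<close> is the gradient of \<phi>, which is
      spacelike.\<close>
    have na: "norm a \<le> 1"
    proof -
      obtain x where x: "x \<in> \<Omega>" using False sub by blast
      have "grad \<Omega> \<phi> x = a" by (rule grad_affine[OF \<Omega>(1) x, of \<phi> a c]) (use ac cl in auto)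
      then have "ereal (norm a) \<le> (SUP x\<in>closure \<Omega>. ereal (norm (grad \<Omega> \<phi> x)))"
        using cl[OF x] by (intro SUP_upper2[of x]) auto
      also have "\<dots> < 1" using \<phi>(1) by (simp add: spacelike_def)
      finally show ?thesis by (simp add: one_ereal_def)
    qed
    have cu: "continuous_on (closure \<Omega>) u" using u(2) by (simp add: Ck_closure_def)
    have u2: "Ck_on 2 \<Omega> u" using u(2) by (simp add: Ck_closure_def)
    have bd': "u x = a \<bullet> x + c" if "x \<in> frontier \<Omega>" for x using bd ac[OF fcl[OF that]] that by simp
    have s1: "0 < sigma_k 1 \<Omega> u x" and s2: "0 < sigma_k 2 \<Omega> u x" if "x \<in> \<Omega>" for x
      using u(3) cl[OF that] by (auto simp: k_admissible_def)
    \<comment> \<open>Boundedness of u is checked first, because real infima and suprema are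
      meaningful only for bounded sets.\<close>
    have inDD: "(x, u x, grad \<Omega> u x) \<in> DD \<Omega> u" if "x \<in> \<Omega>" for x
    proof -
      have "compact (u ` closure \<Omega>)"
        using compact_continuous_image[OF cu] \<Omega>(2) by (simp add: compact_closure)
      then have "bounded (u ` \<Omega>)" by (meson bounded_subset closure_subset compact_imp_bounded image_mono)
      then have "bdd_below (u ` \<Omega>)" "bdd_above (u ` \<Omega>)"
        by (simp_all add: bounded_imp_bdd_below bounded_imp_bdd_above)
      then show ?thesis using that cl[OF that] by (auto simp: DD_def intro: cINF_lower cSUP_upper)
    qed
    have inpsi: "(x, u x, grad \<Omega> u x) \<in> psi_dom \<Omega>" if "x \<in> \<Omega>" for x using that by (simp add: psi_dom_def)
    have mpsi: "m \<le> \<psi> (x, u x, grad \<Omega> u x)" if "x \<in> \<Omega>" for x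
    proof -
      note m
      also have "(INF y\<in>DD \<Omega> u. ereal (\<psi> y)) \<le> ereal (\<psi> (x, u x, grad \<Omega> u x))"
        using inDD[OF that] by (rule INF_lower)
      finally show ?thesis by simp
    qed
    have Kpsi: "\<bar>partials bs \<psi> (x, u x, grad \<Omega> u x)\<bar> \<le> \<bar>K\<bar>"
      if "x \<in> \<Omega>" "set bs \<subseteq> Basis" "length bs \<le> 2" for x bs
      using Ck_norm_bound[OF K that(3), of bs, OF _ inDD[OF that(1)] inpsi[OF that(1)]] that(2)
      by (auto simp: multi_indices_def)
    have low: "\<delta> \<le> a \<bullet> x + c - u x" if "x \<in> \<Omega>'" for x
      unfolding \<delta>_def V_def
      by (rule barrier[OF \<Omega> u(1) cu assms(4,5) gr'[OF cl] s1 _ assms(6) bd'])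
         (use that sub \<rho> mpsi eq in auto)
    \<comment> \<open>The barrier again, now with a ball around an arbitrary interior point; this is
      qualitative, and only the bound on \<Omega>' enters the constant.\<close>
    have eta_pos: "0 < a \<bullet> x + c - u x" if x: "x \<in> \<Omega>" for x
    proof -
      obtain r where r: "0 < r" "ball x r \<subseteq> \<Omega>" using \<Omega>(1) x openE by blast
      have fr: "r \<le> norm (y - x)" if "y \<in> frontier \<Omega>" for y
      proof (rule ccontr)
        assume "\<not> ?thesis"
        then have "y \<in> ball x r" by (simp add: dist_norm norm_minus_commute)
        then show False using r(2) that \<Omega>(1) by (auto simp: frontier_def interior_open)
      qed
      have "sqrt (2 * m) / (4 * real CARD('n) * V ^ 3) * r\<^sup>2 \<le> a \<bullet> x + c - u x"
        unfolding V_def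
        by (rule barrier[OF \<Omega> u(1) cu assms(4,5) gr'[OF cl] s1 _ assms(6) bd'])
           (use x fr r(1) mpsi eq in auto)
      moreover have "0 < sqrt (2 * m) / (4 * real CARD('n) * V ^ 3) * r\<^sup>2"
        using V0 r(1) assms(6) by simp
      ultimately show ?thesis by linarith
    qed
    have eta_le: "a \<bullet> x + c - u x \<le> 6 * R" if "x \<in> \<Omega>" for x
      by (rule height_bound[OF \<Omega>(1) R(2) u2 cu _ na bd' that]) (use gr1 cl in \<open>auto intro: less_imp_le\<close>)
    have data: "dirichlet_data \<Omega> R \<theta> \<bar>K\<bar> m u \<psi> a c"
      unfolding dirichlet_data_def
    proof (intro conjI ballI)
      show "Ck_on 2 (psi_dom \<Omega>) \<psi>" using \<psi> by (simp add: Ck_closure_def)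
      fix x assume x: "x \<in> \<Omega>"
      show "\<psi> (x, u x, grad \<Omega> u x) \<le> \<bar>K\<bar>" using Kpsi[OF x, of "[]"] by simp
      show "\<bar>partials [i] \<psi> (x, u x, grad \<Omega> u x)\<bar> \<le> \<bar>K\<bar>" if "i \<in> Basis" for i
        by (rule Kpsi[OF x]) (use that in auto)
      show "\<bar>partials [j, i] \<psi> (x, u x, grad \<Omega> u x)\<bar> \<le> \<bar>K\<bar>" if "i \<in> Basis" "j \<in> Basis" for i j
        by (rule Kpsi[OF x]) (use that in auto)
    qed (use u(1) na R(2) cl gr' s1 eta_pos eta_le eq mpsi in auto)
    define Z where "Z = (\<lambda>x. mean_curv \<Omega> u x * (a \<bullet> x + c - u x) ^ \<beta> * exp (N * ((norm x)\<^sup>2 / 2)))"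
    have mc: "0 < mean_curv \<Omega> u x" "kappa_max \<Omega> u x \<le> mean_curv \<Omega> u x" if "x \<in> \<Omega>" for x
      using mean_scal_curv_eq(1,3)[OF \<Omega>(1) that u(1) gr1[OF cl]] s1[OF that] s2[OF that] by simp_all
    have "compact (closure \<Omega>)" using \<Omega>(2) by (simp add: compact_closure)
    moreover have "closure \<Omega> \<noteq> {}" using False sub cl by blast
    moreover have "continuous_on (closure \<Omega>) Z"
      unfolding Z_def by (intro continuous_intros continuous_on_mean_curv[OF u(2) gr1] cu) auto
    ultimately obtain x0 where x0: "x0 \<in> closure \<Omega>" "\<And>y. y \<in> closure \<Omega> \<Longrightarrow> Z y \<le> Z x0"
      using continuous_attains_sup[of "closure \<Omega>" Z] by blast
    have Zpos: "0 < Z x" if "x \<in> \<Omega>" for x using mc(1)[OF that] eta_pos[OF that] by (simp add: Z_def)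
    \<comment> \<open>Because \<beta> \<ge> 1, the test function vanishes on the boundary, while it
      is positive inside.\<close>
    have x0\<Omega>: "x0 \<in> \<Omega>"
    proof (rule ccontr)
      assume "x0 \<notin> \<Omega>"
      then have "x0 \<in> frontier \<Omega>" using x0(1) \<Omega>(1) by (simp add: frontier_def interior_open)
      then have "Z x0 = 0" using bd' NC(2) by (simp add: Z_def)
      obtain x where "x \<in> \<Omega>" using False sub by blast
      then show False using Zpos[of x] x0(2)[OF cl[of x]] \<open>Z x0 = 0\<close> by simp
    qed
    have Cx0: "mean_curv \<Omega> u x0 * (a \<bullet> x0 + c - u x0) \<le> C"
      by (rule est[OF data x0\<Omega>]) (use x0(2) cl in \<open>auto simp: Z_def\<close>)
    have Z0: "Z x0 \<le> \<bar>C\<bar> * (6 * R) ^ (\<beta> - 1) * exp (N * (R\<^sup>2 / 2))"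
    proof -
      let ?e = "a \<bullet> x0 + c - u x0"
      have "?e ^ \<beta> = ?e * ?e ^ (\<beta> - 1)" using NC(2) by (cases \<beta>) auto
      then have "Z x0 = (mean_curv \<Omega> u x0 * ?e) * ?e ^ (\<beta> - 1) * exp (N * ((norm x0)\<^sup>2 / 2))"
        by (simp add: Z_def)
      also have "\<dots> \<le> \<bar>C\<bar> * (6 * R) ^ (\<beta> - 1) * exp (N * (R\<^sup>2 / 2))"
      proof (intro mult_mono power_mono)
        show "mean_curv \<Omega> u x0 * ?e \<le> \<bar>C\<bar>" using Cx0 by linarith
        have "(norm x0)\<^sup>2 \<le> R\<^sup>2" using R(2)[OF x0(1)] by (intro power_mono) auto
        then show "exp (N * ((norm x0)\<^sup>2 / 2)) \<le> exp (N * (R\<^sup>2 / 2))" using NC(1) by (simp add: mult_left_mono)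
      qed (use eta_pos[OF x0\<Omega>] eta_le[OF x0\<Omega>] R(1) in auto)
      finally show ?thesis .
    qed
    show "(SUP x\<in>\<Omega>'. ereal (kappa_max \<Omega> u x)) \<le> ereal C'"
    proof (rule SUP_least)
      fix x assume x': "x \<in> \<Omega>'"
      then have x: "x \<in> \<Omega>" using sub by blast
      \<comment> \<open>The factor 1 bounds the exponential from below, as N \<ge> 0.\<close>
      have "mean_curv \<Omega> u x * \<delta> ^ \<beta> * 1 \<le> Z x"
        unfolding Z_def using low[OF x'] \<delta>0 mc(1)[OF x] NC(1)
        by (intro mult_mono power_mono) (auto intro: less_imp_le)
      also have "\<dots> \<le> \<bar>C\<bar> * (6 * R) ^ (\<beta> - 1) * exp (N * (R\<^sup>2 / 2))"
        using x0(2)[OF cl[OF x]] Z0 by linarith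
      finally have "mean_curv \<Omega> u x \<le> \<bar>C\<bar> * (6 * R) ^ (\<beta> - 1) * exp (N * (R\<^sup>2 / 2)) / \<delta> ^ \<beta>"
        using \<delta>0 by (simp add: le_divide_eq)
      then show "ereal (kappa_max \<Omega> u x) \<le> ereal C'" using mc(2)[OF x] by (simp add: C'_def)
    qed
  qed
qed

end
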